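(* Let $R$ be a commutative ring that is Noetherian and hereditary. Then there is a duality between monoids (respectively groups) and commutative $R$-bialgebras (respectively commutative Hopf $R$-algebras) through the right-adjoint contravariant functors $$\mathcal{R}(-):\mathbf{Mon}\to\mathbf{CBig}_R,\qquad\mathrm{Alg}_R(-,R):\mathbf{CBig}_R\to\mathbf{Mon},$$ respectively $$\mathcal{R}(-):\mathbf{Gr}\to\mathbf{CHopf}_R,\qquad\mathrm{Alg}_R(-,R):\mathbf{CHopf}_R\to\mathbf{Gr}.$$
   Context: $R$ is hereditary if every ideal of $R$ is projective. $\mathbf{Mon}$, $\mathbf{Gr}$ are the categories of monoids and groups; $\mathbf{CBig}_R$, $\mathbf{CHopf}_R$ the categories of commutative $R$-bialgebras and commutative Hopf $R$-algebras. For a monoid $G$, $\mathcal{R}(G)=\{f\in R^G: GfG\text{ is finitely generated in }\mathcal{M}_R\}$, i.e. the $R$-submodule of $R^G$ spanned by the two-sided translates $x\mapsto f(gxg')$ ($g,g'\in G$) is finitely generated over $R$. It is identified with $(RG)^{\circ}=\{f\in(RG)^*: f(I)=0\text{ for some two-sided ideal }I\text{ of }RG\text{ with }RG/I\text{ finitely generated over }R\}$, where $RG$ is the monoid bialgebra with $\Delta(x)=x\otimes x$, $\varepsilon(x)=1$ for $x\in G$ (and antipode $x\mapsto x^{-1}$ if $G$ is a group). Its bialgebra structure is dual to that of $RG$: pointwise multiplication, comultiplication determined by $f(xy)=\sum f_1(x)f_2(y)$, counit $f\mapsto f(e)$, and for a group antipode $S(f)(x)=f(x^{-1})$. For a commutative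 $R$-bialgebra $H$, $\mathrm{Alg}_R(H,R)$ is the set of $R$-algebra morphisms $H\to R$ with the convolution product $(f\star g)(h)=\sum f(h_1)g(h_2)$ and unit $\varepsilon_H$. That the contravariant functors are right-adjoint means that there are bijections, natural in $G$ and $H$, between monoid (group) morphisms $G\to\mathrm{Alg}_R(H,R)$ and bialgebra (Hopf algebra) morphisms $H\to\mathcal{R}(G)$. *)

theory Defs
  imports "HOL-Algebra.Algebra" "HOL-Algebra.Free_Abelian_Groups"
begin

section \<open>Modules, projectivity, hereditary rings\<close>

definition module_hom ::
    "('a, 'r) ring_scheme \<Rightarrow> ('a, 'm, 'x) module_scheme \<Rightarrow> ('a, 'n, 'y) module_scheme \<Rightarrow> ('m \<Rightarrow> 'n) set"
  where "module_hom R M N =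
    {f \<in> carrier M \<rightarrow> carrier N.
       (\<forall>x \<in> carrier M. \<forall>y \<in> carrier M. f (x \<oplus>\<^bsub>M\<^esub> y) = f x \<oplus>\<^bsub>N\<^esub> f y) \<and>
       (\<forall>r \<in> carrier R. \<forall>x \<in> carrier M. f (r \<odot>\<^bsub>M\<^esub> x) = r \<odot>\<^bsub>N\<^esub> f x)}"

text \<open>The usual lifting property.  HOL cannot quantify over all types inside a definition, so the
  test modules live on fixed types.  This is no restriction: the free module on \<^term>\<open>carrier P\<close>
  consists of functions of type \<open>'p \<Rightarrow> 'a\<close>, so the canonical surjection from it onto \<open>P\<close>
  is one of the test maps, and lifting the identity along it makes \<open>P\<close> a direct summand of a
  free module.\<close>

definition projective_module :: "('a, 'r) ring_scheme \<Rightarrow> ('a, 'p, 'z) module_scheme \<Rightarrow> bool"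
  where "projective_module R P \<longleftrightarrow> module R P \<and>
    (\<forall>(M :: ('a, 'p \<Rightarrow> 'a) module) (N :: ('a, 'p) module) g f.
       module R M \<and> module R N \<and> g \<in> module_hom R M N \<and> g ` carrier M = carrier N \<and>
       f \<in> module_hom R P N
       \<longrightarrow> (\<exists>h \<in> module_hom R P M. \<forall>x \<in> carrier P. g (h x) = f x))"

definition reg_module :: "('a, 'r) ring_scheme \<Rightarrow> ('a, 'a) module"
  where "reg_module R =
    \<lparr>carrier = carrier R, monoid.mult = monoid.mult R, one = \<one>\<^bsub>R\<^esub>,
     ring.zero = \<zero>\<^bsub>R\<^esub>, add = add R, smult = monoid.mult R\<rparr>"

definition hereditary_ring :: "('a, 'r) ring_scheme \<Rightarrow> bool"
  where "hereditary_ring R \<longleftrightarrow>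
    (\<forall>I. ideal I R \<longrightarrow> projective_module R ((reg_module R)\<lparr>carrier := I\<rparr>))"

definition module_span :: "('a, 'r) ring_scheme \<Rightarrow> ('a, 'm, 'x) module_scheme \<Rightarrow> 'm set \<Rightarrow> 'm set"
  where "module_span R M S = \<Inter>{N. submodule N R M \<and> S \<subseteq> N}"

definition fg_submodule :: "('a, 'r) ring_scheme \<Rightarrow> ('a, 'm, 'x) module_scheme \<Rightarrow> 'm set \<Rightarrow> bool"
  where "fg_submodule R M N \<longleftrightarrow>
    submodule N R M \<and> (\<exists>F. finite F \<and> F \<subseteq> N \<and> module_span R M F = N)"

definition alg_hom ::
    "('a, 'r) ring_scheme \<Rightarrow> ('a, 'm, 'x) module_scheme \<Rightarrow> ('a, 'n, 'y) module_scheme \<Rightarrow> ('m \<Rightarrow> 'n) set"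
  where "alg_hom R A B = ring_hom A B \<inter> module_hom R A B"


section \<open>Tensor products\<close>

text \<open>\<open>M \<otimes>\<^sub>R N\<close> is the free Abelian group on \<open>M \<times> N\<close> modulo the subgroup generated by the
  relations below; its elements are cosets.\<close>

type_synonym ('m, 'n) tens = "(('m \<times> 'n) \<Rightarrow>\<^sub>0 int) set"

definition tensor_rels ::
    "('a, 'r) ring_scheme \<Rightarrow> ('a, 'm, 'x) module_scheme \<Rightarrow> ('a, 'n, 'y) module_scheme
     \<Rightarrow> (('m \<times> 'n) \<Rightarrow>\<^sub>0 int) set"
  where "tensor_rels R M N =
    {frag_of (m \<oplus>\<^bsub>M\<^esub> m', n) - frag_of (m, n) - frag_of (m', n) | m m' n.
       m \<in> carrier M \<and> m' \<in> carrier M \<and> n \<in> carrier N} \<union>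
    {frag_of (m, n \<oplus>\<^bsub>N\<^esub> n') - frag_of (m, n) - frag_of (m, n') | m n n'.
       m \<in> carrier M \<and> n \<in> carrier N \<and> n' \<in> carrier N} \<union>
    {frag_of (r \<odot>\<^bsub>M\<^esub> m, n) - frag_of (m, r \<odot>\<^bsub>N\<^esub> n) | r m n.
       r \<in> carrier R \<and> m \<in> carrier M \<and> n \<in> carrier N}"

definition tensor_group ::
    "('a, 'r) ring_scheme \<Rightarrow> ('a, 'm, 'x) module_scheme \<Rightarrow> ('a, 'n, 'y) module_scheme
     \<Rightarrow> ('m, 'n) tens monoid"
  where "tensor_group R M N =
    (let F = free_Abelian_group (carrier M \<times> carrier N) in F Mod generate F (tensor_rels R M N))"

definition tensor_class ::
    "('a, 'r) ring_scheme \<Rightarrow> ('a, 'm, 'x) module_scheme \<Rightarrow> ('a, 'n, 'y) module_scheme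
     \<Rightarrow> (('m \<times> 'n) \<Rightarrow>\<^sub>0 int) \<Rightarrow> ('m, 'n) tens"
  where "tensor_class R M N u =
    (let F = free_Abelian_group (carrier M \<times> carrier N) in generate F (tensor_rels R M N) #>\<^bsub>F\<^esub> u)"

definition pure_tensor ::
    "('a, 'r) ring_scheme \<Rightarrow> ('a, 'm, 'x) module_scheme \<Rightarrow> ('a, 'n, 'y) module_scheme
     \<Rightarrow> 'm \<Rightarrow> 'n \<Rightarrow> ('m, 'n) tens"
  where "pure_tensor R M N m n = tensor_class R M N (frag_of (m, n))"

text \<open>Scalars act by \<open>r (m \<otimes> n) = (r m) \<otimes> n\<close>.  The multiplication
  \<open>(m \<otimes> n) (m' \<otimes> n') = m m' \<otimes> n n'\<close> and the unit are meaningful when \<open>M\<close> and \<open>N\<close> are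
  algebras.  The resulting coset does not depend on
  the representatives \<open>u\<close>, \<open>v\<close>, so the unions are unions of equal sets, as in \<^const>\<open>set_mult\<close>.\<close>

definition tensor ::
    "('a, 'r) ring_scheme \<Rightarrow> ('a, 'm, 'x) module_scheme \<Rightarrow> ('a, 'n, 'y) module_scheme
     \<Rightarrow> ('a, ('m, 'n) tens) module"
  where "tensor R M N =
    \<lparr>carrier = carrier (tensor_group R M N),
     monoid.mult = (\<lambda>s t. \<Union>u\<in>s. \<Union>v\<in>t. tensor_class R M N
        (frag_extend (\<lambda>(m, n). frag_extend (\<lambda>(m', n'). frag_of (m \<otimes>\<^bsub>M\<^esub> m', n \<otimes>\<^bsub>N\<^esub> n')) v) u)),
     one = pure_tensor R M N \<one>\<^bsub>M\<^esub> \<one>\<^bsub>N\<^esub>,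
     ring.zero = \<one>\<^bsub>tensor_group R M N\<^esub>,
     add = monoid.mult (tensor_group R M N),
     smult = (\<lambda>r t. \<Union>u\<in>t. tensor_class R M N
        (frag_extend (\<lambda>(m, n). frag_of (r \<odot>\<^bsub>M\<^esub> m, n)) u))\<rparr>"

text \<open>For an \<open>R\<close>-bilinear map \<open>\<beta> : M \<times> N \<rightarrow> P\<close>, \<open>tensor_lift P \<beta>\<close> is the induced map
  \<open>M \<otimes>\<^sub>R N \<rightarrow> P\<close>, \<open>m \<otimes> n \<mapsto> \<beta> m n\<close>: all representatives of a tensor give the same value in
  \<open>P\<close>, so the image set is a singleton.  Thus \<open>tensor_lift P \<beta> (\<Delta> h)\<close> is the Sweedler expression
  \<open>\<Sum> \<beta> h\<^sub>1 h\<^sub>2\<close>.\<close>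

definition tensor_lift ::
    "('p, 'z) ring_scheme \<Rightarrow> ('m \<Rightarrow> 'n \<Rightarrow> 'p) \<Rightarrow> ('m, 'n) tens \<Rightarrow> 'p"
  where "tensor_lift P \<beta> t = the_elem
    ((\<lambda>u. finsum P (\<lambda>p. add_pow P (Poly_Mapping.lookup u p) (\<beta> (fst p) (snd p))) (Poly_Mapping.keys u)) ` t)"

definition tensor_map ::
    "('a, 'r) ring_scheme \<Rightarrow> ('a, 'm, 'x) module_scheme \<Rightarrow> ('a, 'n, 'y) module_scheme
     \<Rightarrow> ('k \<Rightarrow> 'm) \<Rightarrow> ('l \<Rightarrow> 'n) \<Rightarrow> ('k, 'l) tens \<Rightarrow> ('m, 'n) tens"
  where "tensor_map R M N f g =
    tensor_lift (tensor R M N) (\<lambda>k l. pure_tensor R M N (f k) (g l))"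

definition tensor_assoc ::
    "('a, 'r) ring_scheme \<Rightarrow> ('a, 'm, 'x) module_scheme \<Rightarrow> ('a, 'n, 'y) module_scheme
     \<Rightarrow> ('a, 'p, 'z) module_scheme \<Rightarrow> (('m, 'n) tens, 'p) tens \<Rightarrow> ('m, ('n, 'p) tens) tens"
  where "tensor_assoc R M N P =
    (let T = tensor R M (tensor R N P) in
     tensor_lift T (\<lambda>t p. tensor_lift T
       (\<lambda>m n. pure_tensor R M (tensor R N P) m (pure_tensor R N P n p)) t))"


section \<open>Commutative bialgebras and Hopf algebras\<close>

record ('a, 'h) bialg = "('a, 'h) module" +
  comul :: "'h \<Rightarrow> ('h, 'h) tens"
  counit :: "'h \<Rightarrow> 'a"

record ('a, 'h) hopf = "('a, 'h) bialg" +
  antipode :: "'h \<Rightarrow> 'h"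

text \<open>The library locale \<^locale>\<open>algebra\<close> already means commutative algebra over a commutative
  ring.\<close>

locale comm_bialgebra = algebra R H
  for R :: "('a, 'r) ring_scheme" (structure) and H :: "('a, 'h, 'z) bialg_scheme" (structure) +
  assumes comul_hom: "comul H \<in> alg_hom R H (tensor R H H)"
    and counit_hom: "counit H \<in> alg_hom R H (reg_module R)"
    and coassoc: "h \<in> carrier H \<Longrightarrow>
      tensor_assoc R H H H (tensor_map R (tensor R H H) H (comul H) id (comul H h)) =
      tensor_map R H (tensor R H H) id (comul H) (comul H h)"
    and counit_left: "h \<in> carrier H \<Longrightarrow>
      tensor_lift H (\<lambda>a b. counit H a \<odot>\<^bsub>H\<^esub> b) (comul H h) = h"
    and counit_right: "h \<in> carrier H \<Longrightarrow>
      tensor_lift H (\<lambda>a b. counit H b \<odot>\<^bsub>H\<^esub> a) (comul H h) = h"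

locale comm_hopf_algebra = comm_bialgebra R H
  for R :: "('a, 'r) ring_scheme" (structure) and H :: "('a, 'h, 'z) hopf_scheme" (structure) +
  assumes antipode_linear: "antipode H \<in> module_hom R H H"
    and antipode_left: "h \<in> carrier H \<Longrightarrow>
      tensor_lift H (\<lambda>a b. antipode H a \<otimes>\<^bsub>H\<^esub> b) (comul H h) = counit H h \<odot>\<^bsub>H\<^esub> \<one>\<^bsub>H\<^esub>"
    and antipode_right: "h \<in> carrier H \<Longrightarrow>
      tensor_lift H (\<lambda>a b. a \<otimes>\<^bsub>H\<^esub> antipode H b) (comul H h) = counit H h \<odot>\<^bsub>H\<^esub> \<one>\<^bsub>H\<^esub>"

text \<open>Morphisms are taken extensional, so that equality of morphisms is equality of functions on
  the carrier.\<close>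

definition bialg_hom ::
    "('a, 'r) ring_scheme \<Rightarrow> ('a, 'h, 'x) bialg_scheme \<Rightarrow> ('a, 'k, 'y) bialg_scheme \<Rightarrow> ('h \<Rightarrow> 'k) set"
  where "bialg_hom R H K =
    {\<alpha> \<in> alg_hom R H K \<inter> extensional (carrier H).
       (\<forall>h \<in> carrier H. comul K (\<alpha> h) = tensor_map R K K \<alpha> \<alpha> (comul H h)) \<and>
       (\<forall>h \<in> carrier H. counit K (\<alpha> h) = counit H h)}"

definition hopf_hom ::
    "('a, 'r) ring_scheme \<Rightarrow> ('a, 'h, 'x) hopf_scheme \<Rightarrow> ('a, 'k, 'y) hopf_scheme \<Rightarrow> ('h \<Rightarrow> 'k) set"
  where "hopf_hom R H K =
    {\<alpha> \<in> bialg_hom R H K. \<forall>h \<in> carrier H. \<alpha> (antipode H h) = antipode K (\<alpha> h)}"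

definition mon_hom :: "('g, 'x) monoid_scheme \<Rightarrow> ('k, 'y) monoid_scheme \<Rightarrow> ('g \<Rightarrow> 'k) set"
  where "mon_hom G K = {\<phi> \<in> hom G K \<inter> extensional (carrier G). \<phi> \<one>\<^bsub>G\<^esub> = \<one>\<^bsub>K\<^esub>}"

definition grp_hom :: "('g, 'x) monoid_scheme \<Rightarrow> ('k, 'y) monoid_scheme \<Rightarrow> ('g \<Rightarrow> 'k) set"
  where "grp_hom G K = hom G K \<inter> extensional (carrier G)"


section \<open>The functor of representative functions\<close>

definition fun_algebra :: "('a, 'r) ring_scheme \<Rightarrow> ('g, 'x) monoid_scheme \<Rightarrow> ('a, 'g \<Rightarrow> 'a) module"
  where "fun_algebra R G =
    \<lparr>carrier = carrier G \<rightarrow>\<^sub>E carrier R,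
     monoid.mult = (\<lambda>f f'. \<lambda>x\<in>carrier G. f x \<otimes>\<^bsub>R\<^esub> f' x),
     one = (\<lambda>x\<in>carrier G. \<one>\<^bsub>R\<^esub>),
     ring.zero = (\<lambda>x\<in>carrier G. \<zero>\<^bsub>R\<^esub>),
     add = (\<lambda>f f'. \<lambda>x\<in>carrier G. f x \<oplus>\<^bsub>R\<^esub> f' x),
     smult = (\<lambda>r f. \<lambda>x\<in>carrier G. r \<otimes>\<^bsub>R\<^esub> f x)\<rparr>"

definition translates :: "('g, 'x) monoid_scheme \<Rightarrow> ('g \<Rightarrow> 'a) \<Rightarrow> ('g \<Rightarrow> 'a) set"
  where "translates G f =
    {(\<lambda>x\<in>carrier G. f (g \<otimes>\<^bsub>G\<^esub> x \<otimes>\<^bsub>G\<^esub> g')) | g g'. g \<in> carrier G \<and> g' \<in> carrier G}"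

definition rep_functions :: "('a, 'r) ring_scheme \<Rightarrow> ('g, 'x) monoid_scheme \<Rightarrow> ('g \<Rightarrow> 'a) set"
  where "rep_functions R G =
    {f \<in> carrier G \<rightarrow>\<^sub>E carrier R.
       fg_submodule R (fun_algebra R G) (module_span R (fun_algebra R G) (translates G f))}"

definition rep_algebra :: "('a, 'r) ring_scheme \<Rightarrow> ('g, 'x) monoid_scheme \<Rightarrow> ('a, 'g \<Rightarrow> 'a) module"
  where "rep_algebra R G = (fun_algebra R G)\<lparr>carrier := rep_functions R G\<rparr>"

text \<open>\<open>is_rep_comul R G f t\<close> says that \<open>t = \<Sum> f\<^sub>1 \<otimes> f\<^sub>2\<close> satisfies
  \<open>f (x y) = \<Sum> f\<^sub>1 x f\<^sub>2 y\<close>.  Existence and uniqueness of \<open>t\<close> are not automatic.\<close>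

definition is_rep_comul ::
    "('a, 'r) ring_scheme \<Rightarrow> ('g, 'x) monoid_scheme \<Rightarrow> ('g \<Rightarrow> 'a) \<Rightarrow> ('g \<Rightarrow> 'a, 'g \<Rightarrow> 'a) tens \<Rightarrow> bool"
  where "is_rep_comul R G f t \<longleftrightarrow>
    t \<in> carrier (tensor R (rep_algebra R G) (rep_algebra R G)) \<and>
    (\<forall>x \<in> carrier G. \<forall>y \<in> carrier G.
       f (x \<otimes>\<^bsub>G\<^esub> y) = tensor_lift R (\<lambda>f1 f2. f1 x \<otimes>\<^bsub>R\<^esub> f2 y) t)"

definition rep_bialg :: "('a, 'r) ring_scheme \<Rightarrow> ('g, 'x) monoid_scheme \<Rightarrow> ('a, 'g \<Rightarrow> 'a) bialg"
  where "rep_bialg R G = module.extend (rep_algebra R G)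
    \<lparr>comul = (\<lambda>f. THE t. is_rep_comul R G f t),
     counit = (\<lambda>f. f \<one>\<^bsub>G\<^esub>)\<rparr>"

definition rep_hopf :: "('a, 'r) ring_scheme \<Rightarrow> ('g, 'x) monoid_scheme \<Rightarrow> ('a, 'g \<Rightarrow> 'a) hopf"
  where "rep_hopf R G = bialg.extend (rep_bialg R G)
    \<lparr>antipode = (\<lambda>f. \<lambda>x\<in>carrier G. f (inv\<^bsub>G\<^esub> x))\<rparr>"

definition rep_map ::
    "('a, 'r) ring_scheme \<Rightarrow> ('g, 'x) monoid_scheme \<Rightarrow> ('k, 'y) monoid_scheme
     \<Rightarrow> ('g \<Rightarrow> 'k) \<Rightarrow> ('k \<Rightarrow> 'a) \<Rightarrow> ('g \<Rightarrow> 'a)"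
  where "rep_map R G K \<phi> = (\<lambda>f\<in>rep_functions R K. compose (carrier G) f \<phi>)"


section \<open>The functor of algebra morphisms to the base ring\<close>

definition alg_points ::
    "('a, 'r) ring_scheme \<Rightarrow> ('a, 'h, 'z) bialg_scheme \<Rightarrow> ('h \<Rightarrow> 'a) monoid"
  where "alg_points R H =
    \<lparr>carrier = alg_hom R H (reg_module R) \<inter> extensional (carrier H),
     monoid.mult = (\<lambda>f g. \<lambda>h\<in>carrier H. tensor_lift R (\<lambda>a b. f a \<otimes>\<^bsub>R\<^esub> g b) (comul H h)),
     one = restrict (counit H) (carrier H)\<rparr>"

definition alg_points_map ::
    "('a, 'r) ring_scheme \<Rightarrow> ('a, 'h, 'x) bialg_scheme \<Rightarrow> ('a, 'k, 'y) bialg_scheme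
     \<Rightarrow> ('h \<Rightarrow> 'k) \<Rightarrow> ('k \<Rightarrow> 'a) \<Rightarrow> ('h \<Rightarrow> 'a)"
  where "alg_points_map R H K \<alpha> = (\<lambda>f\<in>carrier (alg_points R K). compose (carrier H) f \<alpha>)"

text \<open>The adjunction bijection sends \<open>\<phi> : G \<rightarrow> Alg\<^sub>R(H, R)\<close> to \<open>h \<mapsto> (g \<mapsto> \<phi>(g)(h))\<close>.\<close>

definition transpose_hom ::
    "('g, 'x) monoid_scheme \<Rightarrow> ('h, 'y) monoid_scheme \<Rightarrow> ('g \<Rightarrow> 'h \<Rightarrow> 'a) \<Rightarrow> ('h \<Rightarrow> 'g \<Rightarrow> 'a)"
  where "transpose_hom G H \<phi> = (\<lambda>h\<in>carrier H. \<lambda>g\<in>carrier G. \<phi> g h)"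

end

theory Submission
  imports Defs
begin

text \<open>
  The heart of the matter is that a tensor of representative functions is determined by its values.
  Let \<open>L\<close> be a finitely generated module of functions \<open>G \<rightarrow> R\<close>.  Since \<open>R\<close> is Noetherian, finitely
  many points of \<open>G\<close> separate the elements of \<open>L\<close> (\<open>fg_functions_separated\<close>), so \<open>L\<close> embeds into a
  finite power of \<open>R\<close>.  Evaluation at one of these points maps \<open>L\<close> onto an ideal, which is projective
  because \<open>R\<close> is hereditary; splitting off one ideal after the other shows that \<open>L\<close> has a finite dual
  basis (\<open>separated_finite_rank\<close>).  With a dual basis of \<open>L\<close>, a tensor in \<open>L \<otimes> N\<close> whose values
  under all \<open>x \<otimes> e\<close> vanish, where \<open>x\<close> is a point of \<open>G\<close> and \<open>e\<close> is from a separating family of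
  functionals on \<open>N\<close>, is zero; and every tensor over a large module of functions comes from a
  finitely generated one (\<open>tensor_functions_eqI\<close>).

  Consequently the comultiplication of a representative function \<open>f\<close> is unique, and all laws
  of the bialgebra \<open>\<R>(G)\<close> reduce to identities between functions on powers of \<open>G\<close>, where they express
  the laws of \<open>G\<close>.  For the existence of the comultiplication let \<open>(b\<^sub>i, \<phi>\<^sub>i)\<close> be a dual basis of
  the module generated by the translates of \<open>f\<close>.  Then \<open>f (x y) = \<Sum> b\<^sub>i(x) \<phi>\<^sub>i(f (_ y))\<close>, and the
  functions \<open>y \<mapsto> \<phi>\<^sub>i(f (_ y))\<close> are matrix coefficients of the translation action of \<open>G\<close>, hence
  representative (\<open>rep_comul_ex1\<close>).

  On the other side, the points of a bialgebra form a monoid under convolution by coassociativity.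
  For a Hopf algebra the inverse of a point \<open>p\<close> is \<open>p \<circ> S\<close>, which is multiplicative because it is a
  convolution inverse of a multiplicative functional (\<open>conv_inverse_alg_hom\<close>).

  Finally, a monoid morphism \<open>G \<rightarrow> Alg\<^sub>R(H, R)\<close> and a bialgebra morphism \<open>H \<rightarrow> \<R>(G)\<close> are both functions
  of two arguments \<open>g\<close> and \<open>h\<close> with values in \<open>R\<close>, and the adjunction exchanges the arguments.  The
  twofold comultiplication of \<open>h\<close> shows that the function of \<open>g\<close> belonging to \<open>h\<close> is representative
  (\<open>transpose_rep_function\<close>), and multiplicativity in \<open>g\<close> corresponds to compatibility with the
  comultiplication because the latter can be tested on values.
\<close>

section \<open>Linear and bilinear maps\<close>

lemma module_homI:
  assumes "\<And>x. x \<in> carrier M \<Longrightarrow> f x \<in> carrier N"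
    and "\<And>x y. \<lbrakk>x \<in> carrier M; y \<in> carrier M\<rbrakk> \<Longrightarrow> f (x \<oplus>\<^bsub>M\<^esub> y) = f x \<oplus>\<^bsub>N\<^esub> f y"
    and "\<And>r x. \<lbrakk>r \<in> carrier R; x \<in> carrier M\<rbrakk> \<Longrightarrow> f (r \<odot>\<^bsub>M\<^esub> x) = r \<odot>\<^bsub>N\<^esub> f x"
  shows "f \<in> module_hom R M N"
  using assms unfolding module_hom_def by auto

lemma module_homD:
  assumes "f \<in> module_hom R M N"
  shows "\<And>x. x \<in> carrier M \<Longrightarrow> f x \<in> carrier N"
    and "\<And>x y. \<lbrakk>x \<in> carrier M; y \<in> carrier M\<rbrakk> \<Longrightarrow> f (x \<oplus>\<^bsub>M\<^esub> y) = f x \<oplus>\<^bsub>N\<^esub> f y"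
    and "\<And>r x. \<lbrakk>r \<in> carrier R; x \<in> carrier M\<rbrakk> \<Longrightarrow> f (r \<odot>\<^bsub>M\<^esub> x) = r \<odot>\<^bsub>N\<^esub> f x"
  using assms unfolding module_hom_def by auto

lemma module_hom_zero:
  assumes "module R M" "module R N" "f \<in> module_hom R M N"
  shows "f \<zero>\<^bsub>M\<^esub> = \<zero>\<^bsub>N\<^esub>"
proof -
  interpret M: module R M by fact
  interpret N: module R N by fact
  have "f (\<zero>\<^bsub>R\<^esub> \<odot>\<^bsub>M\<^esub> \<zero>\<^bsub>M\<^esub>) = \<zero>\<^bsub>R\<^esub> \<odot>\<^bsub>N\<^esub> f \<zero>\<^bsub>M\<^esub>"
    by (rule module_homD(3)[OF assms(3)]) auto
  then show ?thesis using module_homD(1)[OF assms(3), of "\<zero>\<^bsub>M\<^esub>"] by simp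
qed

lemma module_hom_comp:
  assumes "f \<in> module_hom R M N" "g \<in> module_hom R N P"
  shows "(\<lambda>x. g (f x)) \<in> module_hom R M P"
  by (rule module_homI) (simp_all add: module_homD[OF assms(1)] module_homD[OF assms(2)])

lemma module_hom_plus:
  assumes "module R N" "f \<in> module_hom R M N" "g \<in> module_hom R M N"
  shows "(\<lambda>x. f x \<oplus>\<^bsub>N\<^esub> g x) \<in> module_hom R M N"
proof -
  interpret N: module R N by fact
  show ?thesis
    by (rule module_homI)
       (simp_all add: module_homD[OF assms(2)] module_homD[OF assms(3)] N.smult_r_distr N.M.add.m_ac)
qed

lemma module_hom_scale:
  assumes "module R N" "f \<in> module_hom R M N" "r \<in> carrier R"
  shows "(\<lambda>x. r \<odot>\<^bsub>N\<^esub> f x) \<in> module_hom R M N"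
proof -
  interpret N: module R N by fact
  have "r \<odot>\<^bsub>N\<^esub> (s \<odot>\<^bsub>N\<^esub> y) = s \<odot>\<^bsub>N\<^esub> (r \<odot>\<^bsub>N\<^esub> y)" if "s \<in> carrier R" "y \<in> carrier N" for s y
    using that assms(3) by (metis N.smult_assoc1 N.R.m_comm)
  then show ?thesis
    by (intro module_homI) (simp_all add: module_homD[OF assms(2)] assms(3) N.smult_r_distr)
qed

lemma module_hom_id: "(\<lambda>x. x) \<in> module_hom R M M"
  by (rule module_homI) auto

lemma module_hom_const_zero:
  assumes "module R N"
  shows "(\<lambda>x. \<zero>\<^bsub>N\<^esub>) \<in> module_hom R M N"
proof -
  interpret N: module R N by fact
  show ?thesis by (rule module_homI) auto
qed

lemma module_hom_cong:
  assumes "f \<in> module_hom R M N" "module R M" "\<And>x. x \<in> carrier M \<Longrightarrow> f x = g x"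
  shows "g \<in> module_hom R M N"
proof -
  interpret M: module R M by fact
  show ?thesis
    by (rule module_homI) (simp_all add: module_homD[OF assms(1)] assms(3)[symmetric])
qed

lemma reg_module_simps [simp]:
  "carrier (reg_module R) = carrier R" "monoid.mult (reg_module R) = monoid.mult R"
  "one (reg_module R) = one R" "ring.zero (reg_module R) = ring.zero R"
  "add (reg_module R) = add R" "smult (reg_module R) = monoid.mult R"
  by (simp_all add: reg_module_def)

lemma reg_module_module: "cring R \<Longrightarrow> module R (reg_module R)"
proof -
  assume "cring R"
  then interpret R: cring R .
  show ?thesis
  proof (rule moduleI)
    show "abelian_group (reg_module R)"
      by (rule abelian_groupI)
         (auto simp: R.add.m_ac intro: exI[of _ "\<ominus>\<^bsub>R\<^esub> x" for x] bexI[of _ "\<ominus>\<^bsub>R\<^esub> x" for x] R.l_neg)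
  qed (auto simp: R.l_distr R.r_distr R.m_assoc \<open>cring R\<close>)
qed

definition bilinear ::
    "('a, 'r) ring_scheme \<Rightarrow> ('a, 'm, 'x) module_scheme \<Rightarrow> ('a, 'n, 'y) module_scheme
     \<Rightarrow> ('a, 'p, 'z) module_scheme \<Rightarrow> ('m \<Rightarrow> 'n \<Rightarrow> 'p) \<Rightarrow> bool"
  where "bilinear R M N P \<beta> \<longleftrightarrow>
    (\<forall>m \<in> carrier M. \<beta> m \<in> module_hom R N P) \<and>
    (\<forall>n \<in> carrier N. (\<lambda>m. \<beta> m n) \<in> module_hom R M P)"

lemma bilinearI:
  assumes "\<And>m. m \<in> carrier M \<Longrightarrow> \<beta> m \<in> module_hom R N P"
    and "\<And>n. n \<in> carrier N \<Longrightarrow> (\<lambda>m. \<beta> m n) \<in> module_hom R M P"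
  shows "bilinear R M N P \<beta>"
  using assms unfolding bilinear_def by blast

lemma bilinearD:
  assumes "bilinear R M N P \<beta>"
  shows "\<And>m. m \<in> carrier M \<Longrightarrow> \<beta> m \<in> module_hom R N P"
    and "\<And>n. n \<in> carrier N \<Longrightarrow> (\<lambda>m. \<beta> m n) \<in> module_hom R M P"
    and "\<And>m n. \<lbrakk>m \<in> carrier M; n \<in> carrier N\<rbrakk> \<Longrightarrow> \<beta> m n \<in> carrier P"
    and "\<And>m n n'. \<lbrakk>m \<in> carrier M; n \<in> carrier N; n' \<in> carrier N\<rbrakk> \<Longrightarrow> \<beta> m (n \<oplus>\<^bsub>N\<^esub> n') = \<beta> m n \<oplus>\<^bsub>P\<^esub> \<beta> m n'"
    and "\<And>m m' n. \<lbrakk>m \<in> carrier M; m' \<in> carrier M; n \<in> carrier N\<rbrakk> \<Longrightarrow> \<beta> (m \<oplus>\<^bsub>M\<^esub> m') n = \<beta> m n \<oplus>\<^bsub>P\<^esub> \<beta> m' n"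
    and "\<And>r m n. \<lbrakk>r \<in> carrier R; m \<in> carrier M; n \<in> carrier N\<rbrakk> \<Longrightarrow> \<beta> (r \<odot>\<^bsub>M\<^esub> m) n = r \<odot>\<^bsub>P\<^esub> \<beta> m n"
    and "\<And>r m n. \<lbrakk>r \<in> carrier R; m \<in> carrier M; n \<in> carrier N\<rbrakk> \<Longrightarrow> \<beta> m (r \<odot>\<^bsub>N\<^esub> n) = r \<odot>\<^bsub>P\<^esub> \<beta> m n"
proof -
  have 1: "\<And>m. m \<in> carrier M \<Longrightarrow> \<beta> m \<in> module_hom R N P"
    and 2: "\<And>n. n \<in> carrier N \<Longrightarrow> (\<lambda>m. \<beta> m n) \<in> module_hom R M P"
    using assms unfolding bilinear_def by blast+
  show "\<And>m. m \<in> carrier M \<Longrightarrow> \<beta> m \<in> module_hom R N P"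
    "\<And>n. n \<in> carrier N \<Longrightarrow> (\<lambda>m. \<beta> m n) \<in> module_hom R M P" using 1 2 by auto
  show "\<And>m n. \<lbrakk>m \<in> carrier M; n \<in> carrier N\<rbrakk> \<Longrightarrow> \<beta> m n \<in> carrier P"
    using module_homD(1)[OF 1] .
  show "\<And>m n n'. \<lbrakk>m \<in> carrier M; n \<in> carrier N; n' \<in> carrier N\<rbrakk> \<Longrightarrow> \<beta> m (n \<oplus>\<^bsub>N\<^esub> n') = \<beta> m n \<oplus>\<^bsub>P\<^esub> \<beta> m n'"
    using module_homD(2)[OF 1] .
  show "\<And>r m n. \<lbrakk>r \<in> carrier R; m \<in> carrier M; n \<in> carrier N\<rbrakk> \<Longrightarrow> \<beta> m (r \<odot>\<^bsub>N\<^esub> n) = r \<odot>\<^bsub>P\<^esub> \<beta> m n"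
    using module_homD(3)[OF 1] .
  show "\<And>m m' n. \<lbrakk>m \<in> carrier M; m' \<in> carrier M; n \<in> carrier N\<rbrakk> \<Longrightarrow> \<beta> (m \<oplus>\<^bsub>M\<^esub> m') n = \<beta> m n \<oplus>\<^bsub>P\<^esub> \<beta> m' n"
    using module_homD(2)[OF 2] .
  show "\<And>r m n. \<lbrakk>r \<in> carrier R; m \<in> carrier M; n \<in> carrier N\<rbrakk> \<Longrightarrow> \<beta> (r \<odot>\<^bsub>M\<^esub> m) n = r \<odot>\<^bsub>P\<^esub> \<beta> m n"
    using module_homD(3)[OF 2] .
qed

text \<open>The tensor product has to serve as the target of balanced maps before it is known to be a module:
its scalar multiplication is itself obtained by lifting.  Hence a notion for targets that are mere
Abelian groups, in which scalars can only be moved across the tensor sign.\<close>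

definition balanced ::
    "('a, 'r) ring_scheme \<Rightarrow> ('a, 'm, 'x) module_scheme \<Rightarrow> ('a, 'n, 'y) module_scheme
     \<Rightarrow> ('p, 'z) ring_scheme \<Rightarrow> ('m \<Rightarrow> 'n \<Rightarrow> 'p) \<Rightarrow> bool"
  where "balanced R M N P \<beta> \<longleftrightarrow>
    (\<forall>m \<in> carrier M. \<forall>n \<in> carrier N. \<beta> m n \<in> carrier P) \<and>
    (\<forall>m \<in> carrier M. \<forall>m' \<in> carrier M. \<forall>n \<in> carrier N. \<beta> (m \<oplus>\<^bsub>M\<^esub> m') n = \<beta> m n \<oplus>\<^bsub>P\<^esub> \<beta> m' n) \<and>
    (\<forall>m \<in> carrier M. \<forall>n \<in> carrier N. \<forall>n' \<in> carrier N. \<beta> m (n \<oplus>\<^bsub>N\<^esub> n') = \<beta> m n \<oplus>\<^bsub>P\<^esub> \<beta> m n') \<and>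
    (\<forall>r \<in> carrier R. \<forall>m \<in> carrier M. \<forall>n \<in> carrier N. \<beta> (r \<odot>\<^bsub>M\<^esub> m) n = \<beta> m (r \<odot>\<^bsub>N\<^esub> n))"

lemma balancedI:
  assumes "\<And>m n. \<lbrakk>m \<in> carrier M; n \<in> carrier N\<rbrakk> \<Longrightarrow> \<beta> m n \<in> carrier P"
    and "\<And>m m' n. \<lbrakk>m \<in> carrier M; m' \<in> carrier M; n \<in> carrier N\<rbrakk> \<Longrightarrow> \<beta> (m \<oplus>\<^bsub>M\<^esub> m') n = \<beta> m n \<oplus>\<^bsub>P\<^esub> \<beta> m' n"
    and "\<And>m n n'. \<lbrakk>m \<in> carrier M; n \<in> carrier N; n' \<in> carrier N\<rbrakk> \<Longrightarrow> \<beta> m (n \<oplus>\<^bsub>N\<^esub> n') = \<beta> m n \<oplus>\<^bsub>P\<^esub> \<beta> m n'"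
    and "\<And>r m n. \<lbrakk>r \<in> carrier R; m \<in> carrier M; n \<in> carrier N\<rbrakk> \<Longrightarrow> \<beta> (r \<odot>\<^bsub>M\<^esub> m) n = \<beta> m (r \<odot>\<^bsub>N\<^esub> n)"
  shows "balanced R M N P \<beta>"
  using assms unfolding balanced_def by blast

lemma balancedD:
  assumes "balanced R M N P \<beta>"
  shows "\<And>m n. \<lbrakk>m \<in> carrier M; n \<in> carrier N\<rbrakk> \<Longrightarrow> \<beta> m n \<in> carrier P"
    and "\<And>m m' n. \<lbrakk>m \<in> carrier M; m' \<in> carrier M; n \<in> carrier N\<rbrakk> \<Longrightarrow> \<beta> (m \<oplus>\<^bsub>M\<^esub> m') n = \<beta> m n \<oplus>\<^bsub>P\<^esub> \<beta> m' n"
    and "\<And>m n n'. \<lbrakk>m \<in> carrier M; n \<in> carrier N; n' \<in> carrier N\<rbrakk> \<Longrightarrow> \<beta> m (n \<oplus>\<^bsub>N\<^esub> n') = \<beta> m n \<oplus>\<^bsub>P\<^esub> \<beta> m n'"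
    and "\<And>r m n. \<lbrakk>r \<in> carrier R; m \<in> carrier M; n \<in> carrier N\<rbrakk> \<Longrightarrow> \<beta> (r \<odot>\<^bsub>M\<^esub> m) n = \<beta> m (r \<odot>\<^bsub>N\<^esub> n)"
  using assms unfolding balanced_def by blast+

lemma bilinear_balanced: "bilinear R M N P \<beta> \<Longrightarrow> balanced R M N P \<beta>"
  by (rule balancedI) (simp_all add: bilinearD)

section \<open>The tensor product\<close>

text \<open>The homomorphism from the free Abelian group that extends the function \<open>b\<close> on the generators.  The
lift of \<open>\<beta>\<close> to the tensor product is its value on any representative.\<close>

definition frag_eval ::
    "('p, 'z) ring_scheme \<Rightarrow> ('i \<Rightarrow> 'p) \<Rightarrow> ('i \<Rightarrow>\<^sub>0 int) \<Rightarrow> 'p"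
  where "frag_eval P b u =
    finsum P (\<lambda>p. add_pow P (Poly_Mapping.lookup u p) (b p)) (Poly_Mapping.keys u)"

lemma frag_eval_superset:
  assumes "abelian_group P" "b ` A \<subseteq> carrier P" "finite A" "Poly_Mapping.keys u \<subseteq> A"
  shows "frag_eval P b u = finsum P (\<lambda>p. add_pow P (Poly_Mapping.lookup u p) (b p)) A"
proof -
  interpret P: abelian_group P by fact
  show ?thesis
    unfolding frag_eval_def
  proof (rule P.add.finprod_mono_neutral_cong_left)
    show "\<And>i. i \<in> A - Poly_Mapping.keys u \<Longrightarrow> add_pow P (Poly_Mapping.lookup u i) (b i) = \<zero>\<^bsub>P\<^esub>"
      by (simp add: in_keys_iff add_pow_def)
  qed (use assms in auto)
qed

lemma frag_eval_of:
  assumes "abelian_group P" "b p \<in> carrier P"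
  shows "frag_eval P b (frag_of p) = b p"
proof -
  interpret P: abelian_group P by fact
  show ?thesis using assms(2) by (simp add: frag_eval_def)
qed

lemma frag_eval_hom:
  fixes b :: "'i \<Rightarrow> 'p"
  assumes "abelian_group P" "b ` S \<subseteq> carrier P"
  shows "frag_eval P b \<in> hom (free_Abelian_group S) (add_monoid P)"
proof -
  interpret P: abelian_group P by fact
  show ?thesis
  proof (rule homI; clarsimp)
    fix u :: "'i \<Rightarrow>\<^sub>0 int" assume "Poly_Mapping.keys u \<subseteq> S"
    then show "frag_eval P b u \<in> carrier P"
      unfolding frag_eval_def using assms(2) by (intro P.finsum_closed) auto
  next
    fix u v :: "'i \<Rightarrow>\<^sub>0 int" assume uv: "Poly_Mapping.keys u \<subseteq> S" "Poly_Mapping.keys v \<subseteq> S"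
    let ?A = "Poly_Mapping.keys u \<union> Poly_Mapping.keys v"
    have A: "b ` ?A \<subseteq> carrier P" using uv assms(2) by blast
    note sup = frag_eval_superset[OF assms(1) A]
    have bc: "\<And>p. p \<in> ?A \<Longrightarrow> b p \<in> carrier P" using A by blast
    have "frag_eval P b (u + v) = finsum P (\<lambda>p. add_pow P (Poly_Mapping.lookup (u + v) p) (b p)) ?A"
      by (rule sup) (use keys_add[of u v] in auto)
    also have "\<dots> = finsum P (\<lambda>p. add_pow P (Poly_Mapping.lookup u p) (b p) \<oplus>\<^bsub>P\<^esub>
                                add_pow P (Poly_Mapping.lookup v p) (b p)) ?A"
      by (rule P.finsum_cong') (auto simp: lookup_add P.add.int_pow_mult bc)
    also have "\<dots> = frag_eval P b u \<oplus>\<^bsub>P\<^esub> frag_eval P b v"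
      by (subst P.finsum_addf) (auto simp: sup bc)
    finally show "frag_eval P b (u + v) = frag_eval P b u \<oplus>\<^bsub>P\<^esub> frag_eval P b v" .
  qed
qed

lemma frag_eval_diff:
  assumes "abelian_group P" "b ` S \<subseteq> carrier P" "Poly_Mapping.keys u \<subseteq> S" "Poly_Mapping.keys v \<subseteq> S"
  shows "frag_eval P b (u - v) = frag_eval P b u \<ominus>\<^bsub>P\<^esub> frag_eval P b v"
proof -
  interpret P: abelian_group P by fact
  have h: "frag_eval P b \<in> hom (free_Abelian_group S) (add_monoid P)"
    by (rule frag_eval_hom[OF assms(1,2)])
  have k: "Poly_Mapping.keys (u - v) \<subseteq> S" using keys_diff[of u v] assms(3,4) by blast
  have "frag_eval P b ((u - v) \<otimes>\<^bsub>free_Abelian_group S\<^esub> v) = frag_eval P b (u - v) \<oplus>\<^bsub>P\<^esub> frag_eval P b v"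
    using hom_mult[OF h, of "u - v" v] k assms(4) by simp
  moreover have "frag_eval P b (u - v) \<in> carrier P" "frag_eval P b v \<in> carrier P"
    using hom_in_carrier[OF h] k assms(4) by auto
  ultimately show ?thesis by (simp add: a_minus_def P.a_assoc P.r_neg)
qed

lemma tensor_lift_eq: "tensor_lift P \<beta> t = the_elem (frag_eval P (\<lambda>p. \<beta> (fst p) (snd p)) ` t)"
  by (simp add: tensor_lift_def frag_eval_def)

text \<open>The regular module and the ring are records of different types with the same additive group.  Through
this identity, the evaluation of tensors by scalar valued forms becomes a case of lifting into a module.\<close>

lemma tensor_lift_reg:
  fixes R :: "('a, 'r) ring_scheme" and \<beta> :: "'m \<Rightarrow> 'n \<Rightarrow> 'a"
  shows "tensor_lift (reg_module R) \<beta> = tensor_lift R \<beta>"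
proof -
  have "add_pow (reg_module R) (k :: int) x = add_pow R k x" for k x
    by (simp add: add_pow_def int_pow_def nat_pow_def m_inv_def Let_def)
  moreover have "finsum (reg_module R) f A = finsum R f A" for f :: "'m \<times> 'n \<Rightarrow> 'a" and A
    by (simp add: finsum_def finprod_def)
  ultimately show ?thesis by (simp add: tensor_lift_def fun_eq_iff finsum_def finprod_def)
qed

lemma tensor_simps:
  "carrier (tensor R M N) = carrier (tensor_group R M N)"
  "add (tensor R M N) = monoid.mult (tensor_group R M N)"
  "ring.zero (tensor R M N) = \<one>\<^bsub>tensor_group R M N\<^esub>"
  "one (tensor R M N) = pure_tensor R M N \<one>\<^bsub>M\<^esub> \<one>\<^bsub>N\<^esub>"
  by (simp_all add: tensor_def)

abbreviation (input) free_pairs :: "('a, 'x) partial_object_scheme \<Rightarrow> ('b, 'y) partial_object_scheme \<Rightarrow> ('a \<times> 'b \<Rightarrow>\<^sub>0 int) monoid"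
  where "free_pairs M N \<equiv> free_Abelian_group (carrier M \<times> carrier N)"

abbreviation (input) "tensor_kernel R M N \<equiv> generate (free_pairs M N) (tensor_rels R M N)"

context
  fixes R :: "('a, 'r) ring_scheme" and M :: "('a, 'm, 'x) module_scheme" and N :: "('a, 'n, 'y) module_scheme"
  assumes M: "module R M" and N: "module R N"
begin

interpretation M: module R M by (fact M)
interpretation N: module R N by (fact N)

lemma tensor_rels_carrier: "tensor_rels R M N \<subseteq> carrier (free_pairs M N)"
  unfolding tensor_rels_def by (auto dest!: keys_diff[THEN subsetD])

lemma tensor_subgroup: "subgroup (tensor_kernel R M N) (free_pairs M N)"
  by (rule group.generate_is_subgroup[OF group_free_Abelian_group tensor_rels_carrier])

lemma tensor_normal: "(tensor_kernel R M N) \<lhd> (free_pairs M N)"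
  by (rule comm_group.subgroup_imp_normal[OF abelian_free_Abelian_group tensor_subgroup])

lemma tensor_group_eq: "tensor_group R M N = (free_pairs M N) Mod (tensor_kernel R M N)"
  by (simp add: tensor_group_def Let_def)

lemma tensor_class_eq: "tensor_class R M N u = (tensor_kernel R M N) #>\<^bsub>free_pairs M N\<^esub> u"
  by (simp add: tensor_class_def Let_def)

lemma tensor_abelian_group: "abelian_group (tensor R M N)"
proof -
  have "comm_group (tensor_group R M N)"
    unfolding tensor_group_eq
    by (rule comm_group.abelian_FactGroup[OF abelian_free_Abelian_group tensor_subgroup])
  then interpret T: comm_group "tensor_group R M N" .
  show ?thesis
  proof (rule abelian_groupI; unfold tensor_simps)
    fix x assume "x \<in> carrier (tensor_group R M N)"
    then show "\<exists>y\<in>carrier (tensor_group R M N). y \<otimes>\<^bsub>tensor_group R M N\<^esub> x = \<one>\<^bsub>tensor_group R M N\<^esub>"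
      by (intro bexI[of _ "inv\<^bsub>tensor_group R M N\<^esub> x"]) auto
  qed (simp_all add: T.m_ac)
qed

lemma tensor_class_hom: "tensor_class R M N \<in> hom (free_pairs M N) (add_monoid (tensor R M N))"
proof -
  have "(\<lambda>a. (tensor_kernel R M N) #>\<^bsub>free_pairs M N\<^esub> a) \<in> hom (free_pairs M N) ((free_pairs M N) Mod (tensor_kernel R M N))"
    by (rule normal.r_coset_hom_Mod[OF tensor_normal])
  then show ?thesis
    unfolding hom_def by (auto simp: tensor_simps tensor_group_eq tensor_class_eq Pi_def)
qed

lemma tensor_carrier: "carrier (tensor R M N) = tensor_class R M N ` carrier (free_pairs M N)"
  by (simp add: tensor_simps tensor_group_eq tensor_class_eq carrier_FactGroup cong: image_cong)

lemma tensor_class_rel: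
  assumes "u \<in> tensor_rels R M N"
  shows "tensor_class R M N u = \<zero>\<^bsub>tensor R M N\<^esub>"
proof -
  have "u \<in> (tensor_kernel R M N)" using assms by (rule generate.incl)
  then show ?thesis
    using subgroup.rcos_const[OF tensor_subgroup group_free_Abelian_group, of u]
    by (simp add: tensor_simps tensor_group_eq tensor_class_eq)
qed

text \<open>Two representatives of a tensor differ by an element of the subgroup generated by the relations, and
a homomorphism that kills the relations kills that subgroup.\<close>

lemma frag_eval_tensor_class:
  assumes P: "abelian_group P"
    and c: "\<And>m n. \<lbrakk>m \<in> carrier M; n \<in> carrier N\<rbrakk> \<Longrightarrow> b (m, n) \<in> carrier P"
    and r0: "\<And>u. u \<in> tensor_rels R M N \<Longrightarrow> frag_eval P b u = \<zero>\<^bsub>P\<^esub>"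
    and u: "u \<in> carrier (free_pairs M N)" and v: "v \<in> tensor_class R M N u"
  shows "v \<in> carrier (free_pairs M N)" "frag_eval P b v = frag_eval P b u"
proof -
  interpret P: abelian_group P by fact
  have h: "frag_eval P b \<in> hom (free_pairs M N) (add_monoid P)"
    by (rule frag_eval_hom[OF P]) (use c in auto)
  interpret h: group_hom "free_pairs M N" "add_monoid P" "frag_eval P b"
    by (simp add: group_hom_def group_hom_axioms_def h P.a_group)
  have "(tensor_kernel R M N) \<subseteq> kernel (free_pairs M N) (add_monoid P) (frag_eval P b)"
    by (rule group.generate_subgroup_incl[OF group_free_Abelian_group _ h.subgroup_kernel])
       (use r0 tensor_rels_carrier in \<open>unfold kernel_def monoid.simps partial_object.simps, blast\<close>)
  moreover obtain k where k: "k \<in> (tensor_kernel R M N)" "v = k + u"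
    using v unfolding tensor_class_eq r_coset_def by auto
  ultimately have kk: "k \<in> carrier (free_pairs M N)" "frag_eval P b k = \<zero>\<^bsub>P\<^esub>"
    unfolding kernel_def by auto
  show "v \<in> carrier (free_pairs M N)" using k(2) kk(1) u keys_add[of k u] by auto
  show "frag_eval P b v = frag_eval P b u"
    using hom_mult[OF h kk(1) u] kk(2) k(2) hom_in_carrier[OF h u] by simp
qed

lemma tensor_class_self: "u \<in> carrier (free_pairs M N) \<Longrightarrow> u \<in> tensor_class R M N u"
  unfolding tensor_class_eq
  using subgroup.one_closed[OF tensor_subgroup] by (force simp: r_coset_def)

lemma pure_tensor_closed: 
  assumes "m \<in> carrier M" "n \<in> carrier N"
  shows "pure_tensor R M N m n \<in> carrier (tensor R M N)"
  unfolding tensor_carrier pure_tensor_def using assms by auto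

lemma frag_eval_balanced_rels:
  assumes P: "abelian_group P" and b: "balanced R M N P \<beta>" and u: "u \<in> tensor_rels R M N"
  shows "frag_eval P (\<lambda>p. \<beta> (fst p) (snd p)) u = \<zero>\<^bsub>P\<^esub>"
proof -
  interpret P: abelian_group P by fact
  note bD = balancedD[OF b]
  let ?e = "frag_eval P (\<lambda>p. \<beta> (fst p) (snd p))"
  have im: "(\<lambda>p. \<beta> (fst p) (snd p)) ` (carrier M \<times> carrier N) \<subseteq> carrier P" using bD(1) by auto
  have of: "?e (frag_of (m, n)) = \<beta> m n" if "m \<in> carrier M" "n \<in> carrier N" for m n
    using that bD(1) by (subst frag_eval_of[OF P]) auto
  have d1: "?e (frag_of (m, n) - frag_of (m', n')) = \<beta> m n \<ominus>\<^bsub>P\<^esub> \<beta> m' n'"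
    if "m \<in> carrier M" "n \<in> carrier N" "m' \<in> carrier M" "n' \<in> carrier N" for m n m' n'
    using that frag_eval_diff[OF P im, of "frag_of (m, n)" "frag_of (m', n')"] of by simp
  have kd: "Poly_Mapping.keys (frag_of p - frag_of q) \<subseteq> carrier M \<times> carrier N"
    if "p \<in> carrier M \<times> carrier N" "q \<in> carrier M \<times> carrier N" for p q
    using keys_diff[of "frag_of p" "frag_of q"] that by auto
  have d2: "?e (frag_of (m, n) - frag_of (m', n') - frag_of (m'', n'')) = \<beta> m n \<ominus>\<^bsub>P\<^esub> \<beta> m' n' \<ominus>\<^bsub>P\<^esub> \<beta> m'' n''"
    if "m \<in> carrier M" "n \<in> carrier N" "m' \<in> carrier M" "n' \<in> carrier N" "m'' \<in> carrier M" "n'' \<in> carrier N" for m n m' n' m'' n''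
    using that frag_eval_diff[OF P im kd, of "(m, n)" "(m', n')" "frag_of (m'', n'')"] of d1 by simp
  have canc: "x \<oplus>\<^bsub>P\<^esub> y \<ominus>\<^bsub>P\<^esub> x \<ominus>\<^bsub>P\<^esub> y = \<zero>\<^bsub>P\<^esub>" if "x \<in> carrier P" "y \<in> carrier P" for x y
    using that by (metis P.a_comm P.add.inv_closed P.add.m_assoc P.add.m_closed P.minus_eq P.r_neg P.r_zero)
  from u consider (l) m m' n where "u = frag_of (m \<oplus>\<^bsub>M\<^esub> m', n) - frag_of (m, n) - frag_of (m', n)"
      "m \<in> carrier M" "m' \<in> carrier M" "n \<in> carrier N"
    | (r) m n n' where "u = frag_of (m, n \<oplus>\<^bsub>N\<^esub> n') - frag_of (m, n) - frag_of (m, n')"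
      "m \<in> carrier M" "n \<in> carrier N" "n' \<in> carrier N"
    | (s) r m n where "u = frag_of (r \<odot>\<^bsub>M\<^esub> m, n) - frag_of (m, r \<odot>\<^bsub>N\<^esub> n)"
      "r \<in> carrier R" "m \<in> carrier M" "n \<in> carrier N"
    unfolding tensor_rels_def by blast
  then show ?thesis
  proof cases
    case l then show ?thesis by (simp add: d2 bD canc)
  next
    case r then show ?thesis by (simp add: d2 bD canc)
  next
    case s then show ?thesis by (simp add: d1 bD P.r_neg P.minus_eq)
  qed
qed

lemma tensor_lift_class:
  assumes P: "abelian_group P" and b: "balanced R M N P \<beta>" and u: "u \<in> carrier (free_pairs M N)"
  shows "tensor_lift P \<beta> (tensor_class R M N u) = frag_eval P (\<lambda>p. \<beta> (fst p) (snd p)) u"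
proof -
  interpret P: abelian_group P by fact
  let ?e = "frag_eval P (\<lambda>p. \<beta> (fst p) (snd p))"
  have "?e v = ?e u" if "v \<in> tensor_class R M N u" for v
    by (rule frag_eval_tensor_class(2)[OF P _ frag_eval_balanced_rels[OF P b] u that])
       (simp_all add: balancedD(1)[OF b])
  then have "?e ` tensor_class R M N u = {?e u}"
    using tensor_class_self[OF u] by blast
  then show ?thesis unfolding tensor_lift_eq by simp
qed

lemma tensor_lift_hom:
  assumes P: "abelian_group P" and b: "balanced R M N P \<beta>"
  shows "tensor_lift P \<beta> \<in> hom (add_monoid (tensor R M N)) (add_monoid P)"
proof -
  interpret P: abelian_group P by fact
  have h: "frag_eval P (\<lambda>p. \<beta> (fst p) (snd p)) \<in> hom (free_pairs M N) (add_monoid P)"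
    by (rule frag_eval_hom[OF P]) (use balancedD(1)[OF b] in auto)
  show ?thesis
  proof (rule homI)
    fix t assume "t \<in> carrier (add_monoid (tensor R M N))"
    then show "tensor_lift P \<beta> t \<in> carrier (add_monoid P)"
      using hom_in_carrier[OF h] tensor_lift_class[OF P b] by (auto simp: tensor_carrier)
  next
    fix s t assume "s \<in> carrier (add_monoid (tensor R M N))" "t \<in> carrier (add_monoid (tensor R M N))"
    then obtain u v where uv: "u \<in> carrier (free_pairs M N)" "v \<in> carrier (free_pairs M N)"
      "s = tensor_class R M N u" "t = tensor_class R M N v"
      by (auto simp: tensor_carrier)
    have "s \<oplus>\<^bsub>tensor R M N\<^esub> t = tensor_class R M N (u + v)"
      using hom_mult[OF tensor_class_hom uv(1,2)] uv(3,4) by simp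
    moreover have "u + v \<in> carrier (free_pairs M N)" using uv keys_add[of u v] by auto
    ultimately show "tensor_lift P \<beta> (s \<otimes>\<^bsub>add_monoid (tensor R M N)\<^esub> t) =
        tensor_lift P \<beta> s \<otimes>\<^bsub>add_monoid P\<^esub> tensor_lift P \<beta> t"
      using hom_mult[OF h uv(1,2)] uv tensor_lift_class[OF P b] by simp
  qed
qed

lemma tensor_lift_pure:
  assumes P: "abelian_group P" and b: "balanced R M N P \<beta>" and "m \<in> carrier M" "n \<in> carrier N"
  shows "tensor_lift P \<beta> (pure_tensor R M N m n) = \<beta> m n"
proof -
  interpret P: abelian_group P by fact
  show ?thesis
    unfolding pure_tensor_def using assms balancedD(1)[OF b]
    by (subst tensor_lift_class[OF P b]) (auto simp: frag_eval_of[OF P])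
qed

lemma pure_tensor_rels:
  assumes "m \<in> carrier M" "n \<in> carrier N"
  shows "m' \<in> carrier M \<Longrightarrow> pure_tensor R M N (m \<oplus>\<^bsub>M\<^esub> m') n = pure_tensor R M N m n \<oplus>\<^bsub>tensor R M N\<^esub> pure_tensor R M N m' n"
    and "n' \<in> carrier N \<Longrightarrow> pure_tensor R M N m (n \<oplus>\<^bsub>N\<^esub> n') = pure_tensor R M N m n \<oplus>\<^bsub>tensor R M N\<^esub> pure_tensor R M N m n'"
    and "r \<in> carrier R \<Longrightarrow> pure_tensor R M N (r \<odot>\<^bsub>M\<^esub> m) n = pure_tensor R M N m (r \<odot>\<^bsub>N\<^esub> n)"
proof -
  let ?c = "tensor_class R M N" and ?T = "tensor R M N"
  interpret T: abelian_group ?T by (rule tensor_abelian_group)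
  note add = hom_mult[OF tensor_class_hom, simplified]
  have key: "?c u = ?c v" if "u - v \<in> tensor_rels R M N" "u \<in> carrier (free_pairs M N)" "v \<in> carrier (free_pairs M N)" for u v
  proof -
    have "Poly_Mapping.keys (u - v) \<subseteq> carrier M \<times> carrier N" using that(2,3) keys_diff[of u v] by auto
    then have "?c ((u - v) + v) = ?c (u - v) \<oplus>\<^bsub>?T\<^esub> ?c v" using that by (intro add) auto
    also have "?c (u - v) = \<zero>\<^bsub>?T\<^esub>" by (rule tensor_class_rel[OF that(1)])
    finally show ?thesis using hom_in_carrier[OF tensor_class_hom that(3)] by simp
  qed
  have add2: "?c (frag_of p + frag_of q) = ?c (frag_of p) \<oplus>\<^bsub>?T\<^esub> ?c (frag_of q)"
    if "p \<in> carrier M \<times> carrier N" "q \<in> carrier M \<times> carrier N" for p q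
    using that by (intro add) auto
  have kk: "Poly_Mapping.keys (frag_of p + frag_of q) \<subseteq> carrier M \<times> carrier N" if "p \<in> carrier M \<times> carrier N" "q \<in> carrier M \<times> carrier N" for p q
    using keys_add[of "frag_of p" "frag_of q"] that by auto
  { assume m': "m' \<in> carrier M"
    have "frag_of (m \<oplus>\<^bsub>M\<^esub> m', n) - (frag_of (m, n) + frag_of (m', n)) \<in> tensor_rels R M N"
      unfolding tensor_rels_def diff_add_eq_diff_diff_swap using assms m' by (auto simp: algebra_simps)
    from key[OF this] show "pure_tensor R M N (m \<oplus>\<^bsub>M\<^esub> m') n = pure_tensor R M N m n \<oplus>\<^bsub>tensor R M N\<^esub> pure_tensor R M N m' n"
      unfolding pure_tensor_def using assms m' kk by (subst add2[symmetric]) auto }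
  { assume n': "n' \<in> carrier N"
    have "frag_of (m, n \<oplus>\<^bsub>N\<^esub> n') - (frag_of (m, n) + frag_of (m, n')) \<in> tensor_rels R M N"
      unfolding tensor_rels_def using assms n' by (auto simp: algebra_simps)
    from key[OF this] show "pure_tensor R M N m (n \<oplus>\<^bsub>N\<^esub> n') = pure_tensor R M N m n \<oplus>\<^bsub>tensor R M N\<^esub> pure_tensor R M N m n'"
      unfolding pure_tensor_def using assms n' kk by (subst add2[symmetric]) auto }
  { assume r: "r \<in> carrier R"
    have "frag_of (r \<odot>\<^bsub>M\<^esub> m, n) - frag_of (m, r \<odot>\<^bsub>N\<^esub> n) \<in> tensor_rels R M N"
      unfolding tensor_rels_def using assms r by auto
    from key[OF this] show "pure_tensor R M N (r \<odot>\<^bsub>M\<^esub> m) n = pure_tensor R M N m (r \<odot>\<^bsub>N\<^esub> n)"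
      unfolding pure_tensor_def using assms r by auto }
qed

end

context
  fixes R :: "('a, 'r) ring_scheme" and M :: "('a, 'm, 'x) module_scheme" and N :: "('a, 'n, 'y) module_scheme"
  assumes M: "module R M" and N: "module R N"
begin

interpretation M: module R M by (fact M)
interpretation N: module R N by (fact N)
interpretation T: abelian_group "tensor R M N" by (rule tensor_abelian_group[OF M N])

lemma tensor_class_diff:
  assumes "u \<in> carrier (free_pairs M N)" "v \<in> carrier (free_pairs M N)"
  shows "tensor_class R M N (u - v) = tensor_class R M N u \<ominus>\<^bsub>tensor R M N\<^esub> tensor_class R M N v"
proof -
  have k: "u - v \<in> carrier (free_pairs M N)" using keys_diff[of u v] assms by auto
  have "tensor_class R M N ((u - v) \<otimes>\<^bsub>free_pairs M N\<^esub> v) = tensor_class R M N (u - v) \<oplus>\<^bsub>tensor R M N\<^esub> tensor_class R M N v"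
    using hom_mult[OF tensor_class_hom[OF M N] k assms(2)] by simp
  then show ?thesis
    using hom_in_carrier[OF tensor_class_hom[OF M N] k] hom_in_carrier[OF tensor_class_hom[OF M N] assms(2)]
    by (simp add: a_minus_def T.a_assoc T.r_neg)
qed

lemma tensor_class_zero: "tensor_class R M N 0 = \<zero>\<^bsub>tensor R M N\<^esub>"
proof -
  have "tensor_class R M N 0 \<in> carrier (tensor R M N)"
    using hom_in_carrier[OF tensor_class_hom[OF M N], of 0] by simp
  then show ?thesis
    using tensor_class_diff[of 0 0] by (simp add: a_minus_def T.r_neg)
qed

text \<open>Since \<open>- (m \<otimes> n) = (- m) \<otimes> n\<close>, sums of pure tensors suffice.  The underlying induction on the
free Abelian group subtracts, so it carries the property for a representative and for its negative.\<close>

lemma tensor_induct [consumes 1, case_names pure add]: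
  assumes t: "t \<in> carrier (tensor R M N)"
    and pure: "\<And>m n. \<lbrakk>m \<in> carrier M; n \<in> carrier N\<rbrakk> \<Longrightarrow> P (pure_tensor R M N m n)"
    and add: "\<And>s t. \<lbrakk>s \<in> carrier (tensor R M N); t \<in> carrier (tensor R M N); P s; P t\<rbrakk>
      \<Longrightarrow> P (s \<oplus>\<^bsub>tensor R M N\<^esub> t)"
  shows "P t"
proof -
  let ?T = "tensor R M N" and ?c = "tensor_class R M N"
  have z: "pure_tensor R M N \<zero>\<^bsub>M\<^esub> n = \<zero>\<^bsub>?T\<^esub>" if "n \<in> carrier N" for n
    using pure_tensor_rels(1)[OF M N, of "\<zero>\<^bsub>M\<^esub>" n "\<zero>\<^bsub>M\<^esub>"] pure_tensor_closed[OF M N, of "\<zero>\<^bsub>M\<^esub>" n] that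
    by (metis M.M.l_zero M.M.zero_closed T.add.r_cancel_one')
  have neg: "\<ominus>\<^bsub>?T\<^esub> pure_tensor R M N m n = pure_tensor R M N (\<ominus>\<^bsub>M\<^esub> m) n"
    if "m \<in> carrier M" "n \<in> carrier N" for m n
    using pure_tensor_rels(1)[OF M N, of "\<ominus>\<^bsub>M\<^esub> m" n m] that z[of n] pure_tensor_closed[OF M N]
    by (intro T.minus_equality) (simp_all add: M.M.l_neg)
  obtain u where u: "Poly_Mapping.keys u \<subseteq> carrier M \<times> carrier N" "t = ?c u"
    using t by (auto simp: tensor_carrier[OF M N])
  have cc: "?c u \<in> carrier ?T" if "Poly_Mapping.keys u \<subseteq> carrier M \<times> carrier N" for u
    using that by (auto simp: tensor_carrier[OF M N])
  have "P (?c u) \<and> P (\<ominus>\<^bsub>?T\<^esub> ?c u)"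
  proof (rule free_Abelian_group_induct[OF u(1)], goal_cases)
    case 1
    have "\<ominus>\<^bsub>?T\<^esub> \<zero>\<^bsub>?T\<^esub> = \<zero>\<^bsub>?T\<^esub>"
      by (rule T.minus_equality[OF T.l_zero[OF T.zero_closed] T.zero_closed T.zero_closed])
    moreover have "P \<zero>\<^bsub>?T\<^esub>" using pure[of "\<zero>\<^bsub>M\<^esub>" "\<zero>\<^bsub>N\<^esub>"] z[of "\<zero>\<^bsub>N\<^esub>"] by simp
    ultimately show ?case by (simp only: tensor_class_zero simp_thms)
  next
    case (2 x y)
    then show ?case
      using tensor_class_diff[of x y] add[of "?c x" "\<ominus>\<^bsub>?T\<^esub> ?c y"] add[of "\<ominus>\<^bsub>?T\<^esub> ?c x" "?c y"] cc
      by (simp add: a_minus_def T.minus_add)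
  next
    case (3 a)
    then show ?case using pure neg by (auto simp: pure_tensor_def[symmetric])
  qed
  then show ?thesis using u(2) by simp
qed

text \<open>The scalar multiplication and the product of tensors are given by \<^const>\<open>frag_extend\<close> on
representatives.  Rewriting them with \<^const>\<open>frag_eval\<close> turns both into lifts, which makes their
independence of the representatives evident.\<close>

lemma tensor_class_frag_extend:
  assumes u: "Poly_Mapping.keys u \<subseteq> S" and g: "\<And>p. p \<in> S \<Longrightarrow> g p \<in> carrier (free_pairs M N)"
  shows "frag_extend g u \<in> carrier (free_pairs M N)"
    and "tensor_class R M N (frag_extend g u) = frag_eval (tensor R M N) (\<lambda>p. tensor_class R M N (g p)) u"
proof -
  let ?c = "tensor_class R M N"
  have cc: "?c u \<in> carrier (tensor R M N)" if "Poly_Mapping.keys u \<subseteq> carrier M \<times> carrier N" for u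
    using that by (auto simp: tensor_carrier[OF M N])
  have im: "(\<lambda>p. ?c (g p)) ` S \<subseteq> carrier (tensor R M N)" using g cc by auto
  have "frag_extend g u \<in> carrier (free_pairs M N) \<and> ?c (frag_extend g u) = frag_eval (tensor R M N) (\<lambda>p. ?c (g p)) u"
  proof (rule free_Abelian_group_induct[OF u], goal_cases)
    case 1
    then show ?case by (simp add: frag_eval_def tensor_class_zero)
  next
    case (2 x y)
    then show ?case
      using keys_diff[of "frag_extend g x" "frag_extend g y"]
      by (auto simp: frag_extend_diff frag_eval_diff[OF T.abelian_group_axioms im] tensor_class_diff)
  next
    case (3 a)
    then show ?case using g[OF 3] cc by (simp add: frag_eval_of[OF T.abelian_group_axioms])
  qed
  then show "frag_extend g u \<in> carrier (free_pairs M N)"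
    "?c (frag_extend g u) = frag_eval (tensor R M N) (\<lambda>p. ?c (g p)) u" by auto
qed

lemma frag_eval_cong:
  assumes "abelian_group P" "\<And>p. p \<in> Poly_Mapping.keys u \<Longrightarrow> b p = b' p"
    "\<And>p. p \<in> Poly_Mapping.keys u \<Longrightarrow> b' p \<in> carrier P"
  shows "frag_eval P b u = frag_eval P b' u"
proof -
  interpret P: abelian_group P by fact
  show ?thesis unfolding frag_eval_def by (rule P.finsum_cong') (auto simp: assms)
qed

lemma frag_eval_lift:
  assumes P: "abelian_group P" and b: "balanced R M N P \<beta>"
    and "t \<in> carrier (tensor R M N)" "u \<in> t"
  shows "u \<in> carrier (free_pairs M N)" "frag_eval P (\<lambda>p. \<beta> (fst p) (snd p)) u = tensor_lift P \<beta> t"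
proof -
  obtain v where v: "v \<in> carrier (free_pairs M N)" "t = tensor_class R M N v"
    using assms(3) by (auto simp: tensor_carrier[OF M N])
  have c: "\<And>m n. \<lbrakk>m \<in> carrier M; n \<in> carrier N\<rbrakk> \<Longrightarrow> \<beta> (fst (m, n)) (snd (m, n)) \<in> carrier P"
    by (simp add: balancedD(1)[OF b])
  note * = frag_eval_tensor_class[OF M N P c frag_eval_balanced_rels[OF M N P b] v(1) assms(4)[unfolded v(2)]]
  show "u \<in> carrier (free_pairs M N)" by (rule *(1))
  show "frag_eval P (\<lambda>p. \<beta> (fst p) (snd p)) u = tensor_lift P \<beta> t"
    using *(2) tensor_lift_class[OF M N P b v(1)] v(2) by simp
qed

lemma tensor_nonempty: "t \<in> carrier (tensor R M N) \<Longrightarrow> t \<noteq> {}"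
  using tensor_class_self[OF M N] unfolding tensor_carrier[OF M N] by blast

lemma pure_smult_balanced:
  assumes r: "r \<in> carrier R"
  shows "balanced R M N (tensor R M N) (\<lambda>m n. pure_tensor R M N (r \<odot>\<^bsub>M\<^esub> m) n)"
proof -
  have "r \<odot>\<^bsub>M\<^esub> (s \<odot>\<^bsub>M\<^esub> m) = s \<odot>\<^bsub>M\<^esub> (r \<odot>\<^bsub>M\<^esub> m)" if "s \<in> carrier R" "m \<in> carrier M" for s m
    using that r by (metis M.smult_assoc1 M.R.m_comm)
  then show ?thesis
    by (intro balancedI) (simp_all add: r pure_tensor_closed[OF M N] pure_tensor_rels[OF M N] M.smult_r_distr)
qed

lemma tensor_smult_eq:
  assumes r: "r \<in> carrier R" and t: "t \<in> carrier (tensor R M N)"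
  shows "r \<odot>\<^bsub>tensor R M N\<^esub> t = tensor_lift (tensor R M N) (\<lambda>m n. pure_tensor R M N (r \<odot>\<^bsub>M\<^esub> m) n) t"
proof -
  let ?g = "\<lambda>(m, n). frag_of (r \<odot>\<^bsub>M\<^esub> m, n)"
  have "tensor_class R M N (frag_extend ?g u) = tensor_lift (tensor R M N) (\<lambda>m n. pure_tensor R M N (r \<odot>\<^bsub>M\<^esub> m) n) t"
    if "u \<in> t" for u
  proof -
    note fe = frag_eval_lift[OF T.abelian_group_axioms pure_smult_balanced[OF r] t that]
    have "tensor_class R M N (frag_extend ?g u) = frag_eval (tensor R M N) (\<lambda>p. tensor_class R M N (?g p)) u"
      by (rule tensor_class_frag_extend(2)[of _ "carrier M \<times> carrier N"]) (use fe(1) r in auto)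
    then show ?thesis using fe(2) by (simp add: pure_tensor_def split_def)
  qed
  then show ?thesis
    using tensor_nonempty[OF t] by (auto simp: tensor_def)
qed

lemma tensor_smult_pure:
  assumes "r \<in> carrier R" "m \<in> carrier M" "n \<in> carrier N"
  shows "r \<odot>\<^bsub>tensor R M N\<^esub> pure_tensor R M N m n = pure_tensor R M N (r \<odot>\<^bsub>M\<^esub> m) n"
  using assms tensor_lift_pure[OF M N T.abelian_group_axioms pure_smult_balanced]
  by (simp add: tensor_smult_eq pure_tensor_closed[OF M N])

lemma tensor_module: "module R (tensor R M N)"
proof -
  let ?T = "tensor R M N"
  have cl: "r \<odot>\<^bsub>?T\<^esub> t \<in> carrier ?T" if "r \<in> carrier R" "t \<in> carrier ?T" for r t
    using that hom_in_carrier[OF tensor_lift_hom[OF M N T.abelian_group_axioms pure_smult_balanced]]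
    by (simp add: tensor_smult_eq)
  have ad: "r \<odot>\<^bsub>?T\<^esub> (s \<oplus>\<^bsub>?T\<^esub> t) = r \<odot>\<^bsub>?T\<^esub> s \<oplus>\<^bsub>?T\<^esub> r \<odot>\<^bsub>?T\<^esub> t" if "r \<in> carrier R" "s \<in> carrier ?T" "t \<in> carrier ?T" for r s t
    using that hom_mult[OF tensor_lift_hom[OF M N T.abelian_group_axioms pure_smult_balanced[OF that(1)]]]
    by (simp add: tensor_smult_eq)
  note sp = tensor_smult_pure pure_tensor_closed[OF M N] pure_tensor_rels[OF M N] cl ad
  show ?thesis
  proof (rule moduleI)
    fix a b t assume ab: "a \<in> carrier R" "b \<in> carrier R" and t: "t \<in> carrier ?T"
    show "(a \<oplus>\<^bsub>R\<^esub> b) \<odot>\<^bsub>?T\<^esub> t = a \<odot>\<^bsub>?T\<^esub> t \<oplus>\<^bsub>?T\<^esub> b \<odot>\<^bsub>?T\<^esub> t"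
      using t
    proof (induction rule: tensor_induct)
      case (pure m n) then show ?case using ab by (simp add: sp M.smult_l_distr)
    next
      case (add s t) then show ?case using ab by (simp add: sp T.a_ac)
    qed
    show "(a \<otimes>\<^bsub>R\<^esub> b) \<odot>\<^bsub>?T\<^esub> t = a \<odot>\<^bsub>?T\<^esub> (b \<odot>\<^bsub>?T\<^esub> t)"
      using t
    proof (induction rule: tensor_induct)
      case (pure m n) then show ?case using ab by (simp add: sp(1,2) M.smult_assoc1)
    next
      case (add s t) then show ?case using ab by (simp add: sp)
    qed
  next
    fix t assume t: "t \<in> carrier ?T"
    show "\<one>\<^bsub>R\<^esub> \<odot>\<^bsub>?T\<^esub> t = t"
      using t by (induction rule: tensor_induct) (simp_all add: sp)
  qed (simp_all add: cl ad T.abelian_group_axioms M.R.cring_axioms)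
qed

lemma pure_tensor_bilinear: "bilinear R M N (tensor R M N) (pure_tensor R M N)"
  by (intro bilinearI module_homI)
     (simp_all add: pure_tensor_closed[OF M N] pure_tensor_rels[OF M N] tensor_smult_pure flip: pure_tensor_rels(3)[OF M N])

lemma tensor_lift_linear:
  assumes P: "module R P" and b: "bilinear R M N P \<beta>"
  shows "tensor_lift P \<beta> \<in> module_hom R (tensor R M N) P"
proof -
  interpret P: module R P by fact
  interpret TM: module R "tensor R M N" by (rule tensor_module)
  let ?T = "tensor R M N"
  note h = tensor_lift_hom[OF M N P.M.abelian_group_axioms bilinear_balanced[OF b]]
  have cl: "\<And>t. t \<in> carrier ?T \<Longrightarrow> tensor_lift P \<beta> t \<in> carrier P"
    using hom_in_carrier[OF h] by simp
  have ad: "\<And>s t. \<lbrakk>s \<in> carrier ?T; t \<in> carrier ?T\<rbrakk> \<Longrightarrow> tensor_lift P \<beta> (s \<oplus>\<^bsub>?T\<^esub> t) = tensor_lift P \<beta> s \<oplus>\<^bsub>P\<^esub> tensor_lift P \<beta> t"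
    using hom_mult[OF h] by simp
  show ?thesis
  proof (rule module_homI)
    fix r t assume r: "r \<in> carrier R" and "t \<in> carrier ?T"
    from this(2) show "tensor_lift P \<beta> (r \<odot>\<^bsub>?T\<^esub> t) = r \<odot>\<^bsub>P\<^esub> tensor_lift P \<beta> t"
    proof (induction rule: tensor_induct)
      case (pure m n)
      then show ?case using r
        by (simp add: tensor_smult_pure tensor_lift_pure[OF M N P.M.abelian_group_axioms bilinear_balanced[OF b]] bilinearD[OF b])
    next
      case (add s t)
      then show ?case using r by (simp add: ad cl TM.smult_r_distr P.smult_r_distr)
    qed
  qed (simp_all add: cl ad)
qed

lemma tensor_lift_bilinear_pure:
  assumes P: "module R P" and b: "bilinear R M N P \<beta>" and "m \<in> carrier M" "n \<in> carrier N"
  shows "tensor_lift P \<beta> (pure_tensor R M N m n) = \<beta> m n"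
proof -
  interpret P: module R P by fact
  show ?thesis by (rule tensor_lift_pure[OF M N P.M.abelian_group_axioms bilinear_balanced[OF b] assms(3,4)])
qed

text \<open>Almost every identity about lifts is proved by this principle: both sides are linear in the tensor,
so it is enough to compare them on pure tensors.\<close>

lemma tensor_hom_ext:
  assumes "f \<in> module_hom R (tensor R M N) P" "g \<in> module_hom R (tensor R M N) P"
    and "\<And>m n. \<lbrakk>m \<in> carrier M; n \<in> carrier N\<rbrakk> \<Longrightarrow> f (pure_tensor R M N m n) = g (pure_tensor R M N m n)"
    and "t \<in> carrier (tensor R M N)"
  shows "f t = g t"
  using assms(4)
  by (induction rule: tensor_induct) (simp_all add: assms(3) module_homD[OF assms(1)] module_homD[OF assms(2)])

lemma tensor_lift_cong:
  assumes P: "module R P" and b: "bilinear R M N P \<beta>" and b': "bilinear R M N P \<beta>'"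
    and "\<And>m n. \<lbrakk>m \<in> carrier M; n \<in> carrier N\<rbrakk> \<Longrightarrow> \<beta> m n = \<beta>' m n"
    and t: "t \<in> carrier (tensor R M N)"
  shows "tensor_lift P \<beta> t = tensor_lift P \<beta>' t"
  by (rule tensor_hom_ext[OF tensor_lift_linear[OF P b] tensor_lift_linear[OF P b'] _ t])
     (simp add: tensor_lift_bilinear_pure[OF P b] tensor_lift_bilinear_pure[OF P b'] assms(4))

lemma tensor_lift_closed:
  assumes P: "module R P" and b: "bilinear R M N P \<beta>" and t: "t \<in> carrier (tensor R M N)"
  shows "tensor_lift P \<beta> t \<in> carrier P"
  by (rule module_homD(1)[OF tensor_lift_linear[OF P b] t])

lemma hom_tensor_lift:
  assumes P: "module R P" and Q: "module R Q" and b: "bilinear R M N P \<beta>"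
    and f: "f \<in> module_hom R P Q" and t: "t \<in> carrier (tensor R M N)"
  shows "f (tensor_lift P \<beta> t) = tensor_lift Q (\<lambda>m n. f (\<beta> m n)) t"
    and "bilinear R M N Q (\<lambda>m n. f (\<beta> m n))"
proof -
  show b': "bilinear R M N Q (\<lambda>m n. f (\<beta> m n))"
    by (rule bilinearI) (rule module_hom_comp[OF _ f], simp add: bilinearD[OF b])+
  show "f (tensor_lift P \<beta> t) = tensor_lift Q (\<lambda>m n. f (\<beta> m n)) t"
    by (rule tensor_hom_ext[OF module_hom_comp[OF tensor_lift_linear[OF P b] f] tensor_lift_linear[OF Q b'] _ t])
       (simp add: tensor_lift_bilinear_pure[OF P b] tensor_lift_bilinear_pure[OF Q b'])
qed

end

lemma bilinear_comp:
  assumes "bilinear R M N P \<beta>" "f \<in> module_hom R K M" "g \<in> module_hom R L N"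
  shows "bilinear R K L P (\<lambda>k l. \<beta> (f k) (g l))"
  by (intro bilinearI module_homI)
     (simp_all add: bilinearD[OF assms(1)] module_homD[OF assms(2)] module_homD[OF assms(3)])

text \<open>A lift depends linearly on every parameter on which the bilinear form depends linearly.  This yields
the bilinearity of nested lifts, as they occur in products and in rebracketing.\<close>

lemma tensor_lift_param_hom:
  assumes V: "module R V" and K: "module R K" and L: "module R L" and P: "module R P"
    and b: "\<And>x. x \<in> carrier V \<Longrightarrow> bilinear R K L P (\<gamma> x)"
    and h: "\<And>k l. \<lbrakk>k \<in> carrier K; l \<in> carrier L\<rbrakk> \<Longrightarrow> (\<lambda>x. \<gamma> x k l) \<in> module_hom R V P"
    and t: "t \<in> carrier (tensor R K L)"
  shows "(\<lambda>x. tensor_lift P (\<gamma> x) t) \<in> module_hom R V P"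
  using t
proof (induction rule: tensor_induct[OF K L, consumes 1, case_names pure add])
  case (pure k l)
  show ?case
    by (rule module_hom_cong[OF h[OF pure] V]) (simp add: tensor_lift_bilinear_pure[OF K L P b] pure)
next
  case (add s t)
  show ?case
    by (rule module_hom_cong[OF module_hom_plus[OF P add(3,4)] V])
       (simp add: module_homD[OF tensor_lift_linear[OF K L P b]] add(1,2))
qed

lemma tensor_lift_param_bilinear:
  assumes V: "module R V" and W: "module R W" and K: "module R K" and L: "module R L" and P: "module R P"
    and b: "\<And>x y. \<lbrakk>x \<in> carrier V; y \<in> carrier W\<rbrakk> \<Longrightarrow> bilinear R K L P (\<gamma> x y)"
    and h: "\<And>k l. \<lbrakk>k \<in> carrier K; l \<in> carrier L\<rbrakk> \<Longrightarrow> bilinear R V W P (\<lambda>x y. \<gamma> x y k l)"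
    and t: "t \<in> carrier (tensor R K L)"
  shows "bilinear R V W P (\<lambda>x y. tensor_lift P (\<gamma> x y) t)"
proof (rule bilinearI)
  fix x assume x: "x \<in> carrier V"
  show "(\<lambda>y. tensor_lift P (\<gamma> x y) t) \<in> module_hom R W P"
    by (rule tensor_lift_param_hom[OF W K L P b[OF x] bilinearD(1)[OF h x] t])
next
  fix y assume y: "y \<in> carrier W"
  show "(\<lambda>x. tensor_lift P (\<gamma> x y) t) \<in> module_hom R V P"
    by (rule tensor_lift_param_hom[OF V K L P b[OF _ y] bilinearD(2)[OF h y] t])
qed

lemma algebra_mult_bilinear:
  assumes "algebra R A"
  shows "bilinear R A A A (monoid.mult A)"
proof -
  interpret A: algebra R A by fact
  show ?thesis
  proof (intro bilinearI module_homI; (simp add: A.smult_assoc2 A.l_distr A.r_distr; fail)?)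
    fix m r x assume *: "m \<in> carrier A" "r \<in> carrier R" "x \<in> carrier A"
    then show "m \<otimes>\<^bsub>A\<^esub> (r \<odot>\<^bsub>A\<^esub> x) = r \<odot>\<^bsub>A\<^esub> (m \<otimes>\<^bsub>A\<^esub> x)"
      using A.smult_assoc2[of r x m] A.m_comm by simp
  qed
qed

subsection \<open>Multiplication on the tensor product of two algebras\<close>

context
  fixes R :: "('a, 'r) ring_scheme" and M :: "('a, 'm, 'x) module_scheme" and N :: "('a, 'n, 'y) module_scheme"
  assumes MA: "algebra R M" and NA: "algebra R N"
begin

interpretation M: algebra R M by (fact MA)
interpretation N: algebra R N by (fact NA)

private lemmas MN = M.module_axioms N.module_axioms
private lemmas TM = tensor_module[OF MN]

interpretation T: module R "tensor R M N" by (rule TM)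

lemma pure_mult_bilinear:
  assumes "m \<in> carrier M" "n \<in> carrier N"
  shows "bilinear R M N (tensor R M N) (\<lambda>m' n'. pure_tensor R M N (m \<otimes>\<^bsub>M\<^esub> m') (n \<otimes>\<^bsub>N\<^esub> n'))"
  by (rule bilinear_comp[OF pure_tensor_bilinear[OF MN] bilinearD(1)[OF algebra_mult_bilinear[OF MA] assms(1)]
        bilinearD(1)[OF algebra_mult_bilinear[OF NA] assms(2)]])

lemma pure_mult_bilinear':
  assumes "m' \<in> carrier M" "n' \<in> carrier N"
  shows "bilinear R M N (tensor R M N) (\<lambda>m n. pure_tensor R M N (m \<otimes>\<^bsub>M\<^esub> m') (n \<otimes>\<^bsub>N\<^esub> n'))"
  by (rule bilinear_comp[OF pure_tensor_bilinear[OF MN] bilinearD(2)[OF algebra_mult_bilinear[OF MA] assms(1)]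
        bilinearD(2)[OF algebra_mult_bilinear[OF NA] assms(2)]])

lemma lift_mult_bilinear:
  assumes "t \<in> carrier (tensor R M N)"
  shows "bilinear R M N (tensor R M N)
    (\<lambda>m n. tensor_lift (tensor R M N) (\<lambda>m' n'. pure_tensor R M N (m \<otimes>\<^bsub>M\<^esub> m') (n \<otimes>\<^bsub>N\<^esub> n')) t)"
  by (rule tensor_lift_param_bilinear[OF MN MN TM pure_mult_bilinear pure_mult_bilinear' assms])

text \<open>On representatives \<open>u\<close>, \<open>v\<close> the product is a double \<^const>\<open>frag_extend\<close>; the inner one is a lift over
\<open>t\<close> for each generator in \<open>u\<close>, and the outer one is then a lift over \<open>s\<close>.\<close>

lemma tensor_mult_eq:
  assumes s: "s \<in> carrier (tensor R M N)" and t: "t \<in> carrier (tensor R M N)"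
  shows "s \<otimes>\<^bsub>tensor R M N\<^esub> t = tensor_lift (tensor R M N) (\<lambda>m n. tensor_lift (tensor R M N)
    (\<lambda>m' n'. pure_tensor R M N (m \<otimes>\<^bsub>M\<^esub> m') (n \<otimes>\<^bsub>N\<^esub> n')) t) s"
    (is "_ = ?L s t")
proof -
  let ?T = "tensor R M N" and ?c = "tensor_class R M N" and ?S = "carrier M \<times> carrier N"
  let ?g = "\<lambda>v (m, n). frag_extend (\<lambda>(m', n'). frag_of (m \<otimes>\<^bsub>M\<^esub> m', n \<otimes>\<^bsub>N\<^esub> n')) v"
  have "?c (frag_extend (?g v) u) = ?L s t" if u: "u \<in> s" and v: "v \<in> t" for u v
  proof -
    have inner: "?g v p \<in> carrier (free_pairs M N) \<and>
      ?c (?g v p) = tensor_lift ?T (\<lambda>m' n'. pure_tensor R M N (fst p \<otimes>\<^bsub>M\<^esub> m') (snd p \<otimes>\<^bsub>N\<^esub> n')) t"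
      if p: "p \<in> ?S" for p
    proof -
      obtain m n where mn: "p = (m, n)" "m \<in> carrier M" "n \<in> carrier N" using p by auto
      note fe = frag_eval_lift[OF MN T.M.abelian_group_axioms bilinear_balanced[OF pure_mult_bilinear[OF mn(2,3)]] t v]
      have g: "q \<in> ?S \<Longrightarrow> (\<lambda>(m', n'). frag_of (m \<otimes>\<^bsub>M\<^esub> m', n \<otimes>\<^bsub>N\<^esub> n')) q \<in> carrier (free_pairs M N)" for q
        using mn by auto
      note ext = tensor_class_frag_extend[OF MN _ g, of v]
      show ?thesis
        using ext fe by (simp add: mn pure_tensor_def split_def)
    qed
    note fe = frag_eval_lift[OF MN T.M.abelian_group_axioms bilinear_balanced[OF lift_mult_bilinear[OF t]] s u]
    have uS: "Poly_Mapping.keys u \<subseteq> ?S" using fe(1) by simp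
    have "?c (frag_extend (?g v) u) = frag_eval ?T (\<lambda>p. ?c (?g v p)) u"
      by (rule tensor_class_frag_extend(2)[OF MN uS]) (use inner in blast)
    also have "\<dots> = frag_eval ?T (\<lambda>p. tensor_lift ?T
        (\<lambda>m' n'. pure_tensor R M N (fst p \<otimes>\<^bsub>M\<^esub> m') (snd p \<otimes>\<^bsub>N\<^esub> n')) t) u"
    proof (rule frag_eval_cong[OF MN T.M.abelian_group_axioms])
      fix p assume "p \<in> Poly_Mapping.keys u"
      then have p: "p \<in> ?S" using uS by blast
      show "?c (?g v p) = tensor_lift ?T (\<lambda>m' n'. pure_tensor R M N (fst p \<otimes>\<^bsub>M\<^esub> m') (snd p \<otimes>\<^bsub>N\<^esub> n')) t"
        using inner[OF p] by blast
      show "tensor_lift ?T (\<lambda>m' n'. pure_tensor R M N (fst p \<otimes>\<^bsub>M\<^esub> m') (snd p \<otimes>\<^bsub>N\<^esub> n')) t \<in> carrier ?T"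
        using p bilinearD(3)[OF lift_mult_bilinear[OF t]] by auto
    qed
    finally show ?thesis using fe(2) by simp
  qed
  then have "(\<Union>u\<in>s. \<Union>v\<in>t. ?c (frag_extend (?g v) u)) = ?L s t"
    using tensor_nonempty[OF MN s] tensor_nonempty[OF MN t] by auto
  then show ?thesis by (simp add: tensor_def)
qed

lemma tensor_mult_bilinear: "bilinear R (tensor R M N) (tensor R M N) (tensor R M N) (monoid.mult (tensor R M N))"
proof (rule bilinearI)
  fix s assume s: "s \<in> carrier (tensor R M N)"
  show "monoid.mult (tensor R M N) s \<in> module_hom R (tensor R M N) (tensor R M N)"
    by (rule module_hom_cong[OF tensor_lift_param_hom[OF TM MN TM lift_mult_bilinear _ s] TM])
       (simp_all add: tensor_mult_eq s tensor_lift_linear[OF MN TM pure_mult_bilinear])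
next
  fix t assume t: "t \<in> carrier (tensor R M N)"
  show "(\<lambda>s. s \<otimes>\<^bsub>tensor R M N\<^esub> t) \<in> module_hom R (tensor R M N) (tensor R M N)"
    by (rule module_hom_cong[OF tensor_lift_linear[OF MN TM lift_mult_bilinear[OF t]] TM])
       (simp add: tensor_mult_eq t)
qed

lemma tensor_mult_pure:
  assumes "m \<in> carrier M" "n \<in> carrier N" "m' \<in> carrier M" "n' \<in> carrier N"
  shows "pure_tensor R M N m n \<otimes>\<^bsub>tensor R M N\<^esub> pure_tensor R M N m' n' =
    pure_tensor R M N (m \<otimes>\<^bsub>M\<^esub> m') (n \<otimes>\<^bsub>N\<^esub> n')"
  by (simp add: assms tensor_mult_eq pure_tensor_closed[OF MN] tensor_lift_bilinear_pure[OF MN TM lift_mult_bilinear]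
      tensor_lift_bilinear_pure[OF MN TM pure_mult_bilinear])

lemma tensor_lift_mult:
  assumes A: "algebra R A" and b: "bilinear R M N A \<beta>"
    and m: "\<And>m n m' n'. \<lbrakk>m \<in> carrier M; n \<in> carrier N; m' \<in> carrier M; n' \<in> carrier N\<rbrakk>
      \<Longrightarrow> \<beta> (m \<otimes>\<^bsub>M\<^esub> m') (n \<otimes>\<^bsub>N\<^esub> n') = \<beta> m n \<otimes>\<^bsub>A\<^esub> \<beta> m' n'"
    and s: "s \<in> carrier (tensor R M N)" and t: "t \<in> carrier (tensor R M N)"
  shows "tensor_lift A \<beta> (s \<otimes>\<^bsub>tensor R M N\<^esub> t) = tensor_lift A \<beta> s \<otimes>\<^bsub>A\<^esub> tensor_lift A \<beta> t"
proof -
  interpret A: algebra R A by fact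
  note P = A.module_axioms
  note lin = tensor_lift_linear[OF MN P b]
  note mulA = algebra_mult_bilinear[OF A]
  have one: "tensor_lift A \<beta> (pure_tensor R M N m n \<otimes>\<^bsub>tensor R M N\<^esub> t) = \<beta> m n \<otimes>\<^bsub>A\<^esub> tensor_lift A \<beta> t"
    if mn: "m \<in> carrier M" "n \<in> carrier N" for m n
  proof (rule tensor_hom_ext[OF MN _ _ _ t])
    show "(\<lambda>t. tensor_lift A \<beta> (pure_tensor R M N m n \<otimes>\<^bsub>tensor R M N\<^esub> t)) \<in> module_hom R (tensor R M N) A"
      by (rule module_hom_comp[OF bilinearD(1)[OF tensor_mult_bilinear] lin]) (simp add: pure_tensor_closed[OF MN] mn)
    show "(\<lambda>t. \<beta> m n \<otimes>\<^bsub>A\<^esub> tensor_lift A \<beta> t) \<in> module_hom R (tensor R M N) A"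
      by (rule module_hom_comp[OF lin bilinearD(1)[OF mulA]]) (simp add: bilinearD[OF b] mn)
  qed (simp add: tensor_mult_pure mn tensor_lift_bilinear_pure[OF MN P b] m)
  show ?thesis
  proof (rule tensor_hom_ext[OF MN _ _ _ s])
    show "(\<lambda>s. tensor_lift A \<beta> (s \<otimes>\<^bsub>tensor R M N\<^esub> t)) \<in> module_hom R (tensor R M N) A"
      by (rule module_hom_comp[OF bilinearD(2)[OF tensor_mult_bilinear t] lin])
    show "(\<lambda>s. tensor_lift A \<beta> s \<otimes>\<^bsub>A\<^esub> tensor_lift A \<beta> t) \<in> module_hom R (tensor R M N) A"
      by (rule module_hom_comp[OF lin bilinearD(2)[OF mulA]]) (rule module_homD(1)[OF lin t])
  qed (simp add: one tensor_lift_bilinear_pure[OF MN P b])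
qed

end

subsection \<open>Functoriality and associativity\<close>

context
  fixes R :: "('a, 'r) ring_scheme" and K :: "('a, 'k, 'x) module_scheme" and L :: "('a, 'l, 'y) module_scheme"
    and M :: "('a, 'm, 'u) module_scheme" and N :: "('a, 'n, 'v) module_scheme" and f g
  assumes K: "module R K" and L: "module R L" and M: "module R M" and N: "module R N"
    and f: "f \<in> module_hom R K M" and g: "g \<in> module_hom R L N"
begin

lemma tensor_map_bilinear: "bilinear R K L (tensor R M N) (\<lambda>k l. pure_tensor R M N (f k) (g l))"
  by (rule bilinear_comp[OF pure_tensor_bilinear[OF M N] f g])

lemma tensor_map_linear: "tensor_map R M N f g \<in> module_hom R (tensor R K L) (tensor R M N)"
  unfolding tensor_map_def by (rule tensor_lift_linear[OF K L tensor_module[OF M N] tensor_map_bilinear])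

lemma tensor_map_pure:
  "\<lbrakk>k \<in> carrier K; l \<in> carrier L\<rbrakk>
    \<Longrightarrow> tensor_map R M N f g (pure_tensor R K L k l) = pure_tensor R M N (f k) (g l)"
  unfolding tensor_map_def by (rule tensor_lift_bilinear_pure[OF K L tensor_module[OF M N] tensor_map_bilinear])

lemma tensor_lift_map:
  assumes P: "module R P" and b: "bilinear R M N P \<beta>" and t: "t \<in> carrier (tensor R K L)"
  shows "tensor_lift P \<beta> (tensor_map R M N f g t) = tensor_lift P (\<lambda>k l. \<beta> (f k) (g l)) t"
  by (rule tensor_hom_ext[OF K L module_hom_comp[OF tensor_map_linear tensor_lift_linear[OF M N P b]]
        tensor_lift_linear[OF K L P bilinear_comp[OF b f g]] _ t])
     (simp add: tensor_map_pure tensor_lift_bilinear_pure[OF M N P b] tensor_lift_bilinear_pure[OF K L P bilinear_comp[OF b f g]]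
       module_homD[OF f] module_homD[OF g])

end

context
  fixes R :: "('a, 'r) ring_scheme" and M :: "('a, 'm, 'x) module_scheme" and N :: "('a, 'n, 'y) module_scheme"
    and P :: "('a, 'p, 'z) module_scheme"
  assumes M: "module R M" and N: "module R N" and P: "module R P"
begin

private abbreviation (input) "T1 \<equiv> tensor R M (tensor R N P)"
private lemma NPm: "module R (tensor R N P)" by (rule tensor_module[OF N P])
private lemma MNm: "module R (tensor R M N)" by (rule tensor_module[OF M N])
private lemma T1: "module R T1" by (rule tensor_module[OF M NPm])

lemma tensor_assoc_inner:
  assumes "p \<in> carrier P"
  shows "bilinear R M N T1 (\<lambda>m n. pure_tensor R M (tensor R N P) m (pure_tensor R N P n p))"
  by (rule bilinear_comp[OF pure_tensor_bilinear[OF M NPm] module_hom_id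
        bilinearD(2)[OF pure_tensor_bilinear[OF N P] assms]])

lemma tensor_assoc_outer:
  "bilinear R (tensor R M N) P T1 (\<lambda>t p. tensor_lift T1
       (\<lambda>m n. pure_tensor R M (tensor R N P) m (pure_tensor R N P n p)) t)"
proof (rule bilinearI)
  fix t assume t: "t \<in> carrier (tensor R M N)"
  show "(\<lambda>p. tensor_lift T1 (\<lambda>m n. pure_tensor R M (tensor R N P) m (pure_tensor R N P n p)) t) \<in> module_hom R P T1"
    by (rule tensor_lift_param_hom[OF P M N T1 tensor_assoc_inner _ t], assumption)
       (rule module_hom_comp[OF bilinearD(1)[OF pure_tensor_bilinear[OF N P]] bilinearD(1)[OF pure_tensor_bilinear[OF M NPm]]])
next
  fix p assume p: "p \<in> carrier P"
  show "(\<lambda>t. tensor_lift T1 (\<lambda>m n. pure_tensor R M (tensor R N P) m (pure_tensor R N P n p)) t) \<in> module_hom R (tensor R M N) T1"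
    by (rule tensor_lift_linear[OF M N T1 tensor_assoc_inner[OF p]])
qed

lemma tensor_assoc_linear: "tensor_assoc R M N P \<in> module_hom R (tensor R (tensor R M N) P) T1"
  unfolding tensor_assoc_def Let_def by (rule tensor_lift_linear[OF MNm P T1 tensor_assoc_outer])

lemma tensor_assoc_pure:
  assumes t: "t \<in> carrier (tensor R M N)" and p: "p \<in> carrier P"
  shows "tensor_assoc R M N P (pure_tensor R (tensor R M N) P t p) =
    tensor_lift T1 (\<lambda>m n. pure_tensor R M (tensor R N P) m (pure_tensor R N P n p)) t"
  unfolding tensor_assoc_def Let_def by (rule tensor_lift_bilinear_pure[OF MNm P T1 tensor_assoc_outer t p])

context
  fixes Q :: "('a, 'q, 'w) module_scheme" and \<tau> :: "'m \<Rightarrow> 'n \<Rightarrow> 'p \<Rightarrow> 'q"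
  assumes Q: "module R Q"
    and b1: "\<And>m. m \<in> carrier M \<Longrightarrow> bilinear R N P Q (\<tau> m)"
    and b3: "\<And>p. p \<in> carrier P \<Longrightarrow> bilinear R M N Q (\<lambda>m n. \<tau> m n p)"
begin

lemma trilinear_right: "bilinear R M (tensor R N P) Q (\<lambda>m t. tensor_lift Q (\<tau> m) t)"
proof (rule bilinearI)
  fix m assume "m \<in> carrier M"
  then show "(\<lambda>t. tensor_lift Q (\<tau> m) t) \<in> module_hom R (tensor R N P) Q"
    by (rule tensor_lift_linear[OF N P Q b1])
next
  fix t assume t: "t \<in> carrier (tensor R N P)"
  show "(\<lambda>m. tensor_lift Q (\<tau> m) t) \<in> module_hom R M Q"
    by (rule tensor_lift_param_hom[OF M N P Q b1 _ t], assumption, rule bilinearD(2)[OF b3])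
qed

lemma trilinear_left: "bilinear R (tensor R M N) P Q (\<lambda>t p. tensor_lift Q (\<lambda>m n. \<tau> m n p) t)"
proof (rule bilinearI)
  fix p assume "p \<in> carrier P"
  then show "(\<lambda>t. tensor_lift Q (\<lambda>m n. \<tau> m n p) t) \<in> module_hom R (tensor R M N) Q"
    by (rule tensor_lift_linear[OF M N Q b3])
next
  fix t assume t: "t \<in> carrier (tensor R M N)"
  show "(\<lambda>p. tensor_lift Q (\<lambda>m n. \<tau> m n p) t) \<in> module_hom R P Q"
    by (rule tensor_lift_param_hom[OF P M N Q b3 _ t], assumption, rule bilinearD(1)[OF b1])
qed

text \<open>A trilinear form can be evaluated on a threefold tensor in either bracketing; on
\<open>(m \<otimes> n) \<otimes> p\<close> both sides are \<open>\<tau> m n p\<close>.\<close>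

lemma tensor_lift_assoc:
  assumes s: "s \<in> carrier (tensor R (tensor R M N) P)"
  shows "tensor_lift Q (\<lambda>m t. tensor_lift Q (\<tau> m) t) (tensor_assoc R M N P s) =
    tensor_lift Q (\<lambda>t p. tensor_lift Q (\<lambda>m n. \<tau> m n p) t) s"
proof (rule tensor_hom_ext[OF MNm P module_hom_comp[OF tensor_assoc_linear tensor_lift_linear[OF M NPm Q trilinear_right]]
          tensor_lift_linear[OF MNm P Q trilinear_left] _ s])
  fix t p assume t: "t \<in> carrier (tensor R M N)" and p: "p \<in> carrier P"
  have "tensor_lift Q (\<lambda>m t. tensor_lift Q (\<tau> m) t) (tensor_assoc R M N P (pure_tensor R (tensor R M N) P t p)) =
    tensor_lift Q (\<lambda>m n. tensor_lift Q (\<lambda>m t. tensor_lift Q (\<tau> m) t)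
      (pure_tensor R M (tensor R N P) m (pure_tensor R N P n p))) t"
    unfolding tensor_assoc_pure[OF t p]
    by (rule hom_tensor_lift(1)[OF M N T1 Q tensor_assoc_inner[OF p] tensor_lift_linear[OF M NPm Q trilinear_right] t])
  also have "\<dots> = tensor_lift Q (\<lambda>m n. \<tau> m n p) t"
    by (rule tensor_lift_cong[OF M N Q hom_tensor_lift(2)[OF M N T1 Q tensor_assoc_inner[OF p] tensor_lift_linear[OF M NPm Q trilinear_right] t] b3[OF p] _ t])
       (simp add: tensor_lift_bilinear_pure[OF M NPm Q trilinear_right] tensor_lift_bilinear_pure[OF N P Q b1] p pure_tensor_closed[OF N P])
  also have "\<dots> = tensor_lift Q (\<lambda>t p. tensor_lift Q (\<lambda>m n. \<tau> m n p) t) (pure_tensor R (tensor R M N) P t p)"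
    by (simp add: tensor_lift_bilinear_pure[OF MNm P Q trilinear_left] t p)
  finally show "tensor_lift Q (\<lambda>m t. tensor_lift Q (\<tau> m) t) (tensor_assoc R M N P (pure_tensor R (tensor R M N) P t p)) = \<dots>" .
qed

end

end

section \<open>Finitely generated modules over Noetherian rings\<close>

context module
begin

lemma submodule_of_closed:
  assumes "H \<subseteq> carrier M" "\<zero>\<^bsub>M\<^esub> \<in> H"
    and "\<And>a b. \<lbrakk>a \<in> H; b \<in> H\<rbrakk> \<Longrightarrow> a \<oplus>\<^bsub>M\<^esub> b \<in> H"
    and "\<And>a x. \<lbrakk>a \<in> carrier R; x \<in> H\<rbrakk> \<Longrightarrow> a \<odot>\<^bsub>M\<^esub> x \<in> H"
  shows "submodule H R M"
proof (rule submoduleI)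
  fix a assume a: "a \<in> H"
  have "(\<ominus>\<^bsub>R\<^esub> \<one>\<^bsub>R\<^esub>) \<odot>\<^bsub>M\<^esub> a = \<ominus>\<^bsub>M\<^esub> a"
    using a assms(1) by (subst smult_l_minus) auto
  then show "\<ominus>\<^bsub>M\<^esub> a \<in> H" using assms(4)[of "\<ominus>\<^bsub>R\<^esub> \<one>\<^bsub>R\<^esub>" a] a by simp
qed (use assms in auto)

lemma submodule_zero: "submodule N R M \<Longrightarrow> \<zero>\<^bsub>M\<^esub> \<in> N"
  using submoduleE(2,4)[of N] submoduleE(1)[of N] smult_l_null by (metis R.zero_closed ex_in_conv subsetD)

lemma submodule_Int:
  assumes "submodule N R M" "submodule N' R M"
  shows "submodule (N \<inter> N') R M"
  using submoduleE(1,4,5)[OF assms(1)] submoduleE(1,4,5)[OF assms(2)]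
    submodule_zero[OF assms(1)] submodule_zero[OF assms(2)]
  by (intro submodule_of_closed) auto

lemma span_submodule:
  assumes "S \<subseteq> carrier M"
  shows "submodule (module_span R M S) R M"
proof (rule submodule_of_closed)
  show "module_span R M S \<subseteq> carrier M"
    unfolding module_span_def using carrier_is_submodule assms by blast
  show "\<zero>\<^bsub>M\<^esub> \<in> module_span R M S" unfolding module_span_def using submodule_zero by blast
  show "\<And>a b. \<lbrakk>a \<in> module_span R M S; b \<in> module_span R M S\<rbrakk> \<Longrightarrow> a \<oplus>\<^bsub>M\<^esub> b \<in> module_span R M S"
    unfolding module_span_def using submoduleE(5) by blast
  show "\<And>a x. \<lbrakk>a \<in> carrier R; x \<in> module_span R M S\<rbrakk> \<Longrightarrow> a \<odot>\<^bsub>M\<^esub> x \<in> module_span R M S"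
    unfolding module_span_def using submoduleE(4) by blast
qed

lemma span_superset: "S \<subseteq> module_span R M S"
  unfolding module_span_def by blast

lemma span_minimal: "\<lbrakk>submodule N R M; S \<subseteq> N\<rbrakk> \<Longrightarrow> module_span R M S \<subseteq> N"
  unfolding module_span_def by blast

lemma span_mono: "S \<subseteq> S' \<Longrightarrow> module_span R M S \<subseteq> module_span R M S'"
  unfolding module_span_def by blast

lemma span_closed: "S \<subseteq> carrier M \<Longrightarrow> module_span R M S \<subseteq> carrier M"
  by (rule span_minimal[OF carrier_is_submodule])

lemmas span_add = submoduleE(5)[OF span_submodule]
  and span_smult = submoduleE(4)[OF span_submodule]
  and span_zero = submodule_zero[OF span_submodule]

lemma span_induct [consumes 2, case_names base zero add smult]:
  assumes "x \<in> module_span R M S" "S \<subseteq> carrier M"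
    and "\<And>s. s \<in> S \<Longrightarrow> P s" "P \<zero>\<^bsub>M\<^esub>"
    and "\<And>x y. \<lbrakk>x \<in> module_span R M S; y \<in> module_span R M S; P x; P y\<rbrakk> \<Longrightarrow> P (x \<oplus>\<^bsub>M\<^esub> y)"
    and "\<And>r x. \<lbrakk>r \<in> carrier R; x \<in> module_span R M S; P x\<rbrakk> \<Longrightarrow> P (r \<odot>\<^bsub>M\<^esub> x)"
  shows "P x"
proof -
  have "submodule {x \<in> module_span R M S. P x} R M"
    using span_closed[OF assms(2)] span_zero[OF assms(2)] span_add[OF assms(2)] span_smult[OF assms(2)] assms(4-6)
    by (intro submodule_of_closed) auto
  then have "module_span R M S \<subseteq> {x \<in> module_span R M S. P x}"
    by (rule span_minimal) (use assms(3) span_superset in auto)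
  then show ?thesis using assms(1) by blast
qed

lemma span_insert:
  assumes x: "x \<in> module_span R M (insert f F)" and f: "f \<in> carrier M" and F: "F \<subseteq> carrier M"
  shows "\<exists>r \<in> carrier R. \<exists>w \<in> module_span R M F. x = r \<odot>\<^bsub>M\<^esub> f \<oplus>\<^bsub>M\<^esub> w"
proof -
  have fF: "insert f F \<subseteq> carrier M" using f F by auto
  have wc: "\<And>w. w \<in> module_span R M F \<Longrightarrow> w \<in> carrier M" using span_closed[OF F] by auto
  show ?thesis
    using x fF
  proof (induction rule: span_induct)
    case (base s)
    show ?case
    proof (cases "s = f")
      case True
      then show ?thesis using f span_zero[OF F] by (intro bexI[of _ "\<one>\<^bsub>R\<^esub>"] bexI[of _ "\<zero>\<^bsub>M\<^esub>"]) auto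
    next
      case False
      then show ?thesis using base span_superset[of F] wc f
        by (intro bexI[of _ "\<zero>\<^bsub>R\<^esub>"] bexI[of _ s]) auto
    qed
  next
    case zero
    show ?case using f span_zero[OF F] by (intro bexI[of _ "\<zero>\<^bsub>R\<^esub>"] bexI[of _ "\<zero>\<^bsub>M\<^esub>"]) auto
  next
    case (add x y)
    then obtain r w r' w' where "r \<in> carrier R" "w \<in> module_span R M F" "x = r \<odot>\<^bsub>M\<^esub> f \<oplus>\<^bsub>M\<^esub> w"
      "r' \<in> carrier R" "w' \<in> module_span R M F" "y = r' \<odot>\<^bsub>M\<^esub> f \<oplus>\<^bsub>M\<^esub> w'" by blast
    then show ?case using f wc span_add[OF F]
      by (intro bexI[of _ "r \<oplus>\<^bsub>R\<^esub> r'"] bexI[of _ "w \<oplus>\<^bsub>M\<^esub> w'"]) (auto simp: smult_l_distr M.add.m_ac)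
  next
    case (smult s x)
    then obtain r w where "r \<in> carrier R" "w \<in> module_span R M F" "x = r \<odot>\<^bsub>M\<^esub> f \<oplus>\<^bsub>M\<^esub> w" by blast
    then show ?case using f wc span_smult[OF F] smult(1)
      by (intro bexI[of _ "s \<otimes>\<^bsub>R\<^esub> r"] bexI[of _ "s \<odot>\<^bsub>M\<^esub> w"]) (auto simp: smult_r_distr smult_assoc1)
  qed
qed

lemma span_finite_support:
  assumes "x \<in> module_span R M S" "S \<subseteq> carrier M"
  shows "\<exists>S0. finite S0 \<and> S0 \<subseteq> S \<and> x \<in> module_span R M S0"
  using assms
proof (induction rule: span_induct)
  case (base s)
  then show ?case using span_superset[of "{s}"] by (intro exI[of _ "{s}"]) auto
next
  case zero
  show ?case using span_zero[of "{}"] by (intro exI[of _ "{}"]) auto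
next
  case (add x y)
  then obtain A B where AB: "finite A" "A \<subseteq> S" "x \<in> module_span R M A" "finite B" "B \<subseteq> S" "y \<in> module_span R M B" by blast
  then have "x \<in> module_span R M (A \<union> B)" "y \<in> module_span R M (A \<union> B)" "A \<union> B \<subseteq> carrier M"
    using span_mono[of A "A \<union> B"] span_mono[of B "A \<union> B"] assms(2) by auto
  then show ?case using AB span_add[of "A \<union> B"] by (intro exI[of _ "A \<union> B"]) auto
next
  case (smult r x)
  then obtain A where "finite A" "A \<subseteq> S" "x \<in> module_span R M A" by blast
  then show ?case using smult(1) span_smult[of A] assms(2) by (intro exI[of _ A]) auto
qed

lemma span_finite_support_set:
  assumes "finite T" "T \<subseteq> module_span R M S" "S \<subseteq> carrier M"
  shows "\<exists>S0. finite S0 \<and> S0 \<subseteq> S \<and> T \<subseteq> module_span R M S0"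
  using assms(1,2)
proof (induction T)
  case empty
  then show ?case by (intro exI[of _ "{}"]) auto
next
  case (insert t T)
  then obtain A where A: "finite A" "A \<subseteq> S" "T \<subseteq> module_span R M A" by blast
  obtain B where B: "finite B" "B \<subseteq> S" "t \<in> module_span R M B"
    using span_finite_support[of t S] insert(4) assms(3) by blast
  show ?case using A B span_mono[of A "A \<union> B"] span_mono[of B "A \<union> B"]
    by (intro exI[of _ "A \<union> B"]) auto
qed

lemma fg_span: "\<lbrakk>finite F; F \<subseteq> carrier M\<rbrakk> \<Longrightarrow> fg_submodule R M (module_span R M F)"
  unfolding fg_submodule_def using span_submodule[of F] span_superset[of F] by blast

lemma ideal_of_closed:
  assumes "I \<subseteq> carrier R" "\<zero>\<^bsub>R\<^esub> \<in> I" "\<And>a b. \<lbrakk>a \<in> I; b \<in> I\<rbrakk> \<Longrightarrow> a \<oplus>\<^bsub>R\<^esub> b \<in> I"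
    "\<And>a x. \<lbrakk>a \<in> I; x \<in> carrier R\<rbrakk> \<Longrightarrow> x \<otimes>\<^bsub>R\<^esub> a \<in> I"
  shows "ideal I R"
proof (rule idealI)
  show "ring R" by (rule R.ring_axioms)
  have "\<ominus>\<^bsub>R\<^esub> a \<in> I" if "a \<in> I" for a
    using assms(4)[OF that, of "\<ominus>\<^bsub>R\<^esub> \<one>\<^bsub>R\<^esub>"] that assms(1) by (auto simp: R.l_minus)
  then show "subgroup I (add_monoid R)"
    using assms(1-3) by unfold_locales (auto simp: a_inv_def)
  fix a x assume "a \<in> I" "x \<in> carrier R"
  then show "x \<otimes>\<^bsub>R\<^esub> a \<in> I" "a \<otimes>\<^bsub>R\<^esub> x \<in> I"
    using assms(4)[of a x] assms(1) R.m_comm[of a x] by auto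
qed

text \<open>As in the proof of Hilbert's basis theorem, the elements of \<open>N\<close> are studied through their
coefficient at one distinguished generator \<open>f\<close>.\<close>

lemma leading_coefficients_ideal:
  assumes f: "f \<in> carrier M" and F: "F \<subseteq> carrier M" and N: "submodule N R M"
  shows "ideal {r \<in> carrier R. \<exists>w \<in> module_span R M F. r \<odot>\<^bsub>M\<^esub> f \<oplus>\<^bsub>M\<^esub> w \<in> N} R" (is "ideal ?I R")
proof -
  have wc: "\<And>w. w \<in> module_span R M F \<Longrightarrow> w \<in> carrier M" using span_closed[OF F] by auto
  note Nz = submodule_zero[OF N]
  note N = submoduleE(1,4,5)[OF N]
  define I where "I = ?I"
  have "ideal I R"
  proof (rule ideal_of_closed)
    show "\<zero>\<^bsub>R\<^esub> \<in> I" unfolding I_def using f span_zero[OF F] Nz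
      by (auto intro!: bexI[of _ "\<zero>\<^bsub>M\<^esub>"])
  next
    fix a b assume "a \<in> I" "b \<in> I"
    then obtain w w' where *: "a \<in> carrier R" "b \<in> carrier R" "w \<in> module_span R M F" "w' \<in> module_span R M F"
      "a \<odot>\<^bsub>M\<^esub> f \<oplus>\<^bsub>M\<^esub> w \<in> N" "b \<odot>\<^bsub>M\<^esub> f \<oplus>\<^bsub>M\<^esub> w' \<in> N" unfolding I_def by blast
    then have "(a \<oplus>\<^bsub>R\<^esub> b) \<odot>\<^bsub>M\<^esub> f \<oplus>\<^bsub>M\<^esub> (w \<oplus>\<^bsub>M\<^esub> w') = (a \<odot>\<^bsub>M\<^esub> f \<oplus>\<^bsub>M\<^esub> w) \<oplus>\<^bsub>M\<^esub> (b \<odot>\<^bsub>M\<^esub> f \<oplus>\<^bsub>M\<^esub> w')"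
      using f wc by (simp add: smult_l_distr M.add.m_ac)
    then show "a \<oplus>\<^bsub>R\<^esub> b \<in> I" unfolding I_def using * N(3) span_add[OF F] by (auto intro!: bexI[of _ "w \<oplus>\<^bsub>M\<^esub> w'"])
  next
    fix a x assume "a \<in> I" and x: "x \<in> carrier R"
    then obtain w where *: "a \<in> carrier R" "w \<in> module_span R M F" "a \<odot>\<^bsub>M\<^esub> f \<oplus>\<^bsub>M\<^esub> w \<in> N" unfolding I_def by blast
    then have "(x \<otimes>\<^bsub>R\<^esub> a) \<odot>\<^bsub>M\<^esub> f \<oplus>\<^bsub>M\<^esub> (x \<odot>\<^bsub>M\<^esub> w) = x \<odot>\<^bsub>M\<^esub> (a \<odot>\<^bsub>M\<^esub> f \<oplus>\<^bsub>M\<^esub> w)"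
      using f wc x by (simp add: smult_r_distr smult_assoc1)
    then show "x \<otimes>\<^bsub>R\<^esub> a \<in> I" unfolding I_def using * N(2) x span_smult[OF F] by (auto intro!: bexI[of _ "x \<odot>\<^bsub>M\<^esub> w"])
  qed (auto simp: I_def)
  then show ?thesis by (simp add: I_def)
qed

text \<open>Induction on the number of generators.  Choose finitely many elements of \<open>N\<close> whose coefficients at
the new generator \<open>f\<close> generate the ideal of all such coefficients.  Subtracting a combination of
them from an element of \<open>N\<close> leaves an element of \<open>N\<close> in the span of the old generators.\<close>

lemma noetherian_span:
  assumes noeth: "noetherian_ring R" and F: "finite F" "F \<subseteq> carrier M"
    and N: "submodule N R M" "N \<subseteq> module_span R M F"
  shows "fg_submodule R M N"
  using F N
proof (induction F arbitrary: N)
  case empty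
  then have "N = module_span R M {}" using span_minimal[of N "{}"] by auto
  then show ?case using fg_span[of "{}"] by simp
next
  case (insert f F)
  have f: "f \<in> carrier M" and F: "F \<subseteq> carrier M" using insert.prems by auto
  have wc: "\<And>w. w \<in> module_span R M F \<Longrightarrow> w \<in> carrier M" using span_closed[OF F] by auto
  note N = submoduleE(1,4,5)[OF insert.prems(2)]
  define I where "I = {r \<in> carrier R. \<exists>w \<in> module_span R M F. r \<odot>\<^bsub>M\<^esub> f \<oplus>\<^bsub>M\<^esub> w \<in> N}"
  have "ideal I R" unfolding I_def by (rule leading_coefficients_ideal[OF f F insert.prems(2)])
  then obtain A where A: "A \<subseteq> carrier R" "finite A" "I = Idl\<^bsub>R\<^esub> A"
    using noetherian_ring.finetely_gen[OF noeth] by blast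
  have "\<forall>a\<in>A. \<exists>w \<in> module_span R M F. a \<odot>\<^bsub>M\<^esub> f \<oplus>\<^bsub>M\<^esub> w \<in> N"
    using R.genideal_self[OF A(1)] A(3) unfolding I_def by blast
  then obtain w where w: "\<And>a. a \<in> A \<Longrightarrow> w a \<in> module_span R M F" "\<And>a. a \<in> A \<Longrightarrow> a \<odot>\<^bsub>M\<^esub> f \<oplus>\<^bsub>M\<^esub> w a \<in> N"
    by metis
  define B where "B = (\<lambda>a. a \<odot>\<^bsub>M\<^esub> f \<oplus>\<^bsub>M\<^esub> w a) ` A"
  have B: "finite B" "B \<subseteq> N" "B \<subseteq> carrier M" using A w N(1) by (auto simp: B_def)
  have hc: "\<And>h. h \<in> module_span R M B \<Longrightarrow> h \<in> carrier M" using span_closed[OF B(3)] by auto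
  \<comment> \<open>The coefficients at \<open>f\<close> of combinations of \<open>B\<close> form an ideal as well, and it contains the generators \<open>A\<close> of \<open>I\<close>.\<close>
  define K where "K = {r \<in> carrier R. \<exists>v \<in> module_span R M F. r \<odot>\<^bsub>M\<^esub> f \<oplus>\<^bsub>M\<^esub> v \<in> module_span R M B}"
  have "ideal K R" unfolding K_def by (rule leading_coefficients_ideal[OF f F span_submodule[OF B(3)]])
  moreover have "A \<subseteq> K"
    using A(1) w span_superset[of B] unfolding K_def B_def by blast
  ultimately have IK: "I \<subseteq> K" using R.genideal_minimal A(3) by blast
  have "submodule (N \<inter> module_span R M F) R M"
    by (rule submodule_Int[OF insert.prems(2) span_submodule[OF F]])
  then have "fg_submodule R M (N \<inter> module_span R M F)" using insert.IH F by blast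
  then obtain C where C: "finite C" "C \<subseteq> N" "C \<subseteq> module_span R M F" "module_span R M C = N \<inter> module_span R M F"
    unfolding fg_submodule_def by blast
  have BC: "B \<union> C \<subseteq> carrier M" using B(3) C(2) N(1) by auto
  have "N \<subseteq> module_span R M (B \<union> C)"
  proof
    fix x assume x: "x \<in> N"
    then obtain r v where rv: "r \<in> carrier R" "v \<in> module_span R M F" "x = r \<odot>\<^bsub>M\<^esub> f \<oplus>\<^bsub>M\<^esub> v"
      using span_insert[OF _ f F] insert.prems(3) by blast
    then have "r \<in> K" using x IK unfolding I_def by blast
    then obtain v' where v': "v' \<in> module_span R M F" "r \<odot>\<^bsub>M\<^esub> f \<oplus>\<^bsub>M\<^esub> v' \<in> module_span R M B" unfolding K_def by blast
    let ?h = "r \<odot>\<^bsub>M\<^esub> f \<oplus>\<^bsub>M\<^esub> v'"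
    have hN: "?h \<in> N" using v'(2) span_minimal[OF insert.prems(2) B(2)] by blast
    have vv: "v \<oplus>\<^bsub>M\<^esub> \<ominus>\<^bsub>M\<^esub> v' \<in> module_span R M F"
      using rv v' span_add[OF F] submoduleE(3)[OF span_submodule[OF F]] by blast
    have c: "r \<odot>\<^bsub>M\<^esub> f \<in> carrier M" "v \<in> carrier M" "v' \<in> carrier M" using rv v' f wc by auto
    have e: "x \<oplus>\<^bsub>M\<^esub> \<ominus>\<^bsub>M\<^esub> ?h = v \<oplus>\<^bsub>M\<^esub> \<ominus>\<^bsub>M\<^esub> v'"
      unfolding rv(3) using c
      by (simp add: M.minus_add M.add.m_ac) (metis M.add.inv_closed M.add.m_lcomm M.r_neg M.r_zero M.add.m_closed)
    have "x \<oplus>\<^bsub>M\<^esub> \<ominus>\<^bsub>M\<^esub> ?h \<in> module_span R M C"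
      using vv N(3)[OF x submoduleE(3)[OF insert.prems(2) hN]] unfolding e C(4) by blast
    then have "x \<oplus>\<^bsub>M\<^esub> \<ominus>\<^bsub>M\<^esub> ?h \<in> module_span R M (B \<union> C)" "?h \<in> module_span R M (B \<union> C)"
      using v'(2) span_mono[of B "B \<union> C"] span_mono[of C "B \<union> C"] by auto
    then have "(x \<oplus>\<^bsub>M\<^esub> \<ominus>\<^bsub>M\<^esub> ?h) \<oplus>\<^bsub>M\<^esub> ?h \<in> module_span R M (B \<union> C)" by (rule span_add[OF BC])
    moreover have "(x \<oplus>\<^bsub>M\<^esub> \<ominus>\<^bsub>M\<^esub> ?h) \<oplus>\<^bsub>M\<^esub> ?h = x"
      using x hN N(1) by (simp add: M.add.m_assoc subsetD M.l_neg)
    ultimately show "x \<in> module_span R M (B \<union> C)" by simp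
  qed
  moreover have "module_span R M (B \<union> C) \<subseteq> N" by (rule span_minimal[OF insert.prems(2)]) (use B C in auto)
  ultimately show ?case
    unfolding fg_submodule_def using insert.prems(2) B(1,2) C(1,2) by (intro conjI exI[of _ "B \<union> C"]) auto
qed

end

lemma module_hom_span_submodule:
  assumes M: "module R M" and N: "module R N" and L: "submodule L R M"
    and h: "h \<in> module_hom R (M\<lparr>carrier := L\<rparr>) N" and F: "F \<subseteq> L"
    and m: "m \<in> module_span R M F"
  shows "h m \<in> module_span R N (h ` F)"
proof -
  interpret M: module R M by fact
  interpret N: module R N by fact
  have FM: "F \<subseteq> carrier M" using F M.submoduleE(1)[OF L] by blast
  have sL: "x \<in> L" if "x \<in> module_span R M F" for x using that M.span_minimal[OF L F] by blast
  have hF: "h ` F \<subseteq> carrier N" using module_homD(1)[OF h] F by auto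
  show ?thesis
    using m FM
  proof (induction rule: M.span_induct)
    case (base s)
    then show ?case using N.span_superset[of "h ` F"] by blast
  next
    case zero
    have "h \<zero>\<^bsub>M\<^esub> = \<zero>\<^bsub>N\<^esub>" using module_hom_zero[OF submodule.submodule_is_module[OF L M] N h] by simp
    then show ?case using N.span_zero[OF hF] by simp
  next
    case (add x y)
    then show ?case using module_homD(2)[OF h, of x y] sL N.span_add[OF hF add(3,4)] by simp
  next
    case (smult r x)
    then show ?case using module_homD(3)[OF h, of r x] sL N.span_smult[OF hF smult(1,3)] by simp
  qed
qed

lemma module_hom_span:
  fixes M :: "('a, 'm, 'x) module_scheme"
  assumes M: "module R M" and N: "module R N" and h: "h \<in> module_hom R M N"
    and F: "F \<subseteq> carrier M" and m: "m \<in> module_span R M F"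
  shows "h m \<in> module_span R N (h ` F)"
proof -
  interpret M: module R M by fact
  have "M\<lparr>carrier := carrier M\<rparr> = M" by simp
  then show ?thesis
    using module_hom_span_submodule[OF M N M.carrier_is_submodule _ F m, of h] h by simp
qed

section \<open>Maps of finite rank\<close>

text \<open>Finite sums of maps \<open>m \<mapsto> \<phi> m \<odot> b\<close> with linear functionals \<open>\<phi>\<close>.  That the identity of a module has
finite rank is the dual basis property, which characterises the finitely generated projective
modules.  The inductive form replaces indexed families by rule induction; the equations are
required on the carrier only, so that the notion does not depend on values outside of it.\<close>

inductive finite_rank ::
    "('a, 'r) ring_scheme \<Rightarrow> ('a, 'm, 'x) module_scheme \<Rightarrow> ('a, 'p, 'z) module_scheme \<Rightarrow> ('m \<Rightarrow> 'p) \<Rightarrow> bool"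
  for R M P where
    zero: "\<forall>m \<in> carrier M. g m = \<zero>\<^bsub>P\<^esub> \<Longrightarrow> finite_rank R M P g"
  | step: "\<lbrakk>\<phi> \<in> module_hom R M (reg_module R); b \<in> carrier P; finite_rank R M P g;
      \<forall>m \<in> carrier M. g' m = \<phi> m \<odot>\<^bsub>P\<^esub> b \<oplus>\<^bsub>P\<^esub> g m\<rbrakk> \<Longrightarrow> finite_rank R M P g'"

lemma finite_rank_linear:
  assumes M: "module R M" and P: "module R P" and "finite_rank R M P g"
  shows "g \<in> module_hom R M P"
  using assms(3)
proof induction
  case (zero g)
  show ?case by (rule module_hom_cong[OF module_hom_const_zero[OF P] M]) (simp add: zero)
next
  case (step \<phi> b g g')
  interpret P: module R P by fact
  have "(\<lambda>m. \<phi> m \<odot>\<^bsub>P\<^esub> b) \<in> module_hom R M P"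
    using step(2) by (intro module_homI) (simp_all add: module_homD[OF step(1), simplified] P.smult_l_distr P.smult_assoc1)
  then show ?case
    using module_hom_cong[OF module_hom_plus[OF P _ step.IH] M] step(4) by auto
qed

lemma finite_rank_plus:
  assumes P: "module R P" and M: "module R M" and "finite_rank R M P g" and h: "finite_rank R M P h"
    and "\<forall>m \<in> carrier M. k m = g m \<oplus>\<^bsub>P\<^esub> h m"
  shows "finite_rank R M P k"
  using assms(3,5)
proof (induction arbitrary: k)
  case (zero g)
  interpret P: module R P by fact
  have hc: "h m \<in> carrier P" if "m \<in> carrier M" for m
    using module_homD(1)[OF finite_rank_linear[OF M P h] that] .
  have eq: "\<forall>m \<in> carrier M. k m = h m" using zero hc by auto
  from h show ?case
  proof cases
    case zero then show ?thesis using eq by (auto intro: finite_rank.zero)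
  next
    case (step \<phi> b g) then show ?thesis using eq by (auto intro!: finite_rank.step[of \<phi> R M b P g])
  qed
next
  case (step \<phi> b g g')
  interpret P: module R P by fact
  have c: "h m \<in> carrier P" "g m \<in> carrier P" "\<phi> m \<in> carrier R" if "m \<in> carrier M" for m
    using module_homD(1)[OF finite_rank_linear[OF M P h] that] module_homD(1)[OF finite_rank_linear[OF M P step(3)] that]
      module_homD(1)[OF step(1) that] by auto
  show ?case
    by (rule finite_rank.step[OF step(1,2) step.IH[of "\<lambda>m. g m \<oplus>\<^bsub>P\<^esub> h m"]])
       (use step c in \<open>auto simp: P.M.add.m_assoc\<close>)
qed

lemma finite_rank_comp:
  assumes "finite_rank R M P g" "h \<in> module_hom R M' M" "\<forall>m \<in> carrier M'. k m = g (h m)"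
  shows "finite_rank R M' P k"
  using assms(1,3)
proof (induction arbitrary: k)
  case (zero g)
  then show ?case using module_homD(1)[OF assms(2)] by (intro finite_rank.zero) auto
next
  case (step \<phi> b g g')
  show ?case
    by (rule finite_rank.step[OF module_hom_comp[OF assms(2) step(1)] step(2) step.IH[of "\<lambda>m. g (h m)"]])
       (use step module_homD(1)[OF assms(2)] in auto)
qed

lemma finite_rank_post:
  assumes M: "module R M" and P: "module R P" and P': "module R P'"
    and "finite_rank R M P g" "h \<in> module_hom R P P'" "\<forall>m \<in> carrier M. k m = h (g m)"
  shows "finite_rank R M P' k"
  using assms(4,6)
proof (induction arbitrary: k)
  case (zero g)
  then show ?case using module_hom_zero[OF P P' assms(5)] by (intro finite_rank.zero) auto
next
  case (step \<phi> b g g')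
  interpret P: module R P by fact
  have c: "g m \<in> carrier P" "\<phi> m \<in> carrier R" if "m \<in> carrier M" for m
    using module_homD(1)[OF finite_rank_linear[OF M P step(3)] that] module_homD(1)[OF step(1) that] by auto
  show ?case
    by (rule finite_rank.step[OF step(1) module_homD(1)[OF assms(5) step(2)] step.IH[of "\<lambda>m. h (g m)"]])
       (use step c in \<open>auto simp: module_homD[OF assms(5)]\<close>)
qed

section \<open>Modules of functions\<close>

lemma fun_algebra_simps [simp]:
  "carrier (fun_algebra R G) = carrier G \<rightarrow>\<^sub>E carrier R"
  "monoid.mult (fun_algebra R G) = (\<lambda>f f'. \<lambda>x\<in>carrier G. f x \<otimes>\<^bsub>R\<^esub> f' x)"
  "one (fun_algebra R G) = (\<lambda>x\<in>carrier G. \<one>\<^bsub>R\<^esub>)"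
  "ring.zero (fun_algebra R G) = (\<lambda>x\<in>carrier G. \<zero>\<^bsub>R\<^esub>)"
  "add (fun_algebra R G) = (\<lambda>f f'. \<lambda>x\<in>carrier G. f x \<oplus>\<^bsub>R\<^esub> f' x)"
  "smult (fun_algebra R G) = (\<lambda>r f. \<lambda>x\<in>carrier G. r \<otimes>\<^bsub>R\<^esub> f x)"
  by (simp_all add: fun_algebra_def)

lemma fun_algebra_eqI:
  assumes "f \<in> carrier (fun_algebra R G)" "g \<in> carrier (fun_algebra R G)"
    and "\<And>x. x \<in> carrier G \<Longrightarrow> f x = g x"
  shows "f = g"
  using assms by (auto intro: PiE_ext)

lemma fun_algebra_algebra:
  assumes "cring R"
  shows "algebra R (fun_algebra R G)"
proof -
  interpret R: cring R by fact
  let ?V = "fun_algebra R G"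
  note eq = fun_algebra_eqI[of _ R G]
  have ap: "f x \<in> carrier R" if "f \<in> carrier G \<rightarrow>\<^sub>E carrier R" "x \<in> carrier G" for f x using that by auto
  have ag: "abelian_group ?V"
  proof (rule abelian_groupI)
    fix f assume f: "f \<in> carrier ?V"
    show "\<exists>g\<in>carrier ?V. g \<oplus>\<^bsub>?V\<^esub> f = \<zero>\<^bsub>?V\<^esub>"
      using f by (intro bexI[of _ "\<lambda>x\<in>carrier G. \<ominus>\<^bsub>R\<^esub> f x"] eq) (auto simp: ap R.l_neg)
  qed (auto simp: ap R.add.m_ac intro!: eq)
  have cr: "cring ?V"
  proof (rule cringI[OF ag])
    show "Group.comm_monoid ?V"
      by (rule comm_monoidI) (auto simp: ap R.m_ac intro!: eq)
  qed (auto simp: ap R.l_distr intro!: eq)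
  show ?thesis
    by (rule algebraI[OF \<open>cring R\<close> cr]) (auto simp: ap R.l_distr R.r_distr R.m_assoc intro!: eq)
qed

lemma fun_algebra_module: "cring R \<Longrightarrow> module R (fun_algebra R G)"
  by (rule algebra.module[OF fun_algebra_algebra])

lemma submodule_module: "\<lbrakk>submodule L R M; module R M\<rbrakk> \<Longrightarrow> module R (M\<lparr>carrier := L\<rparr>)"
  by (rule submodule.submodule_is_module)

lemma eval_linear:
  assumes "L \<subseteq> carrier (fun_algebra R G)" "x \<in> carrier G"
  shows "(\<lambda>f. f x) \<in> module_hom R ((fun_algebra R G)\<lparr>carrier := L\<rparr>) (reg_module R)"
  using assms by (intro module_homI) auto

text \<open>Consider the vectors \<open>(a(x))\<^sub>a\<close> in \<open>R\<^sup>F\<close>, one for each point \<open>x\<close>.  The submodule that they span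
is spanned by finitely many of them, say those of the points in \<open>Y\<close>.  A function in the span of \<open>F\<close>
depends on \<open>x\<close> through a linear functional of its vector, so if it vanishes on \<open>Y\<close>, it vanishes
everywhere.\<close>

lemma fg_functions_separated:
  fixes R :: "('a, 'r) ring_scheme" and G :: "('b, 'x) monoid_scheme"
  assumes R: "cring R" and noeth: "noetherian_ring R" and F: "finite F" "F \<subseteq> carrier (fun_algebra R G)"
  shows "\<exists>Y. finite Y \<and> Y \<subseteq> carrier G \<and>
    (\<forall>f \<in> module_span R (fun_algebra R G) F. (\<forall>y \<in> Y. f y = \<zero>\<^bsub>R\<^esub>) \<longrightarrow> f = \<zero>\<^bsub>fun_algebra R G\<^esub>)"
proof -
  interpret R: cring R by fact
  let ?V = "fun_algebra R G"
  interpret V: module R ?V by (rule fun_algebra_module[OF R])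
  \<comment> \<open>The power \<open>R\<^sup>F\<close> is the module of functions on a structure of which only the carrier matters.\<close>
  define FM :: "('b \<Rightarrow> 'a) monoid" where "FM = \<lparr>carrier = F, monoid.mult = (\<lambda>x y. x), one = undefined\<rparr>"
  let ?W = "fun_algebra R FM"
  interpret W: module R ?W by (rule fun_algebra_module[OF R])
  have cFM: "carrier FM = F" by (simp add: FM_def)
  define \<delta> where "\<delta> a = (\<lambda>b\<in>F. if b = a then \<one>\<^bsub>R\<^esub> else \<zero>\<^bsub>R\<^esub>)" for a :: "'b \<Rightarrow> 'a"
  have \<delta>: "\<delta> ` F \<subseteq> carrier ?W" by (auto simp: \<delta>_def cFM)
  \<comment> \<open>The unit vectors span \<open>R\<^sup>F\<close>: induction on the support.\<close>
  have full: "v \<in> module_span R ?W (\<delta> ` F)"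
    if "finite B" "B \<subseteq> F" "v \<in> carrier ?W" "\<forall>a \<in> F - B. v a = \<zero>\<^bsub>R\<^esub>" for B v
    using that
  proof (induction B arbitrary: v)
    case empty
    then have "v = \<zero>\<^bsub>?W\<^esub>" by (intro fun_algebra_eqI[OF _ W.M.zero_closed]) (auto simp: cFM)
    then show ?case using W.span_zero[OF \<delta>] by metis
  next
    case (insert a B)
    define v' where "v' = v(a := \<zero>\<^bsub>R\<^esub>)"
    have v': "v' \<in> carrier ?W" using insert.prems by (auto simp: v'_def cFM PiE_def extensional_def Pi_def)
    have a: "a \<in> F" using insert.prems by auto
    have "v' \<in> module_span R ?W (\<delta> ` F)"
      by (rule insert.IH) (use insert.prems v' in \<open>auto simp: v'_def\<close>)
    moreover have va: "v a \<in> carrier R" using insert.prems(2) a by (auto simp: cFM)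
    then have "v a \<odot>\<^bsub>?W\<^esub> \<delta> a \<in> module_span R ?W (\<delta> ` F)"
      using W.span_superset[of "\<delta> ` F"] a by (intro W.span_smult[OF \<delta>]) auto
    ultimately have "v' \<oplus>\<^bsub>?W\<^esub> (v a \<odot>\<^bsub>?W\<^esub> \<delta> a) \<in> module_span R ?W (\<delta> ` F)" by (rule W.span_add[OF \<delta>])
    moreover have "v' \<oplus>\<^bsub>?W\<^esub> (v a \<odot>\<^bsub>?W\<^esub> \<delta> a) = v"
    proof (rule fun_algebra_eqI[OF _ insert.prems(2)])
      have "\<delta> a \<in> carrier ?W" using \<delta> a by auto
      then show "v' \<oplus>\<^bsub>?W\<^esub> (v a \<odot>\<^bsub>?W\<^esub> \<delta> a) \<in> carrier ?W"
        by (intro W.M.a_closed W.smult_closed v' va)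
      fix b assume b: "b \<in> carrier FM"
      then have "v b \<in> carrier R" using insert.prems(2) by auto
      then show "(v' \<oplus>\<^bsub>?W\<^esub> (v a \<odot>\<^bsub>?W\<^esub> \<delta> a)) b = v b"
        using b va by (auto simp: cFM v'_def \<delta>_def)
    qed
    ultimately show ?case by simp
  qed
  define ev where "ev x = (\<lambda>a\<in>F. a x)" for x :: 'b
  define E where "E = ev ` carrier G"
  have "a x \<in> carrier R" if "a \<in> F" "x \<in> carrier G" for a x using subsetD[OF F(2) that(1)] that(2) by auto
  then have E: "E \<subseteq> carrier ?W" by (auto simp: E_def ev_def cFM)
  have sub: "module_span R ?W E \<subseteq> module_span R ?W (\<delta> ` F)"
    using full[OF F(1)] W.span_closed[OF E] by auto
  have "fg_submodule R ?W (module_span R ?W E)"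
    by (rule W.noetherian_span[OF noeth finite_imageI[OF F(1)] \<delta> W.span_submodule[OF E] sub])
  then obtain T where T: "finite T" "T \<subseteq> module_span R ?W E" "module_span R ?W T = module_span R ?W E"
    unfolding fg_submodule_def by blast
  obtain E0 where E0: "finite E0" "E0 \<subseteq> E" "T \<subseteq> module_span R ?W E0"
    using W.span_finite_support_set[OF T(1,2) E] by blast
  obtain Y where Y: "finite Y" "Y \<subseteq> carrier G" "E0 = ev ` Y"
    using finite_subset_image[OF E0(1) E0(2)[unfolded E_def]] by blast
  have E0c: "E0 \<subseteq> carrier ?W" using E0 E by auto
  have EE: "E \<subseteq> module_span R ?W E0"
    using W.span_superset[of E] T(3) W.span_minimal[OF W.span_submodule[OF E0c] E0(3)] by blast
  have lin: "\<exists>l \<in> module_hom R ?W (reg_module R). \<forall>x \<in> carrier G. f x = l (ev x)"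
    if "f \<in> module_span R ?V F" for f
    using that F(2)
  proof (induction rule: V.span_induct)
    case (base a)
    have "(\<lambda>v. v a) \<in> module_hom R ?W (reg_module R)"
      using base by (intro module_homI) (auto simp: cFM)
    then show ?case using base by (intro bexI[of _ "\<lambda>v. v a"]) (auto simp: ev_def)
  next
    case zero
    show ?case by (rule bexI[OF _ module_hom_const_zero[OF reg_module_module[OF R]]]) auto
  next
    case (add f g)
    then obtain l l' where "l \<in> module_hom R ?W (reg_module R)" "\<forall>x \<in> carrier G. f x = l (ev x)"
      "l' \<in> module_hom R ?W (reg_module R)" "\<forall>x \<in> carrier G. g x = l' (ev x)" by blast
    then show ?case using module_hom_plus[OF reg_module_module[OF R], of l ?W l'] by (intro bexI[of _ "\<lambda>v. l v \<oplus>\<^bsub>R\<^esub> l' v"]) auto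
  next
    case (smult r f)
    then obtain l where "l \<in> module_hom R ?W (reg_module R)" "\<forall>x \<in> carrier G. f x = l (ev x)" by blast
    then show ?case using module_hom_scale[OF reg_module_module[OF R], of l ?W r] smult(1)
      by (intro bexI[of _ "\<lambda>v. r \<otimes>\<^bsub>R\<^esub> l v"]) auto
  qed
  have "f = \<zero>\<^bsub>?V\<^esub>" if f: "f \<in> module_span R ?V F" and z: "\<forall>y \<in> Y. f y = \<zero>\<^bsub>R\<^esub>" for f
  proof -
    obtain l where l: "l \<in> module_hom R ?W (reg_module R)" "\<forall>x \<in> carrier G. f x = l (ev x)" using lin[OF f] by blast
    have "l v = \<zero>\<^bsub>R\<^esub>" if "v \<in> module_span R ?W E0" for v
      using that E0c
    proof (induction rule: W.span_induct)
      case (base v)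
      then obtain y where "y \<in> Y" "v = ev y" using Y(3) by blast
      then show ?case using Y(2) z l(2) by (metis subsetD)
    next
      case zero show ?case using module_hom_zero[OF W.module_axioms reg_module_module[OF R] l(1)] by (simp only: reg_module_simps)
    next
      case (add v w) then show ?case
        using module_homD(2)[OF l(1)] W.span_closed[OF E0c] by (simp del: fun_algebra_simps add: subset_iff)
    next
      case (smult r v) then show ?case
        using module_homD(3)[OF l(1)] W.span_closed[OF E0c] by (simp del: fun_algebra_simps add: subset_iff)
    qed
    then have "f x = \<zero>\<^bsub>R\<^esub>" if "x \<in> carrier G" for x
      using EE l(2) that by (auto simp: E_def)
    moreover have "f \<in> carrier ?V" using f V.span_closed[OF F(2)] by blast
    ultimately show ?thesis by (intro fun_algebra_eqI[OF _ V.M.zero_closed]) simp_all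
  qed
  then show ?thesis using Y by blast
qed

section \<open>Projectivity of modules of functions over hereditary rings\<close>

lemma ideal_submodule:
  assumes R: "cring R" and I: "ideal I R"
  shows "submodule I R (reg_module R)"
proof -
  interpret R: cring R by fact
  interpret I: ideal I R by fact
  interpret reg: module R "reg_module R" by (rule reg_module_module[OF R])
  show ?thesis
    by (rule reg.submodule_of_closed) (use I.a_subset in \<open>auto simp: I.I_l_closed\<close>)
qed

text \<open>A finite generating set \<open>A\<close> of the ideal \<open>I\<close> gives a surjection \<open>R\<^sup>A \<rightarrow> I\<close>.  By projectivity the
identity lifts along it, and the coordinates of the lift are functionals \<open>\<phi>\<^sub>a\<close> with
\<open>x = \<Sum>\<^sub>a \<phi>\<^sub>a(x) a\<close>.\<close>

lemma hereditary_ideal_finite_rank: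
  assumes R: "cring R" and noeth: "noetherian_ring R" and her: "hereditary_ring R" and I: "ideal I R"
  shows "finite_rank R ((reg_module R)\<lparr>carrier := I\<rparr>) ((reg_module R)\<lparr>carrier := I\<rparr>) (\<lambda>x. x)"
proof -
  interpret R: cring R by fact
  interpret I: ideal I R by fact
  let ?I = "(reg_module R)\<lparr>carrier := I\<rparr>"
  have mI: "module R ?I" by (rule submodule_module[OF ideal_submodule[OF R I] reg_module_module[OF R]])
  obtain A where A: "A \<subseteq> carrier R" "finite A" "I = Idl\<^bsub>R\<^esub> A"
    using noetherian_ring.finetely_gen[OF noeth I] by blast
  have AI: "A \<subseteq> I" using R.genideal_self[OF A(1)] A(3) by blast
  \<comment> \<open>Only the carrier of \<open>AM\<close> matters: \<open>fun_algebra R AM\<close> is the free module \<open>R\<^sup>A\<close>.\<close>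
  define AM :: "'a monoid" where "AM = \<lparr>carrier = A, monoid.mult = (\<lambda>x y. x), one = undefined\<rparr>"
  have cAM: "carrier AM = A" by (simp add: AM_def)
  let ?W = "fun_algebra R AM"
  have mW: "module R ?W" by (rule fun_algebra_module[OF R])
  define g where "g v = finsum R (\<lambda>a. v a \<otimes>\<^bsub>R\<^esub> a) A" for v
  have va: "v a \<in> carrier R" "a \<in> carrier R" if "v \<in> carrier ?W" "a \<in> A" for v a using that A(1) by (auto simp: cAM)
  have gI: "g v \<in> I" if v: "v \<in> carrier ?W" for v
  proof -
    have "finsum R (\<lambda>a. v a \<otimes>\<^bsub>R\<^esub> a) B \<in> I" if "B \<subseteq> A" for B
      using finite_subset[OF that A(2)] that
    proof (induction B)
      case (insert b B)
      then have "finsum R (\<lambda>a. v a \<otimes>\<^bsub>R\<^esub> a) (insert b B) = v b \<otimes>\<^bsub>R\<^esub> b \<oplus>\<^bsub>R\<^esub> finsum R (\<lambda>a. v a \<otimes>\<^bsub>R\<^esub> a) B"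
        using va[OF v] by (intro R.finsum_insert) auto
      then show ?case using insert va[OF v] AI by (auto intro!: I.a_closed I.I_l_closed)
    qed simp
    then show ?thesis by (simp add: g_def)
  qed
  have ghom: "g \<in> module_hom R ?W ?I"
  proof (rule module_homI)
    fix v w assume v: "v \<in> carrier ?W" and w: "w \<in> carrier ?W"
    have "g (v \<oplus>\<^bsub>?W\<^esub> w) = finsum R (\<lambda>a. v a \<otimes>\<^bsub>R\<^esub> a \<oplus>\<^bsub>R\<^esub> w a \<otimes>\<^bsub>R\<^esub> a) A"
      unfolding g_def using va[OF v] va[OF w] by (intro R.finsum_cong') (auto simp: cAM R.l_distr)
    then show "g (v \<oplus>\<^bsub>?W\<^esub> w) = g v \<oplus>\<^bsub>?I\<^esub> g w"
      using va[OF v] va[OF w] by (simp add: g_def R.finsum_addf)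
  next
    fix r v assume r: "r \<in> carrier R" and v: "v \<in> carrier ?W"
    have "g (r \<odot>\<^bsub>?W\<^esub> v) = finsum R (\<lambda>a. r \<otimes>\<^bsub>R\<^esub> (v a \<otimes>\<^bsub>R\<^esub> a)) A"
      unfolding g_def using va[OF v] r by (intro R.finsum_cong') (auto simp: cAM R.m_assoc)
    then show "g (r \<odot>\<^bsub>?W\<^esub> v) = r \<odot>\<^bsub>?I\<^esub> g v"
      using va[OF v] r A(2) by (simp add: g_def R.finsum_rdistr)
  qed (use gI in simp)
  note gD = module_homD[OF ghom]
  interpret W: module R ?W by (rule mW)
  have idl: "ideal (g ` carrier ?W) R"
  proof (rule W.ideal_of_closed)
    show "g ` carrier ?W \<subseteq> carrier R" using gI I.a_subset by blast
    have "g \<zero>\<^bsub>?W\<^esub> = \<zero>\<^bsub>R\<^esub>" using module_hom_zero[OF mW mI ghom] by simp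
    then show "\<zero>\<^bsub>R\<^esub> \<in> g ` carrier ?W" by (rule image_eqI[OF sym W.M.zero_closed])
  next
    fix a b assume "a \<in> g ` carrier ?W" "b \<in> g ` carrier ?W"
    then obtain v w where *: "v \<in> carrier ?W" "w \<in> carrier ?W" "a = g v" "b = g w" by blast
    have "g (v \<oplus>\<^bsub>?W\<^esub> w) = a \<oplus>\<^bsub>R\<^esub> b" using gD(2)[OF *(1,2)] *(3,4) by simp
    then show "a \<oplus>\<^bsub>R\<^esub> b \<in> g ` carrier ?W" by (rule image_eqI[OF sym W.M.a_closed[OF *(1,2)]])
  next
    fix a x assume "a \<in> g ` carrier ?W" and x: "x \<in> carrier R"
    then obtain v where *: "v \<in> carrier ?W" "a = g v" by blast
    have "g (x \<odot>\<^bsub>?W\<^esub> v) = x \<otimes>\<^bsub>R\<^esub> a" using gD(3)[OF x *(1)] *(2) by simp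
    then show "x \<otimes>\<^bsub>R\<^esub> a \<in> g ` carrier ?W" by (rule image_eqI[OF sym W.smult_closed[OF x *(1)]])
  qed
  have "A \<subseteq> g ` carrier ?W"
  proof
    fix a assume a: "a \<in> A"
    define d where "d = (\<lambda>b\<in>A. if a = b then \<one>\<^bsub>R\<^esub> else \<zero>\<^bsub>R\<^esub>)"
    have "g d = finsum R (\<lambda>b. if a = b then b else \<zero>\<^bsub>R\<^esub>) A"
      unfolding g_def d_def using A(1) by (intro R.finsum_cong') auto
    also have "\<dots> = a" using a A by (intro R.finsum_singleton) auto
    finally show "a \<in> g ` carrier ?W" by (intro image_eqI[of _ _ d]) (auto simp: d_def cAM)
  qed
  then have "I \<subseteq> g ` carrier ?W" using R.genideal_minimal[OF idl] A(3) by blast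
  then have surj: "g ` carrier ?W = carrier ?I" using gI by auto
  have "projective_module R ?I" using her I unfolding hereditary_ring_def by blast
  then obtain h where h: "h \<in> module_hom R ?I ?W" "\<forall>x \<in> carrier ?I. g (h x) = x"
    unfolding projective_module_def using mW mI ghom surj module_hom_id[of R ?I] by meson
  have fr: "finite_rank R ?I ?I (\<lambda>x. finsum R (\<lambda>a. h x a \<otimes>\<^bsub>R\<^esub> a) B)" if "B \<subseteq> A" for B
    using finite_subset[OF that A(2)] that
  proof (induction B)
    case empty
    show ?case by (rule finite_rank.zero) simp
  next
    case (insert b B)
    have "(\<lambda>x. h x b) \<in> module_hom R ?I (reg_module R)"
      using module_hom_comp[OF h(1), of "\<lambda>v. v b" "reg_module R"] insert.prems
        eval_linear[of "carrier ?W" R AM b] by (simp add: cAM fun_algebra_def)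
    then show ?case
    proof (rule finite_rank.step[OF _ _ insert.IH])
      show "\<forall>x\<in>carrier ?I. finsum R (\<lambda>a. h x a \<otimes>\<^bsub>R\<^esub> a) (insert b B) = h x b \<odot>\<^bsub>?I\<^esub> b \<oplus>\<^bsub>?I\<^esub> finsum R (\<lambda>a. h x a \<otimes>\<^bsub>R\<^esub> a) B"
      proof
        fix x assume "x \<in> carrier ?I"
        then have "h x \<in> carrier ?W" by (rule module_homD(1)[OF h(1)])
        note va = va[OF this]
        have "finsum R (\<lambda>a. h x a \<otimes>\<^bsub>R\<^esub> a) (insert b B) = h x b \<otimes>\<^bsub>R\<^esub> b \<oplus>\<^bsub>R\<^esub> finsum R (\<lambda>a. h x a \<otimes>\<^bsub>R\<^esub> a) B"
          using va insert by (intro R.finsum_insert) auto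
        then show "finsum R (\<lambda>a. h x a \<otimes>\<^bsub>R\<^esub> a) (insert b B) = h x b \<odot>\<^bsub>?I\<^esub> b \<oplus>\<^bsub>?I\<^esub> finsum R (\<lambda>a. h x a \<otimes>\<^bsub>R\<^esub> a) B" by simp
      qed
    qed (use insert.prems AI in auto)
  qed
  have "\<forall>x \<in> carrier ?I. finsum R (\<lambda>a. h x a \<otimes>\<^bsub>R\<^esub> a) A = x" using h(2) by (simp add: g_def)
  then show ?thesis using finite_rank_comp[OF fr[OF order_refl] module_hom_id, of "\<lambda>x. x"] by simp
qed

text \<open>Induction on the separating set.  Evaluation at \<open>y\<close> maps \<open>L\<close> onto an ideal \<open>I\<close>, and the identity of
\<open>I\<close>, being of finite rank, lifts to a map \<open>s\<close> of finite rank on \<open>L\<close> with \<open>(s f) y = f y\<close>.  The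
remainder \<open>f - s f\<close> lies in the submodule of functions that vanish at \<open>y\<close>, which the other points
separate.\<close>

lemma separated_finite_rank:
  assumes R: "cring R" and noeth: "noetherian_ring R" and her: "hereditary_ring R"
    and "finite Y" "Y \<subseteq> carrier G" "submodule L R (fun_algebra R G)"
    and "\<forall>f \<in> L. (\<forall>y \<in> Y. f y = \<zero>\<^bsub>R\<^esub>) \<longrightarrow> f = \<zero>\<^bsub>fun_algebra R G\<^esub>"
  shows "finite_rank R ((fun_algebra R G)\<lparr>carrier := L\<rparr>) ((fun_algebra R G)\<lparr>carrier := L\<rparr>) (\<lambda>f. f)"
  using assms(4-7)
proof (induction Y arbitrary: L)
  case empty
  then have "\<forall>f \<in> L. f = \<zero>\<^bsub>fun_algebra R G\<^esub>" by blast
  then show ?case by (intro finite_rank.zero) (simp del: fun_algebra_simps)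
next
  case (insert y Y)
  interpret R: cring R by fact
  let ?V = "fun_algebra R G"
  interpret V: module R ?V by (rule fun_algebra_module[OF R])
  let ?L = "?V\<lparr>carrier := L\<rparr>"
  note sub = V.submoduleE(1,4,5)[OF insert.prems(2)]
  have y: "y \<in> carrier G" using insert.prems by auto
  have mL: "module R ?L" by (rule submodule_module[OF insert.prems(2) V.module_axioms])
  interpret L: module R ?L by (rule mL)
  have cc: "f x \<in> carrier R" if "f \<in> L" "x \<in> carrier G" for f x using that sub(1) by auto
  define I where "I = (\<lambda>f. f y) ` L"
  have I: "ideal I R"
  proof (rule V.ideal_of_closed)
    show "I \<subseteq> carrier R" using cc y by (auto simp: I_def)
    show "\<zero>\<^bsub>R\<^esub> \<in> I" unfolding I_def using V.submodule_zero[OF insert.prems(2)] y by (intro image_eqI[of _ _ "\<zero>\<^bsub>?V\<^esub>"]) auto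
    show "\<And>a b. \<lbrakk>a \<in> I; b \<in> I\<rbrakk> \<Longrightarrow> a \<oplus>\<^bsub>R\<^esub> b \<in> I"
      unfolding I_def using sub(3) y by (auto intro!: image_eqI[of _ _ "f \<oplus>\<^bsub>?V\<^esub> g" for f g])
    show "\<And>a x. \<lbrakk>a \<in> I; x \<in> carrier R\<rbrakk> \<Longrightarrow> x \<otimes>\<^bsub>R\<^esub> a \<in> I"
      unfolding I_def using sub(2) y by (auto intro!: image_eqI[of _ _ "x \<odot>\<^bsub>?V\<^esub> f" for x f])
  qed
  let ?I = "(reg_module R)\<lparr>carrier := I\<rparr>"
  have evI: "(\<lambda>f. f y) \<in> module_hom R ?L ?I"
    using y by (intro module_homI) (auto simp: I_def)
  \<comment> \<open>To lift a map of finite rank on \<open>I\<close>, compose its functionals with the evaluation and choose preimages of its vectors.\<close>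
  have sect: "\<exists>s. finite_rank R ?L ?L s \<and> (\<forall>f \<in> L. s f y = g (f y))" if "finite_rank R ?I ?I g" for g
    using that
  proof induction
    case (zero g)
    then show ?case
      by (intro exI[of _ "\<lambda>f. \<zero>\<^bsub>?L\<^esub>"] conjI finite_rank.zero) (auto simp: I_def y)
  next
    case (step \<phi> b g g')
    then obtain s where s: "finite_rank R ?L ?L s" "\<forall>f \<in> L. s f y = g (f y)" by blast
    obtain c where c: "c \<in> L" "c y = b" using step(2) by (auto simp: I_def)
    let ?s = "\<lambda>f. \<phi> (f y) \<odot>\<^bsub>?L\<^esub> c \<oplus>\<^bsub>?L\<^esub> s f"
    have "finite_rank R ?L ?L ?s"
      by (rule finite_rank.step[OF module_hom_comp[OF evI step(1)] _ s(1)]) (use c in auto)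
    moreover have "\<forall>f \<in> L. ?s f y = g' (f y)"
      using step(4) s(2) c y by (auto simp: I_def)
    ultimately show ?case by blast
  qed
  obtain s where s: "finite_rank R ?L ?L s" "\<forall>f \<in> L. s f y = f y"
    using sect[OF hereditary_ideal_finite_rank[OF R noeth her I]] by blast
  define L1 where "L1 = {f \<in> L. f y = \<zero>\<^bsub>R\<^esub>}"
  have subL1: "submodule L1 R ?V"
    by (rule V.submodule_of_closed) (use sub V.submodule_zero[OF insert.prems(2)] y in \<open>auto simp: L1_def subset_iff\<close>)
  let ?L1 = "?V\<lparr>carrier := L1\<rparr>"
  have mL1: "module R ?L1" by (rule submodule_module[OF subL1 V.module_axioms])
  have "\<forall>f\<in>L1. (\<forall>y\<in>Y. f y = \<zero>\<^bsub>R\<^esub>) \<longrightarrow> f = \<zero>\<^bsub>?V\<^esub>" using insert.prems(3) by (simp del: fun_algebra_simps add: L1_def)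
  then have fr1: "finite_rank R ?L1 ?L1 (\<lambda>f. f)" using insert.IH[OF _ subL1] insert.prems(1) by auto
  have slin: "s \<in> module_hom R ?L ?L" by (rule finite_rank_linear[OF mL mL s(1)])
  define p where "p f = f \<oplus>\<^bsub>?L\<^esub> ((\<ominus>\<^bsub>R\<^esub> \<one>\<^bsub>R\<^esub>) \<odot>\<^bsub>?L\<^esub> s f)" for f
  have plin: "p \<in> module_hom R ?L ?L"
    unfolding p_def by (rule module_hom_plus[OF mL module_hom_id module_hom_scale[OF mL slin]]) simp
  have sL: "s f \<in> L" if "f \<in> L" for f using module_homD(1)[OF slin, of f] that by simp
  have pL1: "p f \<in> L1" if f: "f \<in> L" for f
  proof -
    have "p f \<in> L" using module_homD(1)[OF plin, of f] f by simp
    moreover have "p f y = \<zero>\<^bsub>R\<^esub>" using s(2) f y cc[OF f y] by (simp add: p_def R.l_minus R.r_neg)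
    ultimately show ?thesis by (simp add: L1_def)
  qed
  have "p \<in> module_hom R ?L ?L1"
    using module_homD[OF plin] pL1 by (intro module_homI) auto
  then have "finite_rank R ?L ?L1 p" by (rule finite_rank_comp[OF fr1]) simp
  then have "finite_rank R ?L ?L p"
    by (rule finite_rank_post[OF mL mL1 mL, of _ "\<lambda>f. f"]) (auto intro!: module_homI simp: L1_def)
  then show ?case
  proof (rule finite_rank_plus[OF mL mL s(1)], intro ballI)
    fix f assume f: "f \<in> carrier ?L"
    have "(\<ominus>\<^bsub>R\<^esub> \<one>\<^bsub>R\<^esub>) \<odot>\<^bsub>?L\<^esub> s f = \<ominus>\<^bsub>?L\<^esub> s f"
      using L.smult_l_minus[of "\<one>\<^bsub>R\<^esub>" "s f"] L.smult_one[of "s f"] module_homD(1)[OF slin f] by simp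
    then have "p f = f \<ominus>\<^bsub>?L\<^esub> s f" by (simp only: p_def a_minus_def)
    then show "f = s f \<oplus>\<^bsub>?L\<^esub> p f"
      using f module_homD(1)[OF slin f] L.M.r_neg L.M.a_lcomm by (simp only: L.M.minus_eq) (metis L.M.add.inv_closed L.M.r_zero L.M.add.m_lcomm)
  qed
qed

lemma fg_functions_finite_rank:
  assumes R: "cring R" and noeth: "noetherian_ring R" and her: "hereditary_ring R"
    and F: "finite F" "F \<subseteq> carrier (fun_algebra R G)"
    and L: "L = module_span R (fun_algebra R G) F"
  shows "finite_rank R ((fun_algebra R G)\<lparr>carrier := L\<rparr>) ((fun_algebra R G)\<lparr>carrier := L\<rparr>) (\<lambda>f. f)"
proof -
  interpret V: module R "fun_algebra R G" by (rule fun_algebra_module[OF R])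
  obtain Y where "finite Y" "Y \<subseteq> carrier G"
    "\<forall>f \<in> L. (\<forall>y \<in> Y. f y = \<zero>\<^bsub>R\<^esub>) \<longrightarrow> f = \<zero>\<^bsub>fun_algebra R G\<^esub>"
    using fg_functions_separated[OF R noeth F] unfolding L by blast
  then show ?thesis
    by (intro separated_finite_rank[OF R noeth her]) (auto simp: L intro: V.span_submodule[OF F(2)])
qed

section \<open>Separation of tensors by their values\<close>

lemma reg_mult_bilinear:
  assumes R: "cring R" and f: "f \<in> module_hom R M (reg_module R)" and g: "g \<in> module_hom R N (reg_module R)"
  shows "bilinear R M N (reg_module R) (\<lambda>m n. f m \<otimes>\<^bsub>R\<^esub> g n)"
proof -
  interpret R: cring R by fact
  show ?thesis
    using module_homD[OF f] module_homD[OF g]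
    by (intro bilinearI module_homI) (simp_all add: R.l_distr R.r_distr R.m_assoc R.m_lcomm)
qed

lemma smult_right_bilinear:
  assumes N: "module R N" and f: "f \<in> module_hom R M (reg_module R)"
  shows "bilinear R M N N (\<lambda>m n. f m \<odot>\<^bsub>N\<^esub> n)"
proof -
  interpret N: module R N by fact
  have "r \<odot>\<^bsub>N\<^esub> (s \<odot>\<^bsub>N\<^esub> y) = s \<odot>\<^bsub>N\<^esub> (r \<odot>\<^bsub>N\<^esub> y)" if "s \<in> carrier R" "r \<in> carrier R" "y \<in> carrier N" for s r y
    using that by (metis N.smult_assoc1 N.R.m_comm)
  then show ?thesis
    using module_homD[OF f]
    by (intro bilinearI module_homI) (simp_all add: N.smult_l_distr N.smult_r_distr N.smult_assoc1)
qed

lemma smult_left_bilinear: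
  assumes M: "module R M" and f: "f \<in> module_hom R N (reg_module R)"
  shows "bilinear R M N M (\<lambda>m n. f n \<odot>\<^bsub>M\<^esub> m)"
  using smult_right_bilinear[OF M f] unfolding bilinear_def by blast

text \<open>If the identity of \<open>L\<close> is \<open>\<Sum> \<phi>\<^sub>i(_) b\<^sub>i\<close>, then \<open>t = \<Sum> b\<^sub>i \<otimes> c\<^sub>i\<close> with the contractions
\<open>c\<^sub>i = (\<phi>\<^sub>i \<otimes> id) t\<close>.  These vanish: for a functional \<open>e\<close> in the separating family,
\<open>e(c\<^sub>i) = \<phi>\<^sub>i((id \<otimes> e) t)\<close>, and the function \<open>(id \<otimes> e) t\<close> is zero at every point by assumption.\<close>

lemma finite_rank_separation:
  fixes R :: "('a, 'r) ring_scheme" and G :: "('g, 'x) monoid_scheme" and N :: "('a, 'n, 'y) module_scheme"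
  assumes R: "cring R" and L: "submodule L R (fun_algebra R G)" and N: "module R N"
    and E: "\<And>e. e \<in> E \<Longrightarrow> e \<in> module_hom R N (reg_module R)"
    and inj: "\<And>n. \<lbrakk>n \<in> carrier N; \<And>e. e \<in> E \<Longrightarrow> e n = \<zero>\<^bsub>R\<^esub>\<rbrakk> \<Longrightarrow> n = \<zero>\<^bsub>N\<^esub>"
    and fr: "finite_rank R ((fun_algebra R G)\<lparr>carrier := L\<rparr>) ((fun_algebra R G)\<lparr>carrier := L\<rparr>) (\<lambda>f. f)"
    and t: "t \<in> carrier (tensor R ((fun_algebra R G)\<lparr>carrier := L\<rparr>) N)"
    and z: "\<And>x e. \<lbrakk>x \<in> carrier G; e \<in> E\<rbrakk> \<Longrightarrow> tensor_lift (reg_module R) (\<lambda>f n. f x \<otimes>\<^bsub>R\<^esub> e n) t = \<zero>\<^bsub>R\<^esub>"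
  shows "t = \<zero>\<^bsub>tensor R ((fun_algebra R G)\<lparr>carrier := L\<rparr>) N\<^esub>"
proof -
  let ?V = "fun_algebra R G" and ?Q = "reg_module R"
  let ?M = "?V\<lparr>carrier := L\<rparr>"
  let ?T = "tensor R ?M N"
  interpret R: cring R by fact
  interpret V: module R ?V by (rule fun_algebra_module[OF R])
  have M: "module R ?M" by (rule submodule_module[OF L V.module_axioms])
  have Q: "module R ?Q" by (rule reg_module_module[OF R])
  have T: "module R ?T" by (rule tensor_module[OF M N])
  interpret N: module R N by fact
  interpret T: module R ?T by (rule T)
  have LV: "L \<subseteq> carrier ?V" by (rule V.submoduleE(1)[OF L])
  have contract: "tensor_lift N (\<lambda>m n. \<phi> m \<odot>\<^bsub>N\<^esub> n) t = \<zero>\<^bsub>N\<^esub>" if \<phi>: "\<phi> \<in> module_hom R ?M ?Q" for \<phi>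
  proof (rule inj)
    note bN = smult_right_bilinear[OF N \<phi>]
    show "tensor_lift N (\<lambda>m n. \<phi> m \<odot>\<^bsub>N\<^esub> n) t \<in> carrier N" by (rule tensor_lift_closed[OF M N N bN t])
    fix e assume e: "e \<in> E"
    note bM = smult_left_bilinear[OF M E[OF e]]
    let ?w = "tensor_lift ?M (\<lambda>m n. e n \<odot>\<^bsub>?M\<^esub> m) t"
    have w: "?w \<in> carrier ?M" by (rule tensor_lift_closed[OF M N M bM t])
    have "?w x = \<zero>\<^bsub>R\<^esub>" if x: "x \<in> carrier G" for x
    proof -
      note ev = eval_linear[OF LV x]
      have "?w x = tensor_lift ?Q (\<lambda>m n. (e n \<odot>\<^bsub>?M\<^esub> m) x) t"
        by (rule hom_tensor_lift(1)[OF M N M Q bM ev t])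
      also have "\<dots> = tensor_lift ?Q (\<lambda>f n. f x \<otimes>\<^bsub>R\<^esub> e n) t"
        using x LV module_homD(1)[OF E[OF e]]
        by (intro tensor_lift_cong[OF M N Q hom_tensor_lift(2)[OF M N M Q bM ev t] reg_mult_bilinear[OF R ev E[OF e]] _ t])
           (auto intro!: R.m_comm)
      finally show ?thesis using z[OF x e] by simp
    qed
    then have "?w = \<zero>\<^bsub>?V\<^esub>"
      using w LV by (intro fun_algebra_eqI[OF _ V.M.zero_closed]) auto
    then have "\<phi> ?w = \<zero>\<^bsub>R\<^esub>" using module_hom_zero[OF M Q \<phi>] by simp
    moreover have "\<phi> ?w = tensor_lift ?Q (\<lambda>m n. \<phi> (e n \<odot>\<^bsub>?M\<^esub> m)) t"
      by (rule hom_tensor_lift(1)[OF M N M Q bM \<phi> t])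
    moreover have "e (tensor_lift N (\<lambda>m n. \<phi> m \<odot>\<^bsub>N\<^esub> n) t) = tensor_lift ?Q (\<lambda>m n. e (\<phi> m \<odot>\<^bsub>N\<^esub> n)) t"
      by (rule hom_tensor_lift(1)[OF M N N Q bN E[OF e] t])
    moreover have "tensor_lift ?Q (\<lambda>m n. e (\<phi> m \<odot>\<^bsub>N\<^esub> n)) t = tensor_lift ?Q (\<lambda>m n. \<phi> (e n \<odot>\<^bsub>?M\<^esub> m)) t"
    proof (rule tensor_lift_cong[OF M N Q hom_tensor_lift(2)[OF M N N Q bN E[OF e] t] hom_tensor_lift(2)[OF M N M Q bM \<phi> t] _ t])
      fix m n assume mn: "m \<in> carrier ?M" "n \<in> carrier N"
      have c: "e n \<in> carrier R" "\<phi> m \<in> carrier R" using module_homD(1)[OF E[OF e] mn(2)] module_homD(1)[OF \<phi> mn(1)] by auto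
      have "e (\<phi> m \<odot>\<^bsub>N\<^esub> n) = \<phi> m \<otimes>\<^bsub>R\<^esub> e n" using module_homD(3)[OF E[OF e] c(2) mn(2)] by simp
      moreover have "\<phi> (e n \<odot>\<^bsub>?M\<^esub> m) = e n \<otimes>\<^bsub>R\<^esub> \<phi> m" using module_homD(3)[OF \<phi> c(1) mn(1)] by simp
      ultimately show "e (\<phi> m \<odot>\<^bsub>N\<^esub> n) = \<phi> (e n \<odot>\<^bsub>?M\<^esub> m)" using R.m_comm[OF c] by simp
    qed
    ultimately show "e (tensor_lift N (\<lambda>m n. \<phi> m \<odot>\<^bsub>N\<^esub> n) t) = \<zero>\<^bsub>R\<^esub>" by simp
  qed
  note pb = pure_tensor_bilinear[OF M N]
  have main: "tensor_lift ?T (\<lambda>m n. pure_tensor R ?M N (g m) n) t = \<zero>\<^bsub>?T\<^esub>" if "finite_rank R ?M ?M g" for g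
    using that
  proof induction
    case (zero g)
    have b: "bilinear R ?M N ?T (\<lambda>m n. \<zero>\<^bsub>?T\<^esub>)"
      by (intro bilinearI module_hom_const_zero[OF T])
    have b': "bilinear R ?M N ?T (\<lambda>m n. pure_tensor R ?M N (g m) n)"
      by (rule bilinear_comp[OF pb finite_rank_linear[OF M M finite_rank.zero[OF zero]] module_hom_id])
    have "tensor_lift ?T (\<lambda>m n. pure_tensor R ?M N (g m) n) t = tensor_lift ?T (\<lambda>m n. \<zero>\<^bsub>?T\<^esub>) t"
    proof (rule tensor_lift_cong[OF M N T b' b _ t])
      fix m n assume "m \<in> carrier ?M" "n \<in> carrier N"
      then show "pure_tensor R ?M N (g m) n = \<zero>\<^bsub>?T\<^esub>"
        using module_hom_zero[OF M T bilinearD(2)[OF pb, of n]] zero by simp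
    qed
    also have "\<dots> = \<zero>\<^bsub>?T\<^esub>"
      by (rule tensor_hom_ext[OF M N tensor_lift_linear[OF M N T b] module_hom_const_zero[OF T] _ t])
         (rule tensor_lift_bilinear_pure[OF M N T b])
    finally show ?case .
  next
    case (step \<phi> b g g')
    have g: "g \<in> module_hom R ?M ?M" by (rule finite_rank_linear[OF M M step(3)])
    have g': "g' \<in> module_hom R ?M ?M" by (rule finite_rank_linear[OF M M finite_rank.step[OF step(1-4)]])
    note bN = smult_right_bilinear[OF N step(1)]
    note h1 = hom_tensor_lift[OF M N N T bN bilinearD(1)[OF pb step(2)] t]
    note b2 = bilinear_comp[OF pb g module_hom_id]
    have "tensor_lift ?T (\<lambda>m n. pure_tensor R ?M N (g' m) n) t =
        tensor_lift ?T (\<lambda>m n. pure_tensor R ?M N b (\<phi> m \<odot>\<^bsub>N\<^esub> n)) t \<oplus>\<^bsub>?T\<^esub> tensor_lift ?T (\<lambda>m n. pure_tensor R ?M N (g m) n) t"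
    proof (rule tensor_hom_ext[OF M N tensor_lift_linear[OF M N T bilinear_comp[OF pb g' module_hom_id]]
          module_hom_plus[OF T tensor_lift_linear[OF M N T h1(2)] tensor_lift_linear[OF M N T b2]] _ t])
      fix m n assume mn: "m \<in> carrier ?M" "n \<in> carrier N"
      have \<phi>m: "\<phi> m \<in> carrier R" using module_homD(1)[OF step(1) mn(1)] by simp
      have gm: "g m \<in> carrier ?M" by (rule module_homD(1)[OF g mn(1)])
      have bm: "\<phi> m \<odot>\<^bsub>?M\<^esub> b \<in> carrier ?M" by (rule module.smult_closed[OF M \<phi>m step(2)])
      have "pure_tensor R ?M N (g' m) n = pure_tensor R ?M N (\<phi> m \<odot>\<^bsub>?M\<^esub> b \<oplus>\<^bsub>?M\<^esub> g m) n" using step(4) mn(1) by metis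
      also have "\<dots> = pure_tensor R ?M N (\<phi> m \<odot>\<^bsub>?M\<^esub> b) n \<oplus>\<^bsub>?T\<^esub> pure_tensor R ?M N (g m) n"
        by (rule bilinearD(5)[OF pb bm gm mn(2)])
      also have "pure_tensor R ?M N (\<phi> m \<odot>\<^bsub>?M\<^esub> b) n = pure_tensor R ?M N b (\<phi> m \<odot>\<^bsub>N\<^esub> n)"
        by (rule pure_tensor_rels(3)[OF M N step(2) mn(2) \<phi>m])
      finally show "tensor_lift ?T (\<lambda>m n. pure_tensor R ?M N (g' m) n) (pure_tensor R ?M N m n) =
        tensor_lift ?T (\<lambda>m n. pure_tensor R ?M N b (\<phi> m \<odot>\<^bsub>N\<^esub> n)) (pure_tensor R ?M N m n) \<oplus>\<^bsub>?T\<^esub>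
        tensor_lift ?T (\<lambda>m n. pure_tensor R ?M N (g m) n) (pure_tensor R ?M N m n)"
        by (simp only: tensor_lift_bilinear_pure[OF M N T h1(2) mn] tensor_lift_bilinear_pure[OF M N T b2 mn]
            tensor_lift_bilinear_pure[OF M N T bilinear_comp[OF pb g' module_hom_id] mn])
    qed
    also have "tensor_lift ?T (\<lambda>m n. pure_tensor R ?M N b (\<phi> m \<odot>\<^bsub>N\<^esub> n)) t = pure_tensor R ?M N b \<zero>\<^bsub>N\<^esub>"
      using h1(1) contract[OF step(1)] by simp
    also have "\<dots> = \<zero>\<^bsub>?T\<^esub>" by (rule module_hom_zero[OF N T bilinearD(1)[OF pb step(2)]])
    finally show ?case using step.IH by simp
  qed
  have "tensor_lift ?T (\<lambda>m n. pure_tensor R ?M N m n) t = t"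
    by (rule tensor_hom_ext[OF M N tensor_lift_linear[OF M N T pb] module_hom_id _ t])
       (rule tensor_lift_bilinear_pure[OF M N T pb])
  then show ?thesis using main[OF fr] by simp
qed

text \<open>This moves a tensor over an arbitrary module into one over a finitely generated submodule, where a
dual basis is available.  The preimage \<open>t'\<close> depends on the submodule, since the map that the
inclusion induces on tensors can fail to be injective.\<close>

lemma tensor_finite_support:
  fixes M :: "('a, 'm, 'x) module_scheme"
  assumes M: "module R M" and N: "module R N" and t: "t \<in> carrier (tensor R M N)"
  shows "\<exists>S. finite S \<and> S \<subseteq> carrier M \<and> (\<forall>L. submodule L R M \<and> S \<subseteq> L \<longrightarrow>
    (\<exists>t' \<in> carrier (tensor R (M\<lparr>carrier := L\<rparr>) N). tensor_lift (tensor R M N) (pure_tensor R M N) t' = t))"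
    (is "\<exists>S. ?P t S")
  using t
proof (induction rule: tensor_induct[OF M N, consumes 1, case_names pure add])
  interpret M: module R M by fact
  note T = tensor_module[OF M N]
  have mL: "module R (M\<lparr>carrier := L\<rparr>)" if "submodule L R M" for L by (rule submodule_module[OF that M])
  have b: "bilinear R (M\<lparr>carrier := L\<rparr>) N (tensor R M N) (pure_tensor R M N)" if "submodule L R M" for L
  proof (rule bilinear_comp[OF pure_tensor_bilinear[OF M N] _ module_hom_id, where f = "\<lambda>x. x", simplified])
    show "(\<lambda>x. x) \<in> module_hom R (M\<lparr>carrier := L\<rparr>) M"
      using M.submoduleE(1)[OF that] by (intro module_homI) auto
  qed
  {
    case (pure m n)
    show ?case
    proof (intro exI[of _ "{m}"] conjI allI impI)
      fix L assume L: "submodule L R M \<and> {m} \<subseteq> L"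
      then show "\<exists>t' \<in> carrier (tensor R (M\<lparr>carrier := L\<rparr>) N).
          tensor_lift (tensor R M N) (pure_tensor R M N) t' = pure_tensor R M N m n"
        using pure by (intro bexI[of _ "pure_tensor R (M\<lparr>carrier := L\<rparr>) N m n"])
          (auto simp: tensor_lift_bilinear_pure[OF mL N T b] intro!: pure_tensor_closed[OF mL N])
    qed (use pure in auto)
  next
    case (add s t)
    then obtain A B where A: "?P s A" and B: "?P t B" by blast
    show ?case
    proof (intro exI[of _ "A \<union> B"] conjI allI impI)
      fix L assume L: "submodule L R M \<and> A \<union> B \<subseteq> L"
      then obtain s' t' where "s' \<in> carrier (tensor R (M\<lparr>carrier := L\<rparr>) N)" "t' \<in> carrier (tensor R (M\<lparr>carrier := L\<rparr>) N)"
        "tensor_lift (tensor R M N) (pure_tensor R M N) s' = s" "tensor_lift (tensor R M N) (pure_tensor R M N) t' = t"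
        using A B by (meson Un_subset_iff)
      then show "\<exists>t' \<in> carrier (tensor R (M\<lparr>carrier := L\<rparr>) N).
          tensor_lift (tensor R M N) (pure_tensor R M N) t' = s \<oplus>\<^bsub>tensor R M N\<^esub> t"
        using L module_homD(2)[OF tensor_lift_linear[OF mL N T b]]
          abelian_groupE(1)[OF tensor_abelian_group[OF mL N]]
        by (intro bexI[of _ "s' \<oplus>\<^bsub>tensor R (M\<lparr>carrier := L\<rparr>) N\<^esub> t'"]) auto
    qed (use A B in auto)
  }
qed

text \<open>The difference \<open>d\<close> of the two tensors comes from a tensor \<open>t'\<close> over the span of finitely many
functions.  The values of \<open>t'\<close> are those of \<open>d\<close>, hence zero, and the dual basis of that span forces
\<open>t' = 0\<close>.\<close>

lemma tensor_functions_eqI: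
  fixes R :: "('a, 'r) ring_scheme" and G :: "('g, 'x) monoid_scheme" and N :: "('a, 'n, 'y) module_scheme"
  assumes R: "cring R" and noeth: "noetherian_ring R" and her: "hereditary_ring R"
    and L: "submodule L R (fun_algebra R G)" and N: "module R N"
    and E: "\<And>e. e \<in> E \<Longrightarrow> e \<in> module_hom R N (reg_module R)"
    and inj: "\<And>n. \<lbrakk>n \<in> carrier N; \<And>e. e \<in> E \<Longrightarrow> e n = \<zero>\<^bsub>R\<^esub>\<rbrakk> \<Longrightarrow> n = \<zero>\<^bsub>N\<^esub>"
    and M_def: "M = (fun_algebra R G)\<lparr>carrier := L\<rparr>"
    and s: "s \<in> carrier (tensor R M N)" and t: "t \<in> carrier (tensor R M N)"
    and eq: "\<And>x e. \<lbrakk>x \<in> carrier G; e \<in> E\<rbrakk> \<Longrightarrow>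
      tensor_lift (reg_module R) (\<lambda>f n. f x \<otimes>\<^bsub>R\<^esub> e n) s = tensor_lift (reg_module R) (\<lambda>f n. f x \<otimes>\<^bsub>R\<^esub> e n) t"
  shows "s = t"
proof -
  let ?V = "fun_algebra R G" and ?Q = "reg_module R" and ?T = "tensor R M N"
  interpret R: cring R by fact
  interpret V: module R ?V by (rule fun_algebra_module[OF R])
  have M: "module R M" unfolding M_def by (rule submodule_module[OF L V.module_axioms])
  have Q: "module R ?Q" by (rule reg_module_module[OF R])
  have T: "module R ?T" by (rule tensor_module[OF M N])
  interpret M: module R M by fact
  interpret T: module R ?T by (rule T)
  have LV: "L \<subseteq> carrier ?V" by (rule V.submoduleE(1)[OF L])
  have cM: "carrier M = L" by (simp add: M_def)
  let ?d = "s \<oplus>\<^bsub>?T\<^esub> (\<ominus>\<^bsub>R\<^esub> \<one>\<^bsub>R\<^esub>) \<odot>\<^bsub>?T\<^esub> t"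
  have bil: "bilinear R M N ?Q (\<lambda>f n. f x \<otimes>\<^bsub>R\<^esub> e n)" if "x \<in> carrier G" "e \<in> E" for x e
    unfolding M_def by (rule reg_mult_bilinear[OF R eval_linear[OF LV that(1)] E[OF that(2)]])
  have d: "?d \<in> carrier ?T" using s t by simp
  have dz: "tensor_lift ?Q (\<lambda>f n. f x \<otimes>\<^bsub>R\<^esub> e n) ?d = \<zero>\<^bsub>R\<^esub>" if xe: "x \<in> carrier G" "e \<in> E" for x e
    using module_homD[OF tensor_lift_linear[OF M N Q bil[OF xe]]] s t eq[OF xe]
    by (simp add: R.l_minus R.r_neg)
  from tensor_finite_support[OF M N d] obtain S where S: "finite S" "S \<subseteq> carrier M"
    and lift: "\<forall>L. submodule L R M \<and> S \<subseteq> L \<longrightarrow>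
      (\<exists>t' \<in> carrier (tensor R (M\<lparr>carrier := L\<rparr>) N). tensor_lift ?T (pure_tensor R M N) t' = ?d)"
    by (elim exE conjE)
  have SV: "S \<subseteq> carrier ?V" using S(2) LV cM by auto
  define L0 where "L0 = module_span R ?V S"
  have L0: "submodule L0 R ?V" unfolding L0_def by (rule V.span_submodule[OF SV])
  have L0L: "L0 \<subseteq> L" unfolding L0_def by (rule V.span_minimal[OF L]) (use S(2) cM in simp)
  have L0M: "submodule L0 R M"
  proof (rule M.submodule_of_closed)
    show "L0 \<subseteq> carrier M" using L0L cM by simp
  qed (use V.submoduleE(4,5)[OF L0] V.submodule_zero[OF L0] in \<open>simp_all add: M_def\<close>)
  let ?M0 = "?V\<lparr>carrier := L0\<rparr>"
  have M0: "M\<lparr>carrier := L0\<rparr> = ?M0" by (simp add: M_def)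
  have mM0: "module R ?M0" by (rule submodule_module[OF L0 V.module_axioms])
  obtain t' where t': "t' \<in> carrier (tensor R ?M0 N)" "tensor_lift ?T (pure_tensor R M N) t' = ?d"
    using lift[rule_format, OF conjI[OF L0M V.span_superset[of S, folded L0_def]]] unfolding M0 by (elim bexE)
  have incl: "(\<lambda>x. x) \<in> module_hom R ?M0 M"
    using L0L by (intro module_homI) (auto simp: M_def)
  have b0: "bilinear R ?M0 N ?T (pure_tensor R M N)"
    using bilinear_comp[OF pure_tensor_bilinear[OF M N] incl module_hom_id] by simp
  have "t' = \<zero>\<^bsub>tensor R ?M0 N\<^esub>"
  proof (rule finite_rank_separation[OF R L0 N E inj _ t'(1)])
    show "finite_rank R ?M0 ?M0 (\<lambda>f. f)"
      by (rule fg_functions_finite_rank[OF R noeth her S(1) SV L0_def])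
    fix x e assume xe: "x \<in> carrier G" "e \<in> E"
    note h = hom_tensor_lift[OF mM0 N T Q b0 tensor_lift_linear[OF M N Q bil[OF xe]] t'(1)]
    have b1: "bilinear R ?M0 N ?Q (\<lambda>f n. f x \<otimes>\<^bsub>R\<^esub> e n)"
      using bilinear_comp[OF bil[OF xe] incl module_hom_id] by simp
    have "tensor_lift ?Q (\<lambda>f n. f x \<otimes>\<^bsub>R\<^esub> e n) t' =
      tensor_lift ?Q (\<lambda>f n. tensor_lift ?Q (\<lambda>f n. f x \<otimes>\<^bsub>R\<^esub> e n) (pure_tensor R M N f n)) t'"
      by (rule tensor_lift_cong[OF mM0 N Q b1 h(2) _ t'(1)])
         (use L0L in \<open>auto simp: tensor_lift_bilinear_pure[OF M N Q bil[OF xe]] cM\<close>)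
    also have "\<dots> = \<zero>\<^bsub>R\<^esub>" using h(1) t'(2) dz[OF xe] by simp
    finally show "tensor_lift ?Q (\<lambda>f n. f x \<otimes>\<^bsub>R\<^esub> e n) t' = \<zero>\<^bsub>R\<^esub>" .
  qed
  then have "?d = \<zero>\<^bsub>?T\<^esub>"
    using module_hom_zero[OF tensor_module[OF mM0 N] T tensor_lift_linear[OF mM0 N T b0]] t'(2) by simp
  then have "s \<ominus>\<^bsub>?T\<^esub> t = \<zero>\<^bsub>?T\<^esub>"
    using T.smult_l_minus[of "\<one>\<^bsub>R\<^esub>" t] t by (simp add: a_minus_def)
  moreover have "(s \<ominus>\<^bsub>?T\<^esub> t) \<oplus>\<^bsub>?T\<^esub> t = s" using s t by (simp add: a_minus_def T.M.a_assoc T.M.l_neg)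
  ultimately show ?thesis using t by simp
qed

section \<open>Representative functions\<close>

definition translate :: "('g, 'x) monoid_scheme \<Rightarrow> 'g \<Rightarrow> 'g \<Rightarrow> ('g \<Rightarrow> 'a) \<Rightarrow> ('g \<Rightarrow> 'a)"
  where "translate G g g' f = (\<lambda>x\<in>carrier G. f (g \<otimes>\<^bsub>G\<^esub> x \<otimes>\<^bsub>G\<^esub> g'))"

lemma translates_eq: "translates G f = {translate G g g' f | g g'. g \<in> carrier G \<and> g' \<in> carrier G}"
  by (simp add: translates_def translate_def)

lemma translate_apply: "x \<in> carrier G \<Longrightarrow> translate G g g' f x = f (g \<otimes>\<^bsub>G\<^esub> x \<otimes>\<^bsub>G\<^esub> g')"
  by (simp add: translate_def)

lemma subalgebra_algebra:
  assumes A: "algebra R A" and L: "submodule (carrier B) R A"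
    and "monoid.mult B = monoid.mult A" "add B = add A" "one B = one A" "ring.zero B = ring.zero A" "smult B = smult A"
    and "\<one>\<^bsub>A\<^esub> \<in> carrier B" "\<And>x y. \<lbrakk>x \<in> carrier B; y \<in> carrier B\<rbrakk> \<Longrightarrow> x \<otimes>\<^bsub>A\<^esub> y \<in> carrier B"
  shows "algebra R B"
proof -
  interpret A: algebra R A by fact
  note sub = A.submoduleE[OF L] A.submodule_zero[OF L]
  have c: "\<And>x. x \<in> carrier B \<Longrightarrow> x \<in> carrier A" using sub(1) by blast
  have ag: "abelian_group B"
  proof (rule abelian_groupI)
    fix x assume "x \<in> carrier B"
    then show "\<exists>y\<in>carrier B. y \<oplus>\<^bsub>B\<^esub> x = \<zero>\<^bsub>B\<^esub>"
      using sub(3) by (intro bexI[of _ "\<ominus>\<^bsub>A\<^esub> x"]) (simp_all add: assms c A.M.l_neg)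
  qed (simp_all add: assms sub c A.M.a_ac)
  have "cring B"
  proof (rule cringI[OF ag])
    show "Group.comm_monoid B"
      by (rule comm_monoidI) (simp_all add: assms c A.m_ac)
  qed (simp_all add: assms c A.l_distr)
  then show ?thesis
    by (rule algebraI[OF A.R.is_cring])
       (simp_all add: assms c sub A.smult_l_distr A.smult_r_distr A.smult_assoc1 A.smult_assoc2)
qed

context
  fixes R :: "('a, 'r) ring_scheme" and G :: "('g, 'x) monoid_scheme"
  assumes R: "cring R" and noeth: "noetherian_ring R" and G: "monoid G"
begin

interpretation R: cring R by (fact R)
interpretation G: monoid G by (fact G)
interpretation V: algebra R "fun_algebra R G" by (rule fun_algebra_algebra[OF R])

abbreviation (input) "VG \<equiv> fun_algebra R G"

lemma translate_closed:
  assumes "f \<in> carrier VG" "g \<in> carrier G" "g' \<in> carrier G"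
  shows "translate G g g' f \<in> carrier VG"
  using assms by (auto simp: translate_def)

lemma translates_closed: "f \<in> carrier VG \<Longrightarrow> translates G f \<subseteq> carrier VG"
  unfolding translates_eq using translate_closed by blast

lemma translate_linear:
  assumes "g \<in> carrier G" "g' \<in> carrier G"
  shows "translate G g g' \<in> module_hom R VG VG"
proof (rule module_homI)
  show "\<And>f. f \<in> carrier VG \<Longrightarrow> translate G g g' f \<in> carrier VG" by (rule translate_closed[OF _ assms])
qed (auto simp: translate_def assms intro!: restrict_ext)

lemma translate_translate:
  assumes "g \<in> carrier G" "g' \<in> carrier G" "h \<in> carrier G" "h' \<in> carrier G"
  shows "translate G h h' (translate G g g' f) = translate G (g \<otimes>\<^bsub>G\<^esub> h) (h' \<otimes>\<^bsub>G\<^esub> g') f"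
  using assms by (auto simp: translate_def G.m_assoc intro!: restrict_ext)

lemma translate_one: "f \<in> carrier VG \<Longrightarrow> translate G \<one>\<^bsub>G\<^esub> \<one>\<^bsub>G\<^esub> f = f"
  by (rule fun_algebra_eqI[OF translate_closed]) (auto simp: translate_apply)

text \<open>Over a Noetherian ring it suffices to enclose the translates in some finitely generated module;
the module that they span is then finitely generated as well.\<close>

lemma rep_functionsI:
  assumes "f \<in> carrier VG" "finite F" "F \<subseteq> carrier VG"
    and "\<And>g g'. \<lbrakk>g \<in> carrier G; g' \<in> carrier G\<rbrakk> \<Longrightarrow> translate G g g' f \<in> module_span R VG F"
  shows "f \<in> rep_functions R G"
proof -
  have "module_span R VG (translates G f) \<subseteq> module_span R VG F"
    by (rule V.span_minimal[OF V.span_submodule[OF assms(3)]]) (use assms(4) in \<open>auto simp: translates_eq\<close>)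
  then have "fg_submodule R VG (module_span R VG (translates G f))"
    by (rule V.noetherian_span[OF noeth assms(2,3) V.span_submodule[OF translates_closed[OF assms(1)]]])
  then show ?thesis using assms(1) by (simp add: rep_functions_def)
qed

lemma rep_functionsD:
  assumes "f \<in> rep_functions R G"
  shows "\<exists>F. f \<in> carrier VG \<and> finite F \<and> F \<subseteq> carrier VG \<and>
    module_span R VG F = module_span R VG (translates G f) \<and>
    (\<forall>g \<in> carrier G. \<forall>g' \<in> carrier G. translate G g g' f \<in> module_span R VG F)"
proof -
  have f: "f \<in> carrier VG" and fg: "fg_submodule R VG (module_span R VG (translates G f))"
    using assms by (auto simp: rep_functions_def)
  then obtain F where F: "finite F" "F \<subseteq> module_span R VG (translates G f)"
    "module_span R VG F = module_span R VG (translates G f)"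
    unfolding fg_submodule_def by blast
  have tr: "translate G g g' f \<in> module_span R VG F" if "g \<in> carrier G" "g' \<in> carrier G" for g g'
    unfolding F(3) using V.span_superset[of "translates G f"] that by (auto simp: translates_eq)
  have "F \<subseteq> carrier VG" using F(2) V.span_closed[OF translates_closed[OF f]] by (rule subset_trans)
  then show ?thesis using f F(1,3) tr by blast
qed

lemma rep_functions_closed: "f \<in> rep_functions R G \<Longrightarrow> f \<in> carrier VG"
  by (simp add: rep_functions_def)

lemma rep_functions_submodule: "submodule (rep_functions R G) R VG"
proof (rule V.submodule_of_closed)
  show "rep_functions R G \<subseteq> carrier VG" using rep_functions_closed by blast
  show "\<zero>\<^bsub>VG\<^esub> \<in> rep_functions R G"
  proof (rule rep_functionsI[of _ "{}"])
    fix g g' assume "g \<in> carrier G" "g' \<in> carrier G"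
    from module_hom_zero[OF V.module_axioms V.module_axioms translate_linear[OF this]]
    show "translate G g g' \<zero>\<^bsub>VG\<^esub> \<in> module_span R VG {}" using V.span_zero[of "{}"] by simp
  qed auto
next
  fix a b assume a: "a \<in> rep_functions R G" and b: "b \<in> rep_functions R G"
  obtain A where A: "a \<in> carrier VG" "finite A" "A \<subseteq> carrier VG"
    "module_span R VG A = module_span R VG (translates G a)"
    "\<forall>g \<in> carrier G. \<forall>g' \<in> carrier G. translate G g g' a \<in> module_span R VG A"
    using rep_functionsD[OF a] by (elim exE conjE)
  obtain B where B: "b \<in> carrier VG" "finite B" "B \<subseteq> carrier VG"
    "module_span R VG B = module_span R VG (translates G b)"
    "\<forall>g \<in> carrier G. \<forall>g' \<in> carrier G. translate G g g' b \<in> module_span R VG B"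
    using rep_functionsD[OF b] by (elim exE conjE)
  show "a \<oplus>\<^bsub>VG\<^esub> b \<in> rep_functions R G"
  proof (rule rep_functionsI[of _ "A \<union> B"])
    fix g g' assume g: "g \<in> carrier G" "g' \<in> carrier G"
    have "translate G g g' a \<in> module_span R VG (A \<union> B)" "translate G g g' b \<in> module_span R VG (A \<union> B)"
      using A(5)[rule_format, OF g] B(5)[rule_format, OF g] V.span_mono[of A "A \<union> B"] V.span_mono[of B "A \<union> B"] by auto
    then show "translate G g g' (a \<oplus>\<^bsub>VG\<^esub> b) \<in> module_span R VG (A \<union> B)"
      unfolding module_homD(2)[OF translate_linear[OF g] A(1) B(1)]
      using A(3) B(3) by (intro V.span_add) auto
  qed (use A B V.M.a_closed[of a b] in auto)
next
  fix r a assume r: "r \<in> carrier R" and a: "a \<in> rep_functions R G"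
  obtain A where A: "a \<in> carrier VG" "finite A" "A \<subseteq> carrier VG"
    "module_span R VG A = module_span R VG (translates G a)"
    "\<forall>g \<in> carrier G. \<forall>g' \<in> carrier G. translate G g g' a \<in> module_span R VG A"
    using rep_functionsD[OF a] by (elim exE conjE)
  show "r \<odot>\<^bsub>VG\<^esub> a \<in> rep_functions R G"
  proof (rule rep_functionsI[OF _ A(2,3)])
    fix g g' assume g: "g \<in> carrier G" "g' \<in> carrier G"
    show "translate G g g' (r \<odot>\<^bsub>VG\<^esub> a) \<in> module_span R VG A"
      unfolding module_homD(3)[OF translate_linear[OF g] r A(1)]
      by (rule V.span_smult[OF A(3) r A(5)[rule_format, OF g]])
  qed (use A(1) r V.smult_closed[of r a] in auto)
qed

lemma span_mult:
  assumes A: "A \<subseteq> carrier VG" and B: "B \<subseteq> carrier VG"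
    and u: "u \<in> module_span R VG A" and v: "v \<in> module_span R VG B"
  shows "u \<otimes>\<^bsub>VG\<^esub> v \<in> module_span R VG {a \<otimes>\<^bsub>VG\<^esub> b | a b. a \<in> A \<and> b \<in> B}"
proof -
  let ?AB = "{a \<otimes>\<^bsub>VG\<^esub> b | a b. a \<in> A \<and> b \<in> B}"
  have AB: "?AB \<subseteq> carrier VG" using A B V.m_closed by blast
  have cA: "\<And>x. x \<in> module_span R VG A \<Longrightarrow> x \<in> carrier VG" using V.span_closed[OF A] by blast
  have cB: "\<And>x. x \<in> module_span R VG B \<Longrightarrow> x \<in> carrier VG" using V.span_closed[OF B] by blast
  note bil = bilinearD[OF algebra_mult_bilinear[OF V.algebra_axioms]]
  have z: "u \<otimes>\<^bsub>VG\<^esub> \<zero>\<^bsub>VG\<^esub> = \<zero>\<^bsub>VG\<^esub>" "\<zero>\<^bsub>VG\<^esub> \<otimes>\<^bsub>VG\<^esub> u = \<zero>\<^bsub>VG\<^esub>" if "u \<in> carrier VG" for u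
    by (simp_all only: V.r_null V.l_null that)
  have 1: "a \<otimes>\<^bsub>VG\<^esub> v \<in> module_span R VG ?AB" if a: "a \<in> A" for a
    using v B
  proof (induction rule: V.span_induct)
    case (base b)
    then show ?case using a V.span_superset[of ?AB] by blast
  next
    case zero
    show ?case unfolding z(1)[OF subsetD[OF A a]] by (rule V.span_zero[OF AB])
  next
    case (add v w)
    show ?case
      unfolding bil(4)[OF subsetD[OF A a] cB[OF add(1)] cB[OF add(2)]] by (rule V.span_add[OF AB add(3,4)])
  next
    case (smult r v)
    show ?case
      unfolding bil(7)[OF smult(1) subsetD[OF A a] cB[OF smult(2)]] by (rule V.span_smult[OF AB smult(1,3)])
  qed
  show ?thesis
    using u A
  proof (induction rule: V.span_induct)
    case (base a)
    then show ?case using 1 by blast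
  next
    case zero
    show ?case unfolding z(2)[OF cB[OF v]] by (rule V.span_zero[OF AB])
  next
    case (add u w)
    show ?case
      unfolding bil(5)[OF cA[OF add(1)] cA[OF add(2)] cB[OF v]] by (rule V.span_add[OF AB add(3,4)])
  next
    case (smult r u)
    show ?case
      unfolding bil(6)[OF smult(1) cA[OF smult(2)] cB[OF v]] by (rule V.span_smult[OF AB smult(1,3)])
  qed
qed

lemma rep_functions_mult:
  assumes "a \<in> rep_functions R G" "b \<in> rep_functions R G"
  shows "a \<otimes>\<^bsub>VG\<^esub> b \<in> rep_functions R G"
proof -
  obtain A where A: "a \<in> carrier VG" "finite A" "A \<subseteq> carrier VG"
    "module_span R VG A = module_span R VG (translates G a)"
    "\<forall>g \<in> carrier G. \<forall>g' \<in> carrier G. translate G g g' a \<in> module_span R VG A"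
    using rep_functionsD[OF assms(1)] by (elim exE conjE)
  obtain B where B: "b \<in> carrier VG" "finite B" "B \<subseteq> carrier VG"
    "module_span R VG B = module_span R VG (translates G b)"
    "\<forall>g \<in> carrier G. \<forall>g' \<in> carrier G. translate G g g' b \<in> module_span R VG B"
    using rep_functionsD[OF assms(2)] by (elim exE conjE)
  let ?AB = "{a \<otimes>\<^bsub>VG\<^esub> b | a b. a \<in> A \<and> b \<in> B}"
  show ?thesis
  proof (rule rep_functionsI[of _ ?AB])
    show "a \<otimes>\<^bsub>VG\<^esub> b \<in> carrier VG" by (rule V.m_closed[OF A(1) B(1)])
    show "?AB \<subseteq> carrier VG" using A(3) B(3) V.m_closed by blast
    show "finite ?AB" using finite_image_set2[of "\<lambda>x. x \<in> A" "\<lambda>x. x \<in> B"] A(2) B(2) by simp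
    fix g g' assume g: "g \<in> carrier G" "g' \<in> carrier G"
    have "translate G g g' (a \<otimes>\<^bsub>VG\<^esub> b) = translate G g g' a \<otimes>\<^bsub>VG\<^esub> translate G g g' b"
      using g by (auto simp: translate_def intro!: restrict_ext)
    then show "translate G g g' (a \<otimes>\<^bsub>VG\<^esub> b) \<in> module_span R VG ?AB"
      using span_mult[OF A(3) B(3) A(5)[rule_format, OF g] B(5)[rule_format, OF g]] by simp
  qed
qed

lemma rep_functions_one: "\<one>\<^bsub>VG\<^esub> \<in> rep_functions R G"
proof (rule rep_functionsI[of _ "{\<one>\<^bsub>VG\<^esub>}"])
  fix g g' assume g: "g \<in> carrier G" "g' \<in> carrier G"
  have "translate G g g' \<one>\<^bsub>VG\<^esub> = \<one>\<^bsub>VG\<^esub>" using g by (auto simp: translate_def intro!: restrict_ext)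
  then show "translate G g g' \<one>\<^bsub>VG\<^esub> \<in> module_span R VG {\<one>\<^bsub>VG\<^esub>}"
    using V.span_superset[of "{\<one>\<^bsub>VG\<^esub>}"] by auto
qed (use V.one_closed in auto)

lemma span_translates_stable:
  assumes f: "f \<in> carrier VG" and g: "g \<in> carrier G" "g' \<in> carrier G"
    and m: "m \<in> module_span R VG (translates G f)"
  shows "translate G g g' m \<in> module_span R VG (translates G f)"
proof -
  have "translate G g g' ` translates G f \<subseteq> translates G f"
  proof
    fix s assume "s \<in> translate G g g' ` translates G f"
    then obtain h h' where h: "h \<in> carrier G" "h' \<in> carrier G" "s = translate G g g' (translate G h h' f)"
      by (auto simp: translates_eq)
    then have "s = translate G (h \<otimes>\<^bsub>G\<^esub> g) (g' \<otimes>\<^bsub>G\<^esub> h') f" using g by (simp add: translate_translate)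
    then show "s \<in> translates G f"
      unfolding translates_eq using G.m_closed[OF h(1) g(1)] G.m_closed[OF g(2) h(2)] by blast
  qed
  then show ?thesis
    using module_hom_span[OF V.module_axioms V.module_axioms translate_linear[OF g] translates_closed[OF f] m]
      V.span_mono by blast
qed

lemma span_translates_rep:
  assumes f: "f \<in> rep_functions R G" and m: "m \<in> module_span R VG (translates G f)"
  shows "m \<in> rep_functions R G"
proof -
  obtain F where F: "f \<in> carrier VG" "finite F" "F \<subseteq> carrier VG"
    "module_span R VG F = module_span R VG (translates G f)"
    using rep_functionsD[OF f] by (elim exE conjE)
  show ?thesis
  proof (rule rep_functionsI[OF _ F(2,3)])
    show "m \<in> carrier VG" using m V.span_closed[OF translates_closed[OF F(1)]] by blast
    show "\<And>g g'. \<lbrakk>g \<in> carrier G; g' \<in> carrier G\<rbrakk> \<Longrightarrow> translate G g g' m \<in> module_span R VG F"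
      unfolding F(4) by (rule span_translates_stable[OF F(1) _ _ m])
  qed
qed

lemma span_translates_self: "f \<in> carrier VG \<Longrightarrow> f \<in> module_span R VG (translates G f)"
  using V.span_superset[of "translates G f"] translate_one[of f] unfolding translates_eq
  by (metis (mono_tags, lifting) G.one_closed mem_Collect_eq subsetD)

end

section \<open>The bialgebra of representative functions\<close>

lemma tensor_field_cong:
  assumes "carrier M = carrier M'" "add M = add M'" "smult M = smult M'" "monoid.mult M = monoid.mult M'" "one M = one M'"
    and "carrier N = carrier N'" "add N = add N'" "smult N = smult N'" "monoid.mult N = monoid.mult N'" "one N = one N'"
  shows "tensor R M N = tensor R M' N'"
  unfolding tensor_def tensor_group_def tensor_class_def pure_tensor_def tensor_rels_def by (simp add: assms)

text \<open>The common part of the bialgebra and the Hopf algebra of representative functions; \<open>z\<close> stands for the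
remaining record fields.\<close>

definition rep_coalg ::
    "('a, 'r) ring_scheme \<Rightarrow> ('g, 'x) monoid_scheme \<Rightarrow> 'z \<Rightarrow> ('a, 'g \<Rightarrow> 'a, 'z) bialg_scheme"
  where "rep_coalg R G z = module.extend (rep_algebra R G)
    \<lparr>comul = (\<lambda>f. THE t. is_rep_comul R G f t), counit = (\<lambda>f. f \<one>\<^bsub>G\<^esub>), \<dots> = z\<rparr>"

lemma rep_bialg_eq: "rep_bialg R G = rep_coalg R G ()"
  by (simp add: rep_bialg_def rep_coalg_def)

lemma rep_hopf_eq:
  "rep_hopf R G = rep_coalg R G \<lparr>antipode = (\<lambda>f. \<lambda>x\<in>carrier G. f (inv\<^bsub>G\<^esub> x))\<rparr>"
  by (simp add: rep_hopf_def rep_bialg_def rep_coalg_def bialg.defs module.defs)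

lemma rep_algebra_simps:
  "carrier (rep_algebra R G) = rep_functions R G"
  "monoid.mult (rep_algebra R G) = monoid.mult (fun_algebra R G)" "one (rep_algebra R G) = one (fun_algebra R G)"
  "ring.zero (rep_algebra R G) = ring.zero (fun_algebra R G)" "add (rep_algebra R G) = add (fun_algebra R G)"
  "smult (rep_algebra R G) = smult (fun_algebra R G)"
  by (simp_all add: rep_algebra_def)

lemma rep_coalg_simps:
  "carrier (rep_coalg R G z) = rep_functions R G"
  "monoid.mult (rep_coalg R G z) = monoid.mult (fun_algebra R G)" "one (rep_coalg R G z) = one (fun_algebra R G)"
  "ring.zero (rep_coalg R G z) = ring.zero (fun_algebra R G)" "add (rep_coalg R G z) = add (fun_algebra R G)"
  "smult (rep_coalg R G z) = smult (fun_algebra R G)"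
  "counit (rep_coalg R G z) f = f \<one>\<^bsub>G\<^esub>"
  by (simp_all add: rep_coalg_def module.defs rep_algebra_simps)

abbreviation (input) "eval2 R x y \<equiv> tensor_lift (reg_module R) (\<lambda>a b. a x \<otimes>\<^bsub>R\<^esub> b y)"

lemma rep_coalg_comul: "comul (rep_coalg R G z) f = (THE t. is_rep_comul R G f t)"
  by (simp add: rep_coalg_def module.defs)

lemma tensor_rep_coalg:
  "tensor R (rep_coalg R G z) N = tensor R (rep_algebra R G) N"
  "tensor R (rep_algebra R G) (rep_coalg R G z) = tensor R (rep_algebra R G) (rep_algebra R G)"
  by (rule tensor_field_cong; simp add: rep_coalg_simps rep_algebra_simps)+

context
  fixes R :: "('a, 'r) ring_scheme" and G :: "('g, 'x) monoid_scheme"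
  assumes R: "cring R" and noeth: "noetherian_ring R" and her: "hereditary_ring R" and G: "monoid G"
begin

interpretation R: cring R by (fact R)
interpretation G: monoid G by (fact G)
interpretation V: algebra R "fun_algebra R G" by (rule fun_algebra_algebra[OF R])

lemma rep_algebra_algebra: "algebra R (rep_algebra R G)"
  using rep_functions_submodule[OF R noeth G] rep_functions_one[OF R noeth G] rep_functions_mult[OF R noeth G]
  by (intro subalgebra_algebra[OF V.algebra_axioms]) (simp_all add: rep_algebra_simps del: fun_algebra_simps)

lemma rep_coalg_algebra: "algebra R (rep_coalg R G z)"
  using rep_functions_submodule[OF R noeth G] rep_functions_one[OF R noeth G] rep_functions_mult[OF R noeth G]
  by (intro subalgebra_algebra[OF V.algebra_axioms]) (simp_all add: rep_coalg_simps del: fun_algebra_simps)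

lemma rep_algebra_module: "module R (rep_algebra R G)"
  by (rule algebra.module[OF rep_algebra_algebra])

lemma rep_eval_linear: "x \<in> carrier G \<Longrightarrow> (\<lambda>f. f x) \<in> module_hom R (rep_algebra R G) (reg_module R)"
  unfolding rep_algebra_def
  by (rule eval_linear) (use rep_functions_closed[OF R noeth G] in blast)

lemma rep_eval2_bilinear:
  assumes "x \<in> carrier G" "y \<in> carrier G"
  shows "bilinear R (rep_algebra R G) (rep_algebra R G) (reg_module R) (\<lambda>a b. a x \<otimes>\<^bsub>R\<^esub> b y)"
  by (rule reg_mult_bilinear[OF R rep_eval_linear[OF assms(1)] rep_eval_linear[OF assms(2)]])

lemma rep_tensor_eqI:
  assumes "s \<in> carrier (tensor R (rep_algebra R G) (rep_algebra R G))" "t \<in> carrier (tensor R (rep_algebra R G) (rep_algebra R G))"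
    and "\<And>x y. \<lbrakk>x \<in> carrier G; y \<in> carrier G\<rbrakk> \<Longrightarrow> eval2 R x y s = eval2 R x y t"
  shows "s = t"
proof -
  let ?E = "(\<lambda>y (f :: 'g \<Rightarrow> 'a). f y) ` carrier G"
  show ?thesis
  proof (rule tensor_functions_eqI[where E = ?E, OF R noeth her rep_functions_submodule[OF R noeth G] rep_algebra_module _ _ _ assms(1,2)])
    show "rep_algebra R G = (fun_algebra R G)\<lparr>carrier := rep_functions R G\<rparr>" by (simp add: rep_algebra_def)
    fix e assume "e \<in> ?E"
    then show "e \<in> module_hom R (rep_algebra R G) (reg_module R)" using rep_eval_linear by auto
  next
    fix n assume n: "n \<in> carrier (rep_algebra R G)" and z: "\<And>e. e \<in> ?E \<Longrightarrow> e n = \<zero>\<^bsub>R\<^esub>"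
    then have "n = \<zero>\<^bsub>fun_algebra R G\<^esub>"
      using rep_functions_closed[OF R noeth G]
      by (intro fun_algebra_eqI[OF _ V.M.zero_closed]) (auto simp: rep_algebra_simps)
    then show "n = \<zero>\<^bsub>rep_algebra R G\<^esub>" by (simp only: rep_algebra_simps)
  next
    fix x e assume "x \<in> carrier G" "e \<in> ?E"
    then show "tensor_lift (reg_module R) (\<lambda>f n. f x \<otimes>\<^bsub>R\<^esub> e n) s = tensor_lift (reg_module R) (\<lambda>f n. f x \<otimes>\<^bsub>R\<^esub> e n) t"
      using assms(3) by auto
  qed
qed

lemma is_rep_comul_iff:
  "is_rep_comul R G f t \<longleftrightarrow> t \<in> carrier (tensor R (rep_algebra R G) (rep_algebra R G)) \<and>
    (\<forall>x \<in> carrier G. \<forall>y \<in> carrier G. eval2 R x y t = f (x \<otimes>\<^bsub>G\<^esub> y))"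
  unfolding is_rep_comul_def tensor_lift_reg by (auto simp: eq_commute)

context
  fixes f assumes f: "f \<in> rep_functions R G"
begin

text \<open>The functions \<open>coef \<phi> m\<close> are the matrix coefficients \<open>y \<mapsto> \<phi> (\<rho>\<^sub>y m)\<close> of the action
\<open>(\<rho>\<^sub>y m) x = m (x y)\<close> of \<open>G\<close> on the module \<open>L\<close> of the translates of \<open>f\<close>.\<close>

private definition "L = module_span R (fun_algebra R G) (translates G f)"
private abbreviation (input) "ML \<equiv> (fun_algebra R G)\<lparr>carrier := L\<rparr>"
private definition "coef \<phi> m = (\<lambda>y\<in>carrier G. \<phi> (translate G \<one>\<^bsub>G\<^esub> y m))" for \<phi> :: "('g \<Rightarrow> 'a) \<Rightarrow> 'a" and m

private lemma fV: "f \<in> carrier (fun_algebra R G)" by (rule rep_functions_closed[OF R noeth G f])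

private lemma L_sub: "submodule L R (fun_algebra R G)"
  unfolding L_def by (rule V.span_submodule[OF translates_closed[OF R noeth G fV]])

private lemma L_mod: "module R ML" by (rule submodule_module[OF L_sub V.module_axioms])

private lemma L_closed: "m \<in> L \<Longrightarrow> m \<in> carrier (fun_algebra R G)" using V.submoduleE(1)[OF L_sub] by blast

private lemma L_stable: "\<lbrakk>m \<in> L; g \<in> carrier G; g' \<in> carrier G\<rbrakk> \<Longrightarrow> translate G g g' m \<in> L"
  unfolding L_def by (rule span_translates_stable[OF R noeth G fV])

private lemma L_rep: "m \<in> L \<Longrightarrow> m \<in> rep_functions R G"
  unfolding L_def by (rule span_translates_rep[OF R noeth G f])

private lemma L_translate_linear:
  assumes "g \<in> carrier G" "g' \<in> carrier G"
  shows "translate G g g' \<in> module_hom R ML ML"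
proof -
  note h = module_homD[OF translate_linear[OF R noeth G assms]]
  show ?thesis by (rule module_homI) (simp_all add: L_stable assms h L_closed del: fun_algebra_simps)
qed

private lemma coef_closed:
  assumes "\<phi> \<in> module_hom R ML (reg_module R)" "m \<in> L"
  shows "coef \<phi> m \<in> carrier (fun_algebra R G)"
  using module_homD(1)[OF assms(1)] L_stable[OF assms(2)] by (auto simp: coef_def)

private lemma coef_linear:
  assumes "\<phi> \<in> module_hom R ML (reg_module R)"
  shows "coef \<phi> \<in> module_hom R ML (fun_algebra R G)"
proof (rule module_homI)
  fix m m' assume "m \<in> carrier ML" "m' \<in> carrier ML"
  then have m: "m \<in> L" "m' \<in> L" by auto
  have "\<phi> (translate G \<one>\<^bsub>G\<^esub> y (m \<oplus>\<^bsub>fun_algebra R G\<^esub> m')) = \<phi> (translate G \<one>\<^bsub>G\<^esub> y m) \<oplus>\<^bsub>R\<^esub> \<phi> (translate G \<one>\<^bsub>G\<^esub> y m')"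
    if y: "y \<in> carrier G" for y
    using module_homD(2)[OF module_hom_comp[OF L_translate_linear[OF G.one_closed y] assms], of m m'] m
    by (simp del: fun_algebra_simps)
  then show "coef \<phi> (m \<oplus>\<^bsub>ML\<^esub> m') = coef \<phi> m \<oplus>\<^bsub>fun_algebra R G\<^esub> coef \<phi> m'"
    by (auto simp: coef_def intro!: restrict_ext)
next
  fix r m assume r: "r \<in> carrier R" and "m \<in> carrier ML"
  then have m: "m \<in> L" by auto
  have "\<phi> (translate G \<one>\<^bsub>G\<^esub> y (r \<odot>\<^bsub>fun_algebra R G\<^esub> m)) = r \<otimes>\<^bsub>R\<^esub> \<phi> (translate G \<one>\<^bsub>G\<^esub> y m)"
    if y: "y \<in> carrier G" for y
    using module_homD(3)[OF module_hom_comp[OF L_translate_linear[OF G.one_closed y] assms], of r m] m r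
    by (simp del: fun_algebra_simps)
  then show "coef \<phi> (r \<odot>\<^bsub>ML\<^esub> m) = r \<odot>\<^bsub>fun_algebra R G\<^esub> coef \<phi> m"
    by (auto simp: coef_def intro!: restrict_ext)
qed (use coef_closed[OF assms] in simp)

private lemma generators: "\<exists>F. finite F \<and> F \<subseteq> carrier (fun_algebra R G) \<and> L = module_span R (fun_algebra R G) F"
  using rep_functionsD[OF R noeth G f] unfolding L_def by metis

private lemma identity_finite_rank: "finite_rank R ML ML (\<lambda>m. m)"
  using generators fg_functions_finite_rank[OF R noeth her] by blast

text \<open>For \<open>g = \<Sum> \<phi>\<^sub>i(_) b\<^sub>i\<close> one has \<open>\<phi> \<circ> g = \<Sum> \<phi>(b\<^sub>i) \<phi>\<^sub>i\<close>, so only the coefficients of the \<open>\<phi>\<^sub>i\<close> matter.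
As \<open>coef \<phi>\<^sub>i m\<close> is linear in \<open>m\<close>, the finitely many functions \<open>coef \<phi>\<^sub>i a\<close> with generators \<open>a\<close> of \<open>L\<close>
span all coefficients.\<close>

private lemma coef_span:
  assumes "finite_rank R ML ML g"
  shows "\<exists>C. finite C \<and> C \<subseteq> carrier (fun_algebra R G) \<and>
    (\<forall>\<phi> \<in> module_hom R ML (reg_module R). \<forall>m \<in> L. (\<lambda>y\<in>carrier G. \<phi> (g (translate G \<one>\<^bsub>G\<^esub> y m))) \<in> module_span R (fun_algebra R G) C)"
  using assms
proof induction
  case (zero g)
  have "(\<lambda>y\<in>carrier G. \<phi> (g (translate G \<one>\<^bsub>G\<^esub> y m))) = \<zero>\<^bsub>fun_algebra R G\<^esub>"
    if "\<phi> \<in> module_hom R ML (reg_module R)" "m \<in> L" for \<phi> m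
  proof -
    have "\<phi> \<zero>\<^bsub>ML\<^esub> = \<zero>\<^bsub>R\<^esub>" using module_hom_zero[OF L_mod reg_module_module[OF R] that(1)] by (simp only: reg_module_simps)
    moreover have "g (translate G \<one>\<^bsub>G\<^esub> y m) = \<zero>\<^bsub>ML\<^esub>" if "y \<in> carrier G" for y
      using zero L_stable[OF \<open>m \<in> L\<close> G.one_closed that] by (simp del: fun_algebra_simps)
    ultimately show ?thesis by (auto intro!: restrict_ext)
  qed
  then show ?case using V.span_zero[of "{}"] by (intro exI[of _ "{}"]) (simp del: fun_algebra_simps)
next
  case (step \<psi> b g g')
  then obtain C where C: "finite C" "C \<subseteq> carrier (fun_algebra R G)"
    and CC: "\<forall>\<phi> \<in> module_hom R ML (reg_module R). \<forall>m \<in> L. (\<lambda>y\<in>carrier G. \<phi> (g (translate G \<one>\<^bsub>G\<^esub> y m))) \<in> module_span R (fun_algebra R G) C"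
    by (elim exE conjE)
  obtain F where F: "finite F" "F \<subseteq> carrier (fun_algebra R G)" "L = module_span R (fun_algebra R G) F"
    using generators by (elim exE conjE)
  have FL: "F \<subseteq> L" unfolding F(3) by (rule V.span_superset)
  let ?D = "coef \<psi> ` F"
  have D: "?D \<subseteq> carrier (fun_algebra R G)" using coef_closed[OF step(1)] FL by blast
  have sp: "coef \<psi> m \<in> module_span R (fun_algebra R G) ?D" if "m \<in> L" for m
    by (rule module_hom_span_submodule[OF V.module_axioms V.module_axioms L_sub coef_linear[OF step(1)] FL that[unfolded F(3)]])
  have CD: "C \<union> ?D \<subseteq> carrier (fun_algebra R G)" using C(2) D by blast
  show ?case
  proof (intro exI[of _ "C \<union> ?D"] conjI ballI)
    show "finite (C \<union> ?D)" using C(1) F(1) by simp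
    show "C \<union> ?D \<subseteq> carrier (fun_algebra R G)" by (rule CD)
    fix \<phi> m assume \<phi>: "\<phi> \<in> module_hom R ML (reg_module R)" and m: "m \<in> L"
    note \<phi>D = module_homD[OF \<phi>]
    have \<phi>b: "\<phi> b \<in> carrier R" using \<phi>D(1)[OF step(2)] by simp
    have eq: "\<phi> (g' (translate G \<one>\<^bsub>G\<^esub> y m)) = \<phi> b \<otimes>\<^bsub>R\<^esub> coef \<psi> m y \<oplus>\<^bsub>R\<^esub> \<phi> (g (translate G \<one>\<^bsub>G\<^esub> y m))"
      if y: "y \<in> carrier G" for y
    proof -
      let ?k = "translate G \<one>\<^bsub>G\<^esub> y m"
      have k: "?k \<in> carrier ML" using L_stable[OF m G.one_closed y] by simp
      have \<psi>k: "\<psi> ?k \<in> carrier R" using module_homD(1)[OF step(1) k] by simp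
      have gk: "g ?k \<in> carrier ML" by (rule module_homD(1)[OF finite_rank_linear[OF L_mod L_mod step(3)] k])
      have sb: "\<psi> ?k \<odot>\<^bsub>ML\<^esub> b \<in> carrier ML" by (rule module.smult_closed[OF L_mod \<psi>k step(2)])
      have "\<phi> (g' ?k) = \<phi> (\<psi> ?k \<odot>\<^bsub>ML\<^esub> b \<oplus>\<^bsub>ML\<^esub> g ?k)" using step(4) k by (metis (no_types))
      also have "\<dots> = \<psi> ?k \<otimes>\<^bsub>R\<^esub> \<phi> b \<oplus>\<^bsub>R\<^esub> \<phi> (g ?k)"
        unfolding \<phi>D(2)[OF sb gk] \<phi>D(3)[OF \<psi>k step(2)] by simp
      finally show ?thesis using y \<psi>k \<phi>b by (simp add: coef_def R.m_comm)
    qed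
    have "coef \<psi> m \<in> module_span R (fun_algebra R G) (C \<union> ?D)"
      "(\<lambda>y\<in>carrier G. \<phi> (g (translate G \<one>\<^bsub>G\<^esub> y m))) \<in> module_span R (fun_algebra R G) (C \<union> ?D)"
      using sp[OF m] CC \<phi> m V.span_mono[of C "C \<union> ?D"] V.span_mono[of ?D "C \<union> ?D"] by blast+
    from V.span_add[OF CD V.span_smult[OF CD \<phi>b this(1)] this(2)]
    have "\<phi> b \<odot>\<^bsub>fun_algebra R G\<^esub> coef \<psi> m \<oplus>\<^bsub>fun_algebra R G\<^esub> (\<lambda>y\<in>carrier G. \<phi> (g (translate G \<one>\<^bsub>G\<^esub> y m)))
      \<in> module_span R (fun_algebra R G) (C \<union> ?D)" .
    also have "\<phi> b \<odot>\<^bsub>fun_algebra R G\<^esub> coef \<psi> m \<oplus>\<^bsub>fun_algebra R G\<^esub> (\<lambda>y\<in>carrier G. \<phi> (g (translate G \<one>\<^bsub>G\<^esub> y m)))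
      = (\<lambda>y\<in>carrier G. \<phi> (g' (translate G \<one>\<^bsub>G\<^esub> y m)))"
      using eq by (auto intro!: restrict_ext)
    finally show "(\<lambda>y\<in>carrier G. \<phi> (g' (translate G \<one>\<^bsub>G\<^esub> y m))) \<in> module_span R (fun_algebra R G) (C \<union> ?D)" .
  qed
qed

text \<open>Translating a matrix coefficient by \<open>g\<close>, \<open>g'\<close> gives the matrix coefficient of \<open>\<phi> \<circ> \<rho>\<^sub>g\<close> and \<open>\<rho>\<^bsub>g'\<^esub> m\<close>;
all coefficients lie in one finitely generated module.\<close>

private lemma coef_rep:
  assumes \<phi>: "\<phi> \<in> module_hom R ML (reg_module R)" and m: "m \<in> L"
  shows "coef \<phi> m \<in> rep_functions R G"
proof -
  obtain C where C: "finite C" "C \<subseteq> carrier (fun_algebra R G)"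
    and CC: "\<forall>\<phi> \<in> module_hom R ML (reg_module R). \<forall>m \<in> L. (\<lambda>y\<in>carrier G. \<phi> (translate G \<one>\<^bsub>G\<^esub> y m)) \<in> module_span R (fun_algebra R G) C"
    using coef_span[OF identity_finite_rank] by (elim exE conjE)
  show ?thesis
  proof (rule rep_functionsI[OF R noeth G coef_closed[OF assms] C])
    fix g g' assume g: "g \<in> carrier G" "g' \<in> carrier G"
    have \<phi>': "(\<lambda>m. \<phi> (translate G \<one>\<^bsub>G\<^esub> g m)) \<in> module_hom R ML (reg_module R)"
      by (rule module_hom_comp[OF L_translate_linear[OF G.one_closed g(1)] \<phi>])
    have m': "translate G \<one>\<^bsub>G\<^esub> g' m \<in> L" by (rule L_stable[OF m G.one_closed g(2)])
    have "translate G g g' (coef \<phi> m) = (\<lambda>y\<in>carrier G. \<phi> (translate G \<one>\<^bsub>G\<^esub> g (translate G \<one>\<^bsub>G\<^esub> y (translate G \<one>\<^bsub>G\<^esub> g' m))))"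
      using g by (auto simp: translate_def[of G g g'] coef_def translate_translate[OF R noeth G] G.m_assoc intro!: restrict_ext)
    then show "translate G g g' (coef \<phi> m) \<in> module_span R (fun_algebra R G) C"
      using CC[rule_format, OF \<phi>' m'] by simp
  qed
qed

text \<open>For the identity \<open>\<Sum> \<phi>\<^sub>i(_) b\<^sub>i\<close> of \<open>L\<close> this reads
\<open>f (x y) = (\<rho>\<^sub>y f) x = \<Sum> b\<^sub>i(x) \<phi>\<^sub>i(\<rho>\<^sub>y f)\<close>, so that \<open>\<Sum> b\<^sub>i \<otimes> coef \<phi>\<^sub>i f\<close> is the wanted tensor.\<close>

private lemma comul_finite_rank:
  assumes "finite_rank R ML ML g"
  shows "\<exists>t \<in> carrier (tensor R (rep_algebra R G) (rep_algebra R G)).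
    \<forall>x \<in> carrier G. \<forall>y \<in> carrier G. eval2 R x y t = g (translate G \<one>\<^bsub>G\<^esub> y f) x"
  using assms
proof induction
  case (zero g)
  let ?T = "tensor R (rep_algebra R G) (rep_algebra R G)"
  have T: "module R ?T" by (rule tensor_module[OF rep_algebra_module rep_algebra_module])
  show ?case
  proof (intro bexI[of _ "\<zero>\<^bsub>?T\<^esub>"] ballI)
    fix x y assume xy: "x \<in> carrier G" "y \<in> carrier G"
    have "translate G \<one>\<^bsub>G\<^esub> y f \<in> L"
      using L_stable[OF _ G.one_closed xy(2)] span_translates_self[OF R noeth G fV] by (simp add: L_def)
    then have "g (translate G \<one>\<^bsub>G\<^esub> y f) x = \<zero>\<^bsub>R\<^esub>" using zero xy(1) by simp
    then show "eval2 R x y \<zero>\<^bsub>?T\<^esub> = g (translate G \<one>\<^bsub>G\<^esub> y f) x"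
      using module_hom_zero[OF T reg_module_module[OF R] tensor_lift_linear[OF rep_algebra_module rep_algebra_module reg_module_module[OF R] rep_eval2_bilinear[OF xy]]]
      by simp
  next
    show "\<zero>\<^bsub>?T\<^esub> \<in> carrier ?T" by (rule abelian_groupE(2)[OF tensor_abelian_group[OF rep_algebra_module rep_algebra_module]])
  qed
next
  case (step \<psi> b g g')
  let ?H = "rep_algebra R G" let ?T = "tensor R ?H ?H"
  note H = rep_algebra_module
  obtain t where t: "t \<in> carrier ?T" "\<forall>x \<in> carrier G. \<forall>y \<in> carrier G. eval2 R x y t = g (translate G \<one>\<^bsub>G\<^esub> y f) x"
    using step.IH by (elim bexE)
  have fL: "f \<in> L" using span_translates_self[OF R noeth G fV] by (simp add: L_def)
  have b: "b \<in> carrier ?H" using step(2) L_rep by (simp add: rep_algebra_simps)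
  have c: "coef \<psi> f \<in> carrier ?H" using coef_rep[OF step(1) fL] by (simp add: rep_algebra_simps)
  show ?case
  proof (intro bexI[of _ "pure_tensor R ?H ?H b (coef \<psi> f) \<oplus>\<^bsub>?T\<^esub> t"] ballI)
    show "pure_tensor R ?H ?H b (coef \<psi> f) \<oplus>\<^bsub>?T\<^esub> t \<in> carrier ?T"
      by (rule abelian_groupE(1)[OF tensor_abelian_group[OF H H] pure_tensor_closed[OF H H b c] t(1)])
    fix x y assume xy: "x \<in> carrier G" "y \<in> carrier G"
    note bil = rep_eval2_bilinear[OF xy]
    let ?k = "translate G \<one>\<^bsub>G\<^esub> y f"
    have k: "?k \<in> carrier ML" using L_stable[OF fL G.one_closed xy(2)] by simp
    have "\<psi> ?k \<in> carrier R" using module_homD(1)[OF step(1) k] by simp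
    moreover have "b x \<in> carrier R" using L_closed[of b] step(2) xy by auto
    moreover have "g' ?k x = \<psi> ?k \<otimes>\<^bsub>R\<^esub> b x \<oplus>\<^bsub>R\<^esub> g ?k x"
      using step(4) k xy(1) by simp
    moreover have "eval2 R x y (pure_tensor R ?H ?H b (coef \<psi> f)) = b x \<otimes>\<^bsub>R\<^esub> \<psi> ?k"
      unfolding tensor_lift_bilinear_pure[OF H H reg_module_module[OF R] bil b c] using xy(2) by (simp add: coef_def)
    ultimately show "eval2 R x y (pure_tensor R ?H ?H b (coef \<psi> f) \<oplus>\<^bsub>?T\<^esub> t) = g' ?k x"
      using t xy
      by (simp add: module_homD(2)[OF tensor_lift_linear[OF H H reg_module_module[OF R] bil] pure_tensor_closed[OF H H b c] t(1)] R.m_comm)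
  qed
qed

lemma rep_comul_ex1: "\<exists>!t. is_rep_comul R G f t"
proof -
  obtain t where t: "t \<in> carrier (tensor R (rep_algebra R G) (rep_algebra R G))"
    "\<forall>x \<in> carrier G. \<forall>y \<in> carrier G. eval2 R x y t = translate G \<one>\<^bsub>G\<^esub> y f x"
    using comul_finite_rank[OF identity_finite_rank] by (elim bexE)
  then have "is_rep_comul R G f t" unfolding is_rep_comul_iff by (simp add: translate_def)
  moreover have "s = t" if "is_rep_comul R G f s" for s
    using that \<open>is_rep_comul R G f t\<close> unfolding is_rep_comul_iff by (intro rep_tensor_eqI) auto
  ultimately show ?thesis by blast
qed

end

end

lemma reg_module_algebra: "cring R \<Longrightarrow> algebra R (reg_module R)"
proof -
  assume R: "cring R"
  then interpret R: cring R .
  interpret Q: module R "reg_module R" by (rule reg_module_module[OF R])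
  have "cring (reg_module R)"
    by (rule cringI[OF Q.M.abelian_group_axioms]) (auto intro!: comm_monoidI simp: R.m_ac R.l_distr R.r_distr)
  then show ?thesis
    by (intro algebraI[OF R]) (auto simp: R.m_assoc R.l_distr R.r_distr)
qed

lemma module_hom_rep_coalg:
  "module_hom R (rep_coalg R G z) N = module_hom R (rep_algebra R G) N"
  "module_hom R M (rep_coalg R G z) = module_hom R M (rep_algebra R G)"
  by (simp_all add: module_hom_def rep_coalg_simps rep_algebra_simps)

context
  fixes R :: "('a, 'r) ring_scheme" and G :: "('g, 'x) monoid_scheme"
    and H :: "('a, 'g \<Rightarrow> 'a, 'z) bialg_scheme" and z :: 'z
  assumes R: "cring R" and noeth: "noetherian_ring R" and her: "hereditary_ring R" and G: "monoid G"
    and H_def: "H = rep_coalg R G z"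
begin

interpretation R: cring R by (fact R)
interpretation G: monoid G by (fact G)
interpretation V: algebra R "fun_algebra R G" by (rule fun_algebra_algebra[OF R])

lemmas repf_simps = rep_coalg_simps[of R G z, folded H_def]

lemma repf_algebra: "algebra R H" unfolding H_def by (rule rep_coalg_algebra[OF R noeth her G])
lemma repf_module: "module R H" by (rule algebra.module[OF repf_algebra])
lemma base_module: "module R (reg_module R)" by (rule reg_module_module[OF R])
lemma repf_tensor_module: "module R (tensor R H H)" by (rule tensor_module[OF repf_module repf_module])

lemma repf_tensor: "tensor R H H = tensor R (rep_algebra R G) (rep_algebra R G)"
  unfolding H_def by (simp add: tensor_rep_coalg)

lemma repf_closed: "f \<in> carrier H \<Longrightarrow> f \<in> carrier (fun_algebra R G)"
  unfolding repf_simps by (rule rep_functions_closed[OF R noeth G])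

lemma repf_value: "\<lbrakk>f \<in> carrier H; x \<in> carrier G\<rbrakk> \<Longrightarrow> f x \<in> carrier R"
  using repf_closed[of f] by auto

lemma repf_eqI: "\<lbrakk>f \<in> carrier H; f' \<in> carrier H; \<And>x. x \<in> carrier G \<Longrightarrow> f x = f' x\<rbrakk> \<Longrightarrow> f = f'"
  by (rule fun_algebra_eqI[OF repf_closed repf_closed])

lemma repf_eval_linear: "x \<in> carrier G \<Longrightarrow> (\<lambda>f. f x) \<in> module_hom R H (reg_module R)"
  unfolding H_def module_hom_rep_coalg by (rule rep_eval_linear[OF R noeth her G])

lemma repf_eval2_bilinear:
  "\<lbrakk>x \<in> carrier G; y \<in> carrier G\<rbrakk> \<Longrightarrow> bilinear R H H (reg_module R) (\<lambda>a b. a x \<otimes>\<^bsub>R\<^esub> b y)"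
  by (rule reg_mult_bilinear[OF R repf_eval_linear repf_eval_linear])

lemmas repf_eval2_linear = tensor_lift_linear[OF repf_module repf_module base_module repf_eval2_bilinear]
lemmas repf_eval2_pure = tensor_lift_bilinear_pure[OF repf_module repf_module base_module repf_eval2_bilinear]

lemma repf_tensor2_eqI:
  assumes "s \<in> carrier (tensor R H H)" "t \<in> carrier (tensor R H H)"
    and "\<And>x y. \<lbrakk>x \<in> carrier G; y \<in> carrier G\<rbrakk> \<Longrightarrow> eval2 R x y s = eval2 R x y t"
  shows "s = t"
  by (rule rep_tensor_eqI[OF R noeth her G assms[unfolded repf_tensor]])

lemma repf_comul_spec:
  assumes "f \<in> carrier H"
  shows "comul H f \<in> carrier (tensor R H H)"
    and "\<And>x y. \<lbrakk>x \<in> carrier G; y \<in> carrier G\<rbrakk> \<Longrightarrow> eval2 R x y (comul H f) = f (x \<otimes>\<^bsub>G\<^esub> y)"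
proof -
  have "is_rep_comul R G f (comul H f)"
    unfolding H_def rep_coalg_comul by (rule theI'[OF rep_comul_ex1[OF R noeth her G assms[unfolded repf_simps]]])
  note * = this[unfolded is_rep_comul_iff[OF R noeth her G], folded repf_tensor]
  show "comul H f \<in> carrier (tensor R H H)" by (rule *[THEN conjunct1])
  show "\<And>x y. \<lbrakk>x \<in> carrier G; y \<in> carrier G\<rbrakk> \<Longrightarrow> eval2 R x y (comul H f) = f (x \<otimes>\<^bsub>G\<^esub> y)"
    by (rule *[THEN conjunct2, rule_format])
qed

lemma repf_comul_eqI:
  assumes "f \<in> carrier H" "t \<in> carrier (tensor R H H)"
    and "\<And>x y. \<lbrakk>x \<in> carrier G; y \<in> carrier G\<rbrakk> \<Longrightarrow> eval2 R x y t = f (x \<otimes>\<^bsub>G\<^esub> y)"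
  shows "comul H f = t"
  by (rule repf_tensor2_eqI) (simp_all add: assms repf_comul_spec)

text \<open>Here the separation of tensors by values is applied twice: tensors in the right factor are
separated by the evaluations at pairs, which are therefore admissible as functionals \<open>e\<close>.\<close>

lemma repf_tensor3_eqI:
  assumes s: "s \<in> carrier (tensor R H (tensor R H H))" and t: "t \<in> carrier (tensor R H (tensor R H H))"
    and eq: "\<And>x y w. \<lbrakk>x \<in> carrier G; y \<in> carrier G; w \<in> carrier G\<rbrakk> \<Longrightarrow>
      tensor_lift (reg_module R) (\<lambda>a u. a x \<otimes>\<^bsub>R\<^esub> eval2 R y w u) s =
      tensor_lift (reg_module R) (\<lambda>a u. a x \<otimes>\<^bsub>R\<^esub> eval2 R y w u) t"
  shows "s = t"
proof -
  let ?E = "(\<lambda>(y, w). eval2 R y w) ` (carrier G \<times> carrier G)"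
  have e: "tensor R H (tensor R H H) = tensor R (rep_algebra R G) (tensor R H H)"
    unfolding H_def by (rule tensor_rep_coalg)
  show ?thesis
  proof (rule tensor_functions_eqI[where E = ?E, OF R noeth her rep_functions_submodule[OF R noeth G] repf_tensor_module _ _ _ s[unfolded e] t[unfolded e]])
    show "rep_algebra R G = (fun_algebra R G)\<lparr>carrier := rep_functions R G\<rparr>" by (simp add: rep_algebra_def)
    fix e assume "e \<in> ?E"
    then show "e \<in> module_hom R (tensor R H H) (reg_module R)" using repf_eval2_linear by auto
  next
    fix n assume n: "n \<in> carrier (tensor R H H)" and zz: "\<And>e. e \<in> ?E \<Longrightarrow> e n = \<zero>\<^bsub>R\<^esub>"
    interpret HH: module R "tensor R H H" by (rule repf_tensor_module)
    show "n = \<zero>\<^bsub>tensor R H H\<^esub>"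
    proof (rule repf_tensor2_eqI[OF n HH.M.zero_closed])
      fix x y assume xy: "x \<in> carrier G" "y \<in> carrier G"
      then have "eval2 R x y n = \<zero>\<^bsub>R\<^esub>" by (intro zz image_eqI[of _ _ "(x, y)"]) simp_all
      then show "eval2 R x y n = eval2 R x y \<zero>\<^bsub>tensor R H H\<^esub>"
        using module_hom_zero[OF repf_tensor_module base_module repf_eval2_linear[OF xy]] by simp
    qed
  next
    fix x e assume "x \<in> carrier G" "e \<in> ?E"
    then show "tensor_lift (reg_module R) (\<lambda>f n. f x \<otimes>\<^bsub>R\<^esub> e n) s = tensor_lift (reg_module R) (\<lambda>f n. f x \<otimes>\<^bsub>R\<^esub> e n) t"
      using eq by auto
  qed
qed

lemma repf_comul_linear: "comul H \<in> module_hom R H (tensor R H H)"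
proof -
  interpret H: module R H by (rule repf_module)
  interpret HH: module R "tensor R H H" by (rule repf_tensor_module)
  show ?thesis
  proof (rule module_homI)
    fix f f' assume f: "f \<in> carrier H" "f' \<in> carrier H"
    show "comul H (f \<oplus>\<^bsub>H\<^esub> f') = comul H f \<oplus>\<^bsub>tensor R H H\<^esub> comul H f'"
    proof (rule repf_comul_eqI)
      fix x y assume xy: "x \<in> carrier G" "y \<in> carrier G"
      show "eval2 R x y (comul H f \<oplus>\<^bsub>tensor R H H\<^esub> comul H f') = (f \<oplus>\<^bsub>H\<^esub> f') (x \<otimes>\<^bsub>G\<^esub> y)"
        using xy by (simp add: module_homD(2)[OF repf_eval2_linear[OF xy] repf_comul_spec(1)[OF f(1)] repf_comul_spec(1)[OF f(2)]]
            repf_comul_spec(2)[OF f(1) xy] repf_comul_spec(2)[OF f(2) xy] repf_simps)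
    qed (simp_all add: f repf_comul_spec(1))
  next
    fix r f assume r: "r \<in> carrier R" and f: "f \<in> carrier H"
    show "comul H (r \<odot>\<^bsub>H\<^esub> f) = r \<odot>\<^bsub>tensor R H H\<^esub> comul H f"
    proof (rule repf_comul_eqI)
      fix x y assume xy: "x \<in> carrier G" "y \<in> carrier G"
      show "eval2 R x y (r \<odot>\<^bsub>tensor R H H\<^esub> comul H f) = (r \<odot>\<^bsub>H\<^esub> f) (x \<otimes>\<^bsub>G\<^esub> y)"
        using xy by (simp add: module_homD(3)[OF repf_eval2_linear[OF xy] r repf_comul_spec(1)[OF f]] repf_comul_spec(2)[OF f xy] repf_simps)
    qed (simp_all add: f r repf_comul_spec(1))
  qed (rule repf_comul_spec(1))
qed

lemma repf_comul_alg_hom: "comul H \<in> alg_hom R H (tensor R H H)"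
proof -
  interpret H: algebra R H by (rule repf_algebra)
  have "comul H \<in> ring_hom H (tensor R H H)"
  proof (rule ring_hom_memI)
    show "\<And>f. f \<in> carrier H \<Longrightarrow> comul H f \<in> carrier (tensor R H H)" by (rule repf_comul_spec(1))
    show "\<And>f f'. \<lbrakk>f \<in> carrier H; f' \<in> carrier H\<rbrakk> \<Longrightarrow> comul H (f \<oplus>\<^bsub>H\<^esub> f') = comul H f \<oplus>\<^bsub>tensor R H H\<^esub> comul H f'"
      by (rule module_homD(2)[OF repf_comul_linear])
  next
    fix f f' assume f: "f \<in> carrier H" "f' \<in> carrier H"
    show "comul H (f \<otimes>\<^bsub>H\<^esub> f') = comul H f \<otimes>\<^bsub>tensor R H H\<^esub> comul H f'"
    proof (rule repf_comul_eqI)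
      show "comul H f \<otimes>\<^bsub>tensor R H H\<^esub> comul H f' \<in> carrier (tensor R H H)"
        by (rule bilinearD(3)[OF tensor_mult_bilinear[OF repf_algebra repf_algebra] repf_comul_spec(1)[OF f(1)] repf_comul_spec(1)[OF f(2)]])
      fix x y assume xy: "x \<in> carrier G" "y \<in> carrier G"
      have "eval2 R x y (comul H f \<otimes>\<^bsub>tensor R H H\<^esub> comul H f') =
        eval2 R x y (comul H f) \<otimes>\<^bsub>reg_module R\<^esub> eval2 R x y (comul H f')"
      proof (rule tensor_lift_mult[OF repf_algebra repf_algebra reg_module_algebra[OF R] repf_eval2_bilinear[OF xy] _ repf_comul_spec(1)[OF f(1)] repf_comul_spec(1)[OF f(2)]])
        fix m n m' n' assume *: "m \<in> carrier H" "n \<in> carrier H" "m' \<in> carrier H" "n' \<in> carrier H"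
        show "(m \<otimes>\<^bsub>H\<^esub> m') x \<otimes>\<^bsub>R\<^esub> (n \<otimes>\<^bsub>H\<^esub> n') y = (m x \<otimes>\<^bsub>R\<^esub> n y) \<otimes>\<^bsub>reg_module R\<^esub> (m' x \<otimes>\<^bsub>R\<^esub> n' y)"
          using xy repf_value[OF *(1) xy(1)] repf_value[OF *(2) xy(2)] repf_value[OF *(3) xy(1)] repf_value[OF *(4) xy(2)]
          by (simp add: repf_simps R.m_ac)
      qed
      then show "eval2 R x y (comul H f \<otimes>\<^bsub>tensor R H H\<^esub> comul H f') = (f \<otimes>\<^bsub>H\<^esub> f') (x \<otimes>\<^bsub>G\<^esub> y)"
        using xy by (simp add: repf_comul_spec(2)[OF f(1) xy] repf_comul_spec(2)[OF f(2) xy] repf_simps)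
    qed (simp add: f)
  next
    show "comul H \<one>\<^bsub>H\<^esub> = \<one>\<^bsub>tensor R H H\<^esub>"
    proof (rule repf_comul_eqI)
      show "\<one>\<^bsub>tensor R H H\<^esub> \<in> carrier (tensor R H H)"
        unfolding tensor_simps(4) by (rule pure_tensor_closed[OF repf_module repf_module H.one_closed H.one_closed])
      fix x y assume xy: "x \<in> carrier G" "y \<in> carrier G"
      then show "eval2 R x y \<one>\<^bsub>tensor R H H\<^esub> = \<one>\<^bsub>H\<^esub> (x \<otimes>\<^bsub>G\<^esub> y)"
        unfolding tensor_simps(4) repf_eval2_pure[OF xy H.one_closed H.one_closed] by (simp add: repf_simps)
    qed simp
  qed
  then show ?thesis using repf_comul_linear by (simp add: alg_hom_def)
qed

lemma repf_counit_alg_hom: "counit H \<in> alg_hom R H (reg_module R)"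
  using repf_value
  unfolding alg_hom_def by (auto intro!: ring_hom_memI module_homI simp: repf_simps)

text \<open>The counit and antipode laws compare functions of the form \<open>\<Sum> \<beta> f\<^sub>1 f\<^sub>2\<close>.  If the evaluation \<open>l\<close> of
such a function only involves the values of \<open>f\<^sub>1\<close> at \<open>x\<close> and of \<open>f\<^sub>2\<close> at \<open>y\<close>, then it is a value of \<open>f\<close>.\<close>

lemma repf_comul_lift:
  assumes P: "module R P" and b: "bilinear R H H P \<beta>" and l: "l \<in> module_hom R P (reg_module R)"
    and v: "\<And>a b. \<lbrakk>a \<in> carrier H; b \<in> carrier H\<rbrakk> \<Longrightarrow> l (\<beta> a b) = a x \<otimes>\<^bsub>R\<^esub> b y"
    and f: "f \<in> carrier H" and xy: "x \<in> carrier G" "y \<in> carrier G"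
  shows "l (tensor_lift P \<beta> (comul H f)) = f (x \<otimes>\<^bsub>G\<^esub> y)"
proof -
  note h = hom_tensor_lift[OF repf_module repf_module P base_module b l repf_comul_spec(1)[OF f]]
  have "l (tensor_lift P \<beta> (comul H f)) = eval2 R x y (comul H f)"
    unfolding h(1) by (rule tensor_lift_cong[OF repf_module repf_module base_module h(2) repf_eval2_bilinear[OF xy] v repf_comul_spec(1)[OF f]])
  then show ?thesis using repf_comul_spec(2)[OF f xy] by simp
qed

text \<open>Both sides have the value \<open>f (x y w)\<close> at \<open>(x, y, w)\<close>, by associativity in \<open>G\<close>.\<close>

lemma repf_coassoc:
  assumes f: "f \<in> carrier H"
  shows "tensor_assoc R H H H (tensor_map R (tensor R H H) H (comul H) id (comul H f)) =
    tensor_map R H (tensor R H H) id (comul H) (comul H f)"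
proof -
  note Hm = repf_module and c = repf_comul_spec
  have id: "id \<in> module_hom R H H" by (rule module_homI) auto
  note tL = tensor_map_linear[OF Hm Hm repf_tensor_module Hm repf_comul_linear id]
  note tR = tensor_map_linear[OF Hm Hm Hm repf_tensor_module id repf_comul_linear]
  show ?thesis
  proof (rule repf_tensor3_eqI)
    show "tensor_assoc R H H H (tensor_map R (tensor R H H) H (comul H) id (comul H f)) \<in> carrier (tensor R H (tensor R H H))"
      by (rule module_homD(1)[OF tensor_assoc_linear[OF Hm Hm Hm] module_homD(1)[OF tL c(1)[OF f]]])
    show "tensor_map R H (tensor R H H) id (comul H) (comul H f) \<in> carrier (tensor R H (tensor R H H))"
      by (rule module_homD(1)[OF tR c(1)[OF f]])
    fix x y w assume x: "x \<in> carrier G" and y: "y \<in> carrier G" and w: "w \<in> carrier G"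
    let ?Q = "reg_module R" let ?ev = "\<lambda>a u. a x \<otimes>\<^bsub>R\<^esub> eval2 R y w u"
    let ?tau = "\<lambda>a b d. a x \<otimes>\<^bsub>R\<^esub> (b y \<otimes>\<^bsub>R\<^esub> d w)"
    have bev: "bilinear R H (tensor R H H) ?Q ?ev"
      by (rule reg_mult_bilinear[OF R repf_eval_linear[OF x] repf_eval2_linear[OF y w]])
    have "tensor_lift ?Q ?ev (tensor_map R H (tensor R H H) id (comul H) (comul H f)) =
      tensor_lift ?Q (\<lambda>a b. (id a) x \<otimes>\<^bsub>R\<^esub> eval2 R y w (comul H b)) (comul H f)"
      by (rule tensor_lift_map[OF Hm Hm Hm repf_tensor_module id repf_comul_linear base_module bev c(1)[OF f]])
    also have "\<dots> = eval2 R x (y \<otimes>\<^bsub>G\<^esub> w) (comul H f)"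
      by (rule tensor_lift_cong[OF Hm Hm base_module bilinear_comp[OF bev id repf_comul_linear] repf_eval2_bilinear[OF x] _ c(1)[OF f]])
         (simp_all add: c(2) y w)
    finally have right: "tensor_lift ?Q ?ev (tensor_map R H (tensor R H H) id (comul H) (comul H f)) = f (x \<otimes>\<^bsub>G\<^esub> y \<otimes>\<^bsub>G\<^esub> w)"
      using c(2)[OF f x G.m_closed[OF y w]] x y w by (simp add: G.m_assoc)
    have mulx: "(\<lambda>r. a x \<otimes>\<^bsub>R\<^esub> r) \<in> module_hom R ?Q ?Q" if "a \<in> carrier H" for a
      using repf_value[OF that x] by (intro module_homI) (simp_all add: R.r_distr R.m_lcomm)
    have b1: "bilinear R H H ?Q (?tau a)" if "a \<in> carrier H" for a
      by (rule hom_tensor_lift(2)[OF Hm Hm base_module base_module repf_eval2_bilinear[OF y w] mulx[OF that] c(1)[OF f]])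
    have b3: "bilinear R H H ?Q (\<lambda>a b. ?tau a b d)" if d: "d \<in> carrier H" for d
    proof -
      have "(\<lambda>b. b y \<otimes>\<^bsub>R\<^esub> d w) \<in> module_hom R H ?Q"
        by (rule bilinearD(2)[OF repf_eval2_bilinear[OF y w] d])
      from reg_mult_bilinear[OF R repf_eval_linear[OF x] this] show ?thesis .
    qed
    have tr: "bilinear R H (tensor R H H) ?Q (\<lambda>a u. tensor_lift ?Q (?tau a) u)"
      by (rule trilinear_right[where \<tau> = ?tau, OF Hm Hm Hm base_module]; erule b1 b3)
    have tl: "bilinear R (tensor R H H) H ?Q (\<lambda>u d. tensor_lift ?Q (\<lambda>a b. ?tau a b d) u)"
      by (rule trilinear_left[where \<tau> = ?tau, OF Hm Hm Hm base_module]; erule b1 b3)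
    let ?s = "tensor_map R (tensor R H H) H (comul H) id (comul H f)"
    have s: "?s \<in> carrier (tensor R (tensor R H H) H)" by (rule module_homD(1)[OF tL c(1)[OF f]])
    have as: "tensor_assoc R H H H ?s \<in> carrier (tensor R H (tensor R H H))"
      by (rule module_homD(1)[OF tensor_assoc_linear[OF Hm Hm Hm] s])
    have "tensor_lift ?Q ?ev (tensor_assoc R H H H ?s) = tensor_lift ?Q (\<lambda>a u. tensor_lift ?Q (?tau a) u) (tensor_assoc R H H H ?s)"
    proof (rule tensor_lift_cong[OF Hm repf_tensor_module base_module bev tr _ as])
      fix a u assume a: "a \<in> carrier H" and u: "u \<in> carrier (tensor R H H)"
      show "?ev a u = tensor_lift ?Q (?tau a) u"
        by (rule hom_tensor_lift(1)[OF Hm Hm base_module base_module repf_eval2_bilinear[OF y w] mulx[OF a] u])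
    qed
    also have "\<dots> = tensor_lift ?Q (\<lambda>u d. tensor_lift ?Q (\<lambda>a b. ?tau a b d) u) ?s"
      by (rule tensor_lift_assoc[where \<tau> = ?tau, OF Hm Hm Hm base_module _ _ s]; erule b1 b3)
    also have "\<dots> = tensor_lift ?Q (\<lambda>a d. tensor_lift ?Q (\<lambda>a b. ?tau a b (id d)) (comul H a)) (comul H f)"
      by (rule tensor_lift_map[OF Hm Hm repf_tensor_module Hm repf_comul_linear id base_module tl c(1)[OF f]])
    also have "\<dots> = eval2 R (x \<otimes>\<^bsub>G\<^esub> y) w (comul H f)"
    proof (rule tensor_lift_cong[OF Hm Hm base_module bilinear_comp[OF tl repf_comul_linear id] repf_eval2_bilinear[OF G.m_closed[OF x y] w] _ c(1)[OF f]])
      fix a d assume a: "a \<in> carrier H" and d: "d \<in> carrier H"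
      have dw: "d w \<in> carrier R" by (rule repf_value[OF d w])
      have mulw: "(\<lambda>r. r \<otimes>\<^bsub>R\<^esub> d w) \<in> module_hom R ?Q ?Q"
        using dw by (intro module_homI) (simp_all add: R.l_distr R.m_assoc)
      note h = hom_tensor_lift[OF Hm Hm base_module base_module repf_eval2_bilinear[OF x y] mulw c(1)[OF a]]
      have "tensor_lift ?Q (\<lambda>a b. ?tau a b (id d)) (comul H a) = tensor_lift ?Q (\<lambda>a b. (a x \<otimes>\<^bsub>R\<^esub> b y) \<otimes>\<^bsub>R\<^esub> d w) (comul H a)"
        using dw x y repf_value by (intro tensor_lift_cong[OF Hm Hm base_module b3[of "id d"] h(2) _ c(1)[OF a]]) (simp_all add: R.m_assoc d)
      then show "tensor_lift ?Q (\<lambda>a b. ?tau a b (id d)) (comul H a) = a (x \<otimes>\<^bsub>G\<^esub> y) \<otimes>\<^bsub>R\<^esub> d w"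
        using h(1) c(2)[OF a x y] by simp
    qed
    also have "\<dots> = f (x \<otimes>\<^bsub>G\<^esub> y \<otimes>\<^bsub>G\<^esub> w)" by (rule c(2)[OF f G.m_closed[OF x y] w])
    finally show "tensor_lift ?Q ?ev (tensor_assoc R H H H ?s) =
      tensor_lift ?Q ?ev (tensor_map R H (tensor R H H) id (comul H) (comul H f))" using right by simp
  qed
qed

lemma repf_comm_bialgebra: "comm_bialgebra R H"
proof -
  interpret H: algebra R H by (rule repf_algebra)
  note one = G.one_closed
  have cu: "(\<lambda>a. counit H a) \<in> module_hom R H (reg_module R)" using repf_counit_alg_hom by (simp add: alg_hom_def)
  have bl: "bilinear R H H H (\<lambda>a b. counit H a \<odot>\<^bsub>H\<^esub> b)" by (rule smult_right_bilinear[OF repf_module cu])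
  have br: "bilinear R H H H (\<lambda>a b. counit H b \<odot>\<^bsub>H\<^esub> a)" by (rule smult_left_bilinear[OF repf_module cu])
  show ?thesis
  proof (intro comm_bialgebra.intro comm_bialgebra_axioms.intro repf_algebra repf_comul_alg_hom repf_counit_alg_hom repf_coassoc)
    fix f assume f: "f \<in> carrier H"
    show "tensor_lift H (\<lambda>a b. counit H a \<odot>\<^bsub>H\<^esub> b) (comul H f) = f"
    proof (rule repf_eqI[OF tensor_lift_closed[OF repf_module repf_module repf_module bl repf_comul_spec(1)[OF f]] f])
      fix x assume x: "x \<in> carrier G"
      have "tensor_lift H (\<lambda>a b. counit H a \<odot>\<^bsub>H\<^esub> b) (comul H f) x = f (\<one>\<^bsub>G\<^esub> \<otimes>\<^bsub>G\<^esub> x)"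
        by (rule repf_comul_lift[OF repf_module bl repf_eval_linear[OF x] _ f one x]) (simp add: repf_simps x)
      then show "tensor_lift H (\<lambda>a b. counit H a \<odot>\<^bsub>H\<^esub> b) (comul H f) x = f x" using x by simp
    qed
    show "tensor_lift H (\<lambda>a b. counit H b \<odot>\<^bsub>H\<^esub> a) (comul H f) = f"
    proof (rule repf_eqI[OF tensor_lift_closed[OF repf_module repf_module repf_module br repf_comul_spec(1)[OF f]] f])
      fix x assume x: "x \<in> carrier G"
      have "tensor_lift H (\<lambda>a b. counit H b \<odot>\<^bsub>H\<^esub> a) (comul H f) x = f (x \<otimes>\<^bsub>G\<^esub> \<one>\<^bsub>G\<^esub>)"
      proof (rule repf_comul_lift[OF repf_module br repf_eval_linear[OF x] _ f x one])
        fix a b assume ab: "a \<in> carrier H" "b \<in> carrier H"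
        show "(counit H b \<odot>\<^bsub>H\<^esub> a) x = a x \<otimes>\<^bsub>R\<^esub> b \<one>\<^bsub>G\<^esub>"
          using repf_value[OF ab(1) x] repf_value[OF ab(2) one] x by (simp add: repf_simps R.m_comm)
      qed
      then show "tensor_lift H (\<lambda>a b. counit H b \<odot>\<^bsub>H\<^esub> a) (comul H f) x = f x" using x by simp
    qed
  qed
qed

end

lemma rep_bialg_comm_bialgebra:
  assumes "cring R" "noetherian_ring R" "hereditary_ring R" "monoid G"
  shows "comm_bialgebra R (rep_bialg R G)"
  by (rule repf_comm_bialgebra[OF assms rep_bialg_eq])

lemma rep_hopf_comm_hopf_algebra:
  fixes G :: "('g, 'x) monoid_scheme"
  assumes R: "cring R" and noeth: "noetherian_ring R" and her: "hereditary_ring R" and G: "group G"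
  shows "comm_hopf_algebra R (rep_hopf R G)"
proof -
  interpret R: cring R by fact
  interpret G: group G by fact
  let ?H = "rep_hopf R G" and ?S = "antipode (rep_hopf R G)"
  note ctx = R noeth her G.monoid_axioms rep_hopf_eq
  note ctx' = R noeth G.monoid_axioms
  interpret V: algebra R "fun_algebra R G" by (rule fun_algebra_algebra[OF R])
  interpret B: comm_bialgebra R ?H by (rule repf_comm_bialgebra[OF ctx])
  have S: "?S f = (\<lambda>x\<in>carrier G. f (inv\<^bsub>G\<^esub> x))" for f by (simp add: rep_hopf_def bialg.defs)
  note Hs = repf_simps[OF ctx] note Hm = repf_module[OF ctx]
  have SV: "?S \<in> module_hom R (fun_algebra R G) (fun_algebra R G)"
    by (rule module_homI) (auto simp: S intro!: restrict_ext)
  have Srep: "?S f \<in> rep_functions R G" if f: "f \<in> rep_functions R G" for f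
  proof -
    obtain F where F: "f \<in> carrier (fun_algebra R G)" "finite F" "F \<subseteq> carrier (fun_algebra R G)"
      and tr: "\<forall>g \<in> carrier G. \<forall>g' \<in> carrier G. translate G g g' f \<in> module_span R (fun_algebra R G) F"
      using rep_functionsD[OF ctx' f] by (elim exE conjE)
    have SF: "?S ` F \<subseteq> carrier (fun_algebra R G)" using module_homD(1)[OF SV] F(3) by blast
    have sp: "?S m \<in> module_span R (fun_algebra R G) (?S ` F)" if "m \<in> module_span R (fun_algebra R G) F" for m
      by (rule module_hom_span[OF V.module_axioms V.module_axioms SV F(3) that])
    show ?thesis
    proof (rule rep_functionsI[OF ctx' module_homD(1)[OF SV F(1)] finite_imageI[OF F(2)] SF])
      fix g g' assume g: "g \<in> carrier G" "g' \<in> carrier G"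
      have "translate G g g' (?S f) = ?S (translate G (inv\<^bsub>G\<^esub> g') (inv\<^bsub>G\<^esub> g) f)"
        using g by (auto simp: S translate_def G.inv_mult_group G.m_assoc intro!: restrict_ext)
      then show "translate G g g' (?S f) \<in> module_span R (fun_algebra R G) (?S ` F)"
        using sp[OF tr[rule_format, OF G.inv_closed[OF g(2)] G.inv_closed[OF g(1)]]] by simp
    qed
  qed
  have Slin: "?S \<in> module_hom R ?H ?H"
    using module_homD[OF SV] Srep repf_closed[OF ctx] by (intro module_homI) (simp_all add: Hs del: fun_algebra_simps)
  have mul: "bilinear R ?H ?H ?H (monoid.mult ?H)" by (rule algebra_mult_bilinear[OF B.algebra_axioms])
  note bl = bilinear_comp[OF mul Slin module_hom_id] and br = bilinear_comp[OF mul module_hom_id Slin]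
  have unit: "counit ?H f \<odot>\<^bsub>?H\<^esub> \<one>\<^bsub>?H\<^esub> \<in> carrier ?H" "x \<in> carrier G \<Longrightarrow> (counit ?H f \<odot>\<^bsub>?H\<^esub> \<one>\<^bsub>?H\<^esub>) x = f \<one>\<^bsub>G\<^esub>"
    if f: "f \<in> carrier ?H" for f x
  proof -
    have "counit ?H f \<in> carrier R" using repf_value[OF ctx f] by (simp add: Hs)
    then show "counit ?H f \<odot>\<^bsub>?H\<^esub> \<one>\<^bsub>?H\<^esub> \<in> carrier ?H" by (rule B.smult_closed[OF _ B.one_closed])
    show "x \<in> carrier G \<Longrightarrow> (counit ?H f \<odot>\<^bsub>?H\<^esub> \<one>\<^bsub>?H\<^esub>) x = f \<one>\<^bsub>G\<^esub>" using repf_value[OF ctx f] by (simp add: Hs)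
  qed
  show ?thesis
  proof (intro comm_hopf_algebra.intro comm_hopf_algebra_axioms.intro B.comm_bialgebra_axioms Slin)
    fix f assume f: "f \<in> carrier ?H"
    show "tensor_lift ?H (\<lambda>a b. ?S a \<otimes>\<^bsub>?H\<^esub> b) (comul ?H f) = counit ?H f \<odot>\<^bsub>?H\<^esub> \<one>\<^bsub>?H\<^esub>"
    proof (rule repf_eqI[OF ctx tensor_lift_closed[OF Hm Hm Hm bl repf_comul_spec(1)[OF ctx f]] unit(1)[OF f]])
      fix x assume x: "x \<in> carrier G"
      have "tensor_lift ?H (\<lambda>a b. ?S a \<otimes>\<^bsub>?H\<^esub> b) (comul ?H f) x = f (inv\<^bsub>G\<^esub> x \<otimes>\<^bsub>G\<^esub> x)"
        by (rule repf_comul_lift[OF ctx Hm bl repf_eval_linear[OF ctx x] _ f G.inv_closed[OF x] x]) (simp add: Hs x S)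
      then show "tensor_lift ?H (\<lambda>a b. ?S a \<otimes>\<^bsub>?H\<^esub> b) (comul ?H f) x = (counit ?H f \<odot>\<^bsub>?H\<^esub> \<one>\<^bsub>?H\<^esub>) x"
        using unit(2)[OF f x] x by simp
    qed
    show "tensor_lift ?H (\<lambda>a b. a \<otimes>\<^bsub>?H\<^esub> ?S b) (comul ?H f) = counit ?H f \<odot>\<^bsub>?H\<^esub> \<one>\<^bsub>?H\<^esub>"
    proof (rule repf_eqI[OF ctx tensor_lift_closed[OF Hm Hm Hm br repf_comul_spec(1)[OF ctx f]] unit(1)[OF f]])
      fix x assume x: "x \<in> carrier G"
      have "tensor_lift ?H (\<lambda>a b. a \<otimes>\<^bsub>?H\<^esub> ?S b) (comul ?H f) x = f (x \<otimes>\<^bsub>G\<^esub> inv\<^bsub>G\<^esub> x)"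
        by (rule repf_comul_lift[OF ctx Hm br repf_eval_linear[OF ctx x] _ f x G.inv_closed[OF x]]) (simp add: Hs x S)
      then show "tensor_lift ?H (\<lambda>a b. a \<otimes>\<^bsub>?H\<^esub> ?S b) (comul ?H f) x = (counit ?H f \<odot>\<^bsub>?H\<^esub> \<one>\<^bsub>?H\<^esub>) x"
        using unit(2)[OF f x] x by simp
    qed
  qed
qed

section \<open>The monoid of points of a bialgebra\<close>

text \<open>The convolution \<open>(f \<star> g) h = \<Sum> f h\<^sub>1 g h\<^sub>2\<close>, for arbitrary linear functionals and not only for points:
the inverse of a point is first known as a linear functional.\<close>

definition conv ::
    "('a, 'r) ring_scheme \<Rightarrow> ('a, 'h, 'z) bialg_scheme \<Rightarrow> ('h \<Rightarrow> 'a) \<Rightarrow> ('h \<Rightarrow> 'a) \<Rightarrow> 'h \<Rightarrow> 'a"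
  where "conv R H f g h = tensor_lift (reg_module R) (\<lambda>a b. f a \<otimes>\<^bsub>R\<^esub> g b) (comul H h)"

lemma alg_points_simps:
  "carrier (alg_points R H) = alg_hom R H (reg_module R) \<inter> extensional (carrier H)"
  "f \<otimes>\<^bsub>alg_points R H\<^esub> g = (\<lambda>h\<in>carrier H. conv R H f g h)"
  "\<one>\<^bsub>alg_points R H\<^esub> = restrict (counit H) (carrier H)"
  by (simp_all add: alg_points_def conv_def[abs_def] tensor_lift_reg)

lemma alg_homD:
  assumes "f \<in> alg_hom R A B"
  shows "f \<in> module_hom R A B" "\<And>x y. \<lbrakk>x \<in> carrier A; y \<in> carrier A\<rbrakk> \<Longrightarrow> f (x \<otimes>\<^bsub>A\<^esub> y) = f x \<otimes>\<^bsub>B\<^esub> f y"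
    "f \<one>\<^bsub>A\<^esub> = \<one>\<^bsub>B\<^esub>"
  using assms by (auto simp: alg_hom_def ring_hom_def)

lemma alg_homI:
  assumes "f \<in> module_hom R A B" "\<And>x y. \<lbrakk>x \<in> carrier A; y \<in> carrier A\<rbrakk> \<Longrightarrow> f (x \<otimes>\<^bsub>A\<^esub> y) = f x \<otimes>\<^bsub>B\<^esub> f y"
    "f \<one>\<^bsub>A\<^esub> = \<one>\<^bsub>B\<^esub>"
  shows "f \<in> alg_hom R A B"
  using assms module_homD[OF assms(1)] by (auto simp: alg_hom_def intro!: ring_hom_memI)

lemma alg_hom_restrict:
  assumes "algebra R A" "f \<in> alg_hom R A B" "\<And>x. x \<in> carrier A \<Longrightarrow> g x = f x"
  shows "g \<in> alg_hom R A B"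
proof -
  interpret A: algebra R A by fact
  show ?thesis
    using alg_homD[OF assms(2)] assms(3)
    by (intro alg_homI module_hom_cong[OF alg_homD(1)[OF assms(2)] A.module_axioms]) auto
qed

context
  fixes R :: "('a, 'r) ring_scheme" and H :: "('a, 'h, 'z) bialg_scheme"
  assumes B: "comm_bialgebra R H"
begin

interpretation B: comm_bialgebra R H by (fact B)

private abbreviation (input) "Q \<equiv> reg_module R"

lemma bialg_algebra: "algebra R H" by (rule B.algebra_axioms)
private lemma R: "cring R" by (rule B.R.is_cring)
private lemma Hm: "module R H" by (rule B.module_axioms)
private lemma Qm: "module R Q" by (rule reg_module_module[OF R])
private lemma HHm: "module R (tensor R H H)" by (rule tensor_module[OF Hm Hm])

lemma bialg_comul_linear: "comul H \<in> module_hom R H (tensor R H H)"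
  by (rule alg_homD(1)[OF B.comul_hom])

private lemmas \<Delta>_closed = module_homD(1)[OF bialg_comul_linear]

text \<open>Coassociativity in Sweedler form,
\<open>\<Sum> \<tau> h\<^sub>1\<^sub>1 h\<^sub>1\<^sub>2 h\<^sub>2 = \<Sum> \<tau> h\<^sub>1 h\<^sub>2\<^sub>1 h\<^sub>2\<^sub>2\<close> for trilinear \<open>\<tau>\<close>, without mention of threefold tensors.\<close>

lemma bialg_coassoc:
  fixes \<tau> :: "'h \<Rightarrow> 'h \<Rightarrow> 'h \<Rightarrow> 'p"
  assumes P: "module R P"
    and b1: "\<And>m. m \<in> carrier H \<Longrightarrow> bilinear R H H P (\<tau> m)"
    and b3: "\<And>p. p \<in> carrier H \<Longrightarrow> bilinear R H H P (\<lambda>m n. \<tau> m n p)"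
    and h: "h \<in> carrier H"
  shows "tensor_lift P (\<lambda>a d. tensor_lift P (\<lambda>a b. \<tau> a b d) (comul H a)) (comul H h) =
    tensor_lift P (\<lambda>a b. tensor_lift P (\<tau> a) (comul H b)) (comul H h)"
proof -
  have id: "id \<in> module_hom R H H" by (rule module_homI) auto
  have tr: "bilinear R H (tensor R H H) P (\<lambda>a u. tensor_lift P (\<tau> a) u)"
    by (rule trilinear_right[where \<tau> = \<tau>, OF Hm Hm Hm P]; erule b1 b3)
  have tl: "bilinear R (tensor R H H) H P (\<lambda>u d. tensor_lift P (\<lambda>a b. \<tau> a b d) u)"
    by (rule trilinear_left[where \<tau> = \<tau>, OF Hm Hm Hm P]; erule b1 b3)
  note c = bialg_comul_linear
  let ?s = "tensor_map R (tensor R H H) H (comul H) id (comul H h)"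
  have s: "?s \<in> carrier (tensor R (tensor R H H) H)"
    by (rule module_homD(1)[OF tensor_map_linear[OF Hm Hm HHm Hm c id] \<Delta>_closed[OF h]])
  have "tensor_lift P (\<lambda>a d. tensor_lift P (\<lambda>a b. \<tau> a b d) (comul H a)) (comul H h) =
      tensor_lift P (\<lambda>u d. tensor_lift P (\<lambda>a b. \<tau> a b d) u) ?s"
    using tensor_lift_map[OF Hm Hm HHm Hm c id P tl \<Delta>_closed[OF h]] by simp
  also have "\<dots> = tensor_lift P (\<lambda>a u. tensor_lift P (\<tau> a) u) (tensor_assoc R H H H ?s)"
    by (rule tensor_lift_assoc[where \<tau> = \<tau>, OF Hm Hm Hm P _ _ s, symmetric]; erule b1 b3)
  also have "\<dots> = tensor_lift P (\<lambda>a b. tensor_lift P (\<tau> a) (comul H b)) (comul H h)"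
    using tensor_lift_map[OF Hm Hm Hm HHm id c P tr \<Delta>_closed[OF h]] by (simp add: B.coassoc[OF h])
  finally show ?thesis .
qed

lemma conv_linear:
  assumes "f \<in> module_hom R H Q" "g \<in> module_hom R H Q"
  shows "conv R H f g \<in> module_hom R H Q"
  unfolding conv_def
  by (rule module_hom_comp[OF bialg_comul_linear tensor_lift_linear[OF Hm Hm Qm reg_mult_bilinear[OF R assms]]])

lemma conv_cong:
  assumes "f \<in> module_hom R H Q" "g \<in> module_hom R H Q" "f' \<in> module_hom R H Q" "g' \<in> module_hom R H Q"
    and "\<And>a. a \<in> carrier H \<Longrightarrow> f a = f' a" "\<And>a. a \<in> carrier H \<Longrightarrow> g a = g' a" "h \<in> carrier H"
  shows "conv R H f g h = conv R H f' g' h"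
  unfolding conv_def
  by (rule tensor_lift_cong[OF Hm Hm Qm reg_mult_bilinear[OF R assms(1,2)] reg_mult_bilinear[OF R assms(3,4)] _ \<Delta>_closed[OF assms(7)]])
     (simp add: assms(5,6))

lemma conv_assoc:
  assumes f: "f \<in> module_hom R H Q" and g: "g \<in> module_hom R H Q" and k: "k \<in> module_hom R H Q" and h: "h \<in> carrier H"
  shows "conv R H (conv R H f g) k h = conv R H f (conv R H g k) h"
proof -
  let ?tau = "\<lambda>a b d. f a \<otimes>\<^bsub>R\<^esub> (g b \<otimes>\<^bsub>R\<^esub> k d)"
  have mul: "(\<lambda>r. s \<otimes>\<^bsub>R\<^esub> r) \<in> module_hom R Q Q" "(\<lambda>r. r \<otimes>\<^bsub>R\<^esub> s) \<in> module_hom R Q Q" if "s \<in> carrier R" for s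
    using that by (auto intro!: module_homI simp: B.R.r_distr B.R.l_distr B.R.m_lcomm B.R.m_assoc)
  have v: "f a \<in> carrier R" "g a \<in> carrier R" "k a \<in> carrier R" if "a \<in> carrier H" for a
    using that module_homD(1)[OF f] module_homD(1)[OF g] module_homD(1)[OF k] by auto
  note gk = hom_tensor_lift[OF Hm Hm Qm Qm reg_mult_bilinear[OF R g k] mul(1)]
  note fg = hom_tensor_lift[OF Hm Hm Qm Qm reg_mult_bilinear[OF R f g] mul(2)]
  have b1: "bilinear R H H Q (?tau a)" if "a \<in> carrier H" for a
    by (rule gk(2)[OF v(1)[OF that] \<Delta>_closed[OF h]])
  have b3: "bilinear R H H Q (\<lambda>a b. ?tau a b d)" if d: "d \<in> carrier H" for d
    using reg_mult_bilinear[OF R f module_hom_comp[OF g mul(2)[OF v(3)[OF d]]]] .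
  have tr: "bilinear R H (tensor R H H) Q (\<lambda>a u. tensor_lift Q (?tau a) u)"
    by (rule trilinear_right[where \<tau> = ?tau, OF Hm Hm Hm Qm]; erule b1 b3)
  have tl: "bilinear R (tensor R H H) H Q (\<lambda>u d. tensor_lift Q (\<lambda>a b. ?tau a b d) u)"
    by (rule trilinear_left[where \<tau> = ?tau, OF Hm Hm Hm Qm]; erule b1 b3)
  have bl: "bilinear R H H Q (\<lambda>a d. tensor_lift Q (\<lambda>a b. ?tau a b d) (comul H a))"
    using bilinear_comp[OF tl bialg_comul_linear module_hom_id] .
  have br: "bilinear R H H Q (\<lambda>a b. tensor_lift Q (?tau a) (comul H b))"
    using bilinear_comp[OF tr module_hom_id bialg_comul_linear] .
  have "conv R H (conv R H f g) k h = tensor_lift Q (\<lambda>a d. tensor_lift Q (\<lambda>a b. ?tau a b d) (comul H a)) (comul H h)"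
    unfolding conv_def[of R H "conv R H f g"]
  proof (rule tensor_lift_cong[OF Hm Hm Qm reg_mult_bilinear[OF R conv_linear[OF f g] k] bl _ \<Delta>_closed[OF h]])
    fix a d assume a: "a \<in> carrier H" and d: "d \<in> carrier H"
    have "conv R H f g a \<otimes>\<^bsub>R\<^esub> k d = tensor_lift Q (\<lambda>a b. f a \<otimes>\<^bsub>R\<^esub> g b \<otimes>\<^bsub>R\<^esub> k d) (comul H a)"
      unfolding conv_def by (rule fg(1)[OF v(3)[OF d] \<Delta>_closed[OF a]])
    also have "\<dots> = tensor_lift Q (\<lambda>a b. ?tau a b d) (comul H a)"
      by (rule tensor_lift_cong[OF Hm Hm Qm fg(2)[OF v(3)[OF d] \<Delta>_closed[OF a]] b3[OF d] _ \<Delta>_closed[OF a]])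
         (simp add: B.R.m_assoc v d)
    finally show "conv R H f g a \<otimes>\<^bsub>R\<^esub> k d = tensor_lift Q (\<lambda>a b. ?tau a b d) (comul H a)" .
  qed
  also have "\<dots> = tensor_lift Q (\<lambda>a b. tensor_lift Q (?tau a) (comul H b)) (comul H h)"
    by (rule bialg_coassoc[where \<tau> = ?tau, OF Qm _ _ h]; erule b1 b3)
  also have "\<dots> = conv R H f (conv R H g k) h"
    unfolding conv_def[of R H f]
  proof (rule tensor_lift_cong[OF Hm Hm Qm br reg_mult_bilinear[OF R f conv_linear[OF g k]] _ \<Delta>_closed[OF h]])
    fix a b assume a: "a \<in> carrier H" and b: "b \<in> carrier H"
    show "tensor_lift Q (?tau a) (comul H b) = f a \<otimes>\<^bsub>R\<^esub> conv R H g k b"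
      unfolding conv_def by (rule gk(1)[OF v(1)[OF a] \<Delta>_closed[OF b], symmetric])
  qed
  finally show ?thesis .
qed

lemma counit_linear: "counit H \<in> module_hom R H Q"
  by (rule alg_homD(1)[OF B.counit_hom])

lemma conv_counit_left:
  assumes f: "f \<in> module_hom R H Q" and h: "h \<in> carrier H"
  shows "conv R H (counit H) f h = f h"
proof -
  note b = smult_right_bilinear[OF Hm counit_linear]
  note k = hom_tensor_lift[OF Hm Hm Hm Qm b f \<Delta>_closed[OF h]]
  have "conv R H (counit H) f h = tensor_lift Q (\<lambda>a b. f (counit H a \<odot>\<^bsub>H\<^esub> b)) (comul H h)"
    unfolding conv_def
    by (rule tensor_lift_cong[OF Hm Hm Qm reg_mult_bilinear[OF R counit_linear f] k(2) _ \<Delta>_closed[OF h]])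
       (use module_homD[OF f] module_homD[OF counit_linear] in simp)
  then show ?thesis using k(1) B.counit_left[OF h] by simp
qed

lemma conv_counit_right:
  assumes f: "f \<in> module_hom R H Q" and h: "h \<in> carrier H"
  shows "conv R H f (counit H) h = f h"
proof -
  note b = smult_left_bilinear[OF Hm counit_linear]
  note k = hom_tensor_lift[OF Hm Hm Hm Qm b f \<Delta>_closed[OF h]]
  have "conv R H f (counit H) h = tensor_lift Q (\<lambda>a b. f (counit H b \<odot>\<^bsub>H\<^esub> a)) (comul H h)"
    unfolding conv_def
    by (rule tensor_lift_cong[OF Hm Hm Qm reg_mult_bilinear[OF R f counit_linear] k(2) _ \<Delta>_closed[OF h]])
       (use module_homD[OF f] module_homD[OF counit_linear] in \<open>simp add: B.R.m_comm\<close>)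
  then show ?thesis using k(1) B.counit_right[OF h] by simp
qed

lemma conv_alg_hom:
  assumes f: "f \<in> alg_hom R H Q" and g: "g \<in> alg_hom R H Q"
  shows "conv R H f g \<in> alg_hom R H Q"
proof (rule alg_homI)
  note fl = alg_homD(1)[OF f] and gl = alg_homD(1)[OF g]
  note b = reg_mult_bilinear[OF R fl gl]
  show "conv R H f g \<in> module_hom R H Q" by (rule conv_linear[OF fl gl])
  have v: "f a \<in> carrier R" "g a \<in> carrier R" if "a \<in> carrier H" for a
    using that module_homD(1)[OF fl] module_homD(1)[OF gl] by auto
  show "conv R H f g (x \<otimes>\<^bsub>H\<^esub> y) = conv R H f g x \<otimes>\<^bsub>Q\<^esub> conv R H f g y" if "x \<in> carrier H" "y \<in> carrier H" for x y
    unfolding conv_def alg_homD(2)[OF B.comul_hom that]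
  proof (rule tensor_lift_mult[OF bialg_algebra bialg_algebra reg_module_algebra[OF R] b _ \<Delta>_closed[OF that(1)] \<Delta>_closed[OF that(2)]])
    fix m n m' n' assume "m \<in> carrier H" "n \<in> carrier H" "m' \<in> carrier H" "n' \<in> carrier H"
    then show "f (m \<otimes>\<^bsub>H\<^esub> m') \<otimes>\<^bsub>R\<^esub> g (n \<otimes>\<^bsub>H\<^esub> n') = (f m \<otimes>\<^bsub>R\<^esub> g n) \<otimes>\<^bsub>Q\<^esub> (f m' \<otimes>\<^bsub>R\<^esub> g n')"
      using alg_homD(2)[OF f] alg_homD(2)[OF g] v by (simp add: B.R.m_ac)
  qed
  show "conv R H f g \<one>\<^bsub>H\<^esub> = \<one>\<^bsub>Q\<^esub>"
    unfolding conv_def alg_homD(3)[OF B.comul_hom] tensor_simps(4)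
      tensor_lift_bilinear_pure[OF Hm Hm Qm b B.one_closed B.one_closed]
    using alg_homD(3)[OF f] alg_homD(3)[OF g] by simp
qed

lemma alg_points_linear: "p \<in> carrier (alg_points R H) \<Longrightarrow> p \<in> module_hom R H Q"
  by (simp add: alg_points_simps alg_hom_def)

lemma alg_points_monoid: "monoid (alg_points R H)"
proof -
  note res = alg_hom_restrict[OF bialg_algebra]
  have lin: "(\<lambda>h\<in>carrier H. conv R H f g h) \<in> module_hom R H Q"
    if "f \<in> module_hom R H Q" "g \<in> module_hom R H Q" for f g
    by (rule module_hom_cong[OF conv_linear[OF that] Hm]) simp
  have linc: "restrict (counit H) (carrier H) \<in> module_hom R H Q"
    by (rule module_hom_cong[OF counit_linear Hm]) simp
  show ?thesis
  proof (rule monoidI)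
    fix f g assume f: "f \<in> carrier (alg_points R H)" and g: "g \<in> carrier (alg_points R H)"
    show "f \<otimes>\<^bsub>alg_points R H\<^esub> g \<in> carrier (alg_points R H)"
      using f g unfolding alg_points_simps
      by (elim IntE, intro IntI restrict_extensional) (rule res[OF conv_alg_hom[of f g]]; simp)
    fix k assume k: "k \<in> carrier (alg_points R H)"
    note fl = alg_points_linear[OF f] and gl = alg_points_linear[OF g] and kl = alg_points_linear[OF k]
    show "f \<otimes>\<^bsub>alg_points R H\<^esub> g \<otimes>\<^bsub>alg_points R H\<^esub> k = f \<otimes>\<^bsub>alg_points R H\<^esub> (g \<otimes>\<^bsub>alg_points R H\<^esub> k)"
      unfolding alg_points_simps
    proof (rule restrict_ext)
      fix h assume h: "h \<in> carrier H"
      have "conv R H (\<lambda>h\<in>carrier H. conv R H f g h) k h = conv R H (conv R H f g) k h"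
        by (rule conv_cong[OF lin[OF fl gl] kl conv_linear[OF fl gl] kl _ _ h]) simp_all
      also have "\<dots> = conv R H f (conv R H g k) h" by (rule conv_assoc[OF fl gl kl h])
      also have "\<dots> = conv R H f (\<lambda>h\<in>carrier H. conv R H g k h) h"
        by (rule conv_cong[OF fl conv_linear[OF gl kl] fl lin[OF gl kl] _ _ h]) simp_all
      finally show "conv R H (\<lambda>h\<in>carrier H. conv R H f g h) k h = conv R H f (\<lambda>h\<in>carrier H. conv R H g k h) h" .
    qed
  next
    show "\<one>\<^bsub>alg_points R H\<^esub> \<in> carrier (alg_points R H)"
      unfolding alg_points_simps by (intro IntI restrict_extensional) (rule res[OF B.counit_hom]; simp)
  next
    fix f assume f: "f \<in> carrier (alg_points R H)"
    note fl = alg_points_linear[OF f]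
    have fe: "f = (\<lambda>h\<in>carrier H. f h)" using f by (simp add: alg_points_simps extensional_restrict)
    have "conv R H (restrict (counit H) (carrier H)) f h = f h" if h: "h \<in> carrier H" for h
      using conv_cong[OF linc fl counit_linear fl _ _ h] conv_counit_left[OF fl h] by simp
    then show "\<one>\<^bsub>alg_points R H\<^esub> \<otimes>\<^bsub>alg_points R H\<^esub> f = f"
      by (subst (2) fe) (auto simp: alg_points_simps intro!: restrict_ext)
    have "conv R H f (restrict (counit H) (carrier H)) h = f h" if h: "h \<in> carrier H" for h
      using conv_cong[OF fl linc fl counit_linear _ _ h] conv_counit_right[OF fl h] by simp
    then show "f \<otimes>\<^bsub>alg_points R H\<^esub> \<one>\<^bsub>alg_points R H\<^esub> = f"
      by (subst (2) fe) (auto simp: alg_points_simps intro!: restrict_ext)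
  qed
qed

text \<open>\<open>m = m \<star> \<epsilon> = m \<star> (f \<star> g) = (m \<star> f) \<star> g = r (\<epsilon> \<star> g) = r g\<close>.\<close>

lemma conv_cancel:
  assumes m: "m \<in> module_hom R H Q" and f: "f \<in> module_hom R H Q" and g: "g \<in> module_hom R H Q" and r: "r \<in> carrier R"
    and fg: "\<And>h. h \<in> carrier H \<Longrightarrow> conv R H f g h = counit H h"
    and mf: "\<And>h. h \<in> carrier H \<Longrightarrow> conv R H m f h = r \<otimes>\<^bsub>R\<^esub> counit H h"
    and h: "h \<in> carrier H"
  shows "m h = r \<otimes>\<^bsub>R\<^esub> g h"
proof -
  have rc: "(\<lambda>h. r \<otimes>\<^bsub>R\<^esub> counit H h) \<in> module_hom R H Q"
    using module_hom_scale[OF Qm counit_linear r] by simp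
  have mulr: "(\<lambda>s. r \<otimes>\<^bsub>R\<^esub> s) \<in> module_hom R Q Q"
    using r by (auto intro!: module_homI simp: B.R.r_distr B.R.m_lcomm)
  note b = reg_mult_bilinear[OF R counit_linear g]
  note k = hom_tensor_lift[OF Hm Hm Qm Qm b mulr \<Delta>_closed[OF h]]
  have v: "counit H a \<in> carrier R" "g a \<in> carrier R" if "a \<in> carrier H" for a
    using that module_homD(1)[OF counit_linear] module_homD(1)[OF g] by auto
  have "m h = conv R H m (counit H) h" by (rule conv_counit_right[OF m h, symmetric])
  also have "\<dots> = conv R H m (conv R H f g) h"
    by (rule conv_cong[OF m counit_linear m conv_linear[OF f g] _ _ h]) (simp_all add: fg)
  also have "\<dots> = conv R H (conv R H m f) g h" by (rule conv_assoc[OF m f g h, symmetric])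
  also have "\<dots> = conv R H (\<lambda>h. r \<otimes>\<^bsub>R\<^esub> counit H h) g h"
    by (rule conv_cong[OF conv_linear[OF m f] g rc g _ _ h]) (simp_all add: mf)
  also have "\<dots> = tensor_lift Q (\<lambda>a b. r \<otimes>\<^bsub>R\<^esub> (counit H a \<otimes>\<^bsub>R\<^esub> g b)) (comul H h)"
    unfolding conv_def
    by (rule tensor_lift_cong[OF Hm Hm Qm reg_mult_bilinear[OF R rc g] k(2) _ \<Delta>_closed[OF h]])
       (simp add: r v B.R.m_assoc)
  also have "\<dots> = r \<otimes>\<^bsub>R\<^esub> conv R H (counit H) g h" unfolding conv_def by (rule k(1)[symmetric])
  finally show ?thesis using conv_counit_left[OF g h] by simp
qed

text \<open>Cancellation is used once in each argument.  For fixed \<open>b\<close> let \<open>M(a) = \<Sum> g (a b\<^sub>1) f b\<^sub>2\<close>.  As \<open>f\<close> is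
multiplicative, \<open>(M \<star> f) a = (g \<star> f) (a b) = \<epsilon> a \<epsilon> b\<close>, whence \<open>M a = \<epsilon> b g a\<close>.  For fixed \<open>a\<close> this says
\<open>g (a \<cdot> _) \<star> f = g a \<epsilon>\<close>, whence \<open>g (a b) = g a g b\<close>.\<close>

lemma conv_inverse_alg_hom:
  assumes f: "f \<in> alg_hom R H Q" and g: "g \<in> module_hom R H Q"
    and fg: "\<And>h. h \<in> carrier H \<Longrightarrow> conv R H f g h = counit H h"
    and gf: "\<And>h. h \<in> carrier H \<Longrightarrow> conv R H g f h = counit H h"
  shows "g \<in> alg_hom R H Q"
proof (rule alg_homI[OF g])
  note fl = alg_homD(1)[OF f]
  have v: "f a \<in> carrier R" "g a \<in> carrier R" "counit H a \<in> carrier R" if "a \<in> carrier H" for a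
    using that module_homD(1)[OF fl] module_homD(1)[OF g] module_homD(1)[OF counit_linear] by auto
  note mulH = algebra_mult_bilinear[OF bialg_algebra]
  note T = tensor_module[OF Hm Hm]
  have gmul: "(\<lambda>b. g (a \<otimes>\<^bsub>H\<^esub> b)) \<in> module_hom R H Q" if "a \<in> carrier H" for a
    by (rule module_hom_comp[OF bilinearD(1)[OF mulH that] g])
  have gmul': "(\<lambda>a. g (a \<otimes>\<^bsub>H\<^esub> b)) \<in> module_hom R H Q" if "b \<in> carrier H" for b
    by (rule module_hom_comp[OF bilinearD(2)[OF mulH that] g])
  fix a b assume a: "a \<in> carrier H" and b: "b \<in> carrier H"
  have Mlin: "(\<lambda>a. conv R H (\<lambda>b. g (a \<otimes>\<^bsub>H\<^esub> b)) f b) \<in> module_hom R H Q" if b: "b \<in> carrier H" for b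
    unfolding conv_def
  proof (rule tensor_lift_param_hom[OF Hm Hm Hm Qm reg_mult_bilinear[OF R gmul fl] _ \<Delta>_closed[OF b]])
    fix k l assume k: "k \<in> carrier H" and l: "l \<in> carrier H"
    have "(\<lambda>r. r \<otimes>\<^bsub>R\<^esub> f l) \<in> module_hom R Q Q"
      using v(1)[OF l] by (auto intro!: module_homI simp: B.R.l_distr B.R.m_assoc)
    from module_hom_comp[OF gmul'[OF k] this]
    show "(\<lambda>x. g (x \<otimes>\<^bsub>H\<^esub> k) \<otimes>\<^bsub>R\<^esub> f l) \<in> module_hom R H Q" .
  qed
  have M: "conv R H (\<lambda>b. g (a \<otimes>\<^bsub>H\<^esub> b)) f b = counit H b \<otimes>\<^bsub>R\<^esub> g a" if a: "a \<in> carrier H" and b: "b \<in> carrier H" for a b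
  proof (rule conv_cancel[OF Mlin[OF b] fl g v(3)[OF b] fg _ a])
    fix a assume a: "a \<in> carrier H"
    let ?\<beta> = "\<lambda>m n. g m \<otimes>\<^bsub>R\<^esub> f n"
    note bgf = reg_mult_bilinear[OF R g fl]
    have inner: "tensor_lift Q ?\<beta> (tensor_lift (tensor R H H) (\<lambda>m' n'. pure_tensor R H H (m \<otimes>\<^bsub>H\<^esub> m') (n \<otimes>\<^bsub>H\<^esub> n')) (comul H b)) =
        conv R H (\<lambda>b. g (m \<otimes>\<^bsub>H\<^esub> b)) f b \<otimes>\<^bsub>R\<^esub> f n" if m: "m \<in> carrier H" and n: "n \<in> carrier H" for m n
    proof -
      have mulr: "(\<lambda>r. r \<otimes>\<^bsub>R\<^esub> f n) \<in> module_hom R Q Q"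
        using v(1)[OF n] by (auto intro!: module_homI simp: B.R.l_distr B.R.m_assoc)
      note k1 = hom_tensor_lift[OF Hm Hm T Qm pure_mult_bilinear[OF bialg_algebra bialg_algebra m n] tensor_lift_linear[OF Hm Hm Qm bgf] \<Delta>_closed[OF b]]
      note k2 = hom_tensor_lift[OF Hm Hm Qm Qm reg_mult_bilinear[OF R gmul[OF m] fl] mulr \<Delta>_closed[OF b]]
      show ?thesis
        unfolding k1(1) conv_def k2(1)
      proof (rule tensor_lift_cong[OF Hm Hm Qm k1(2) k2(2) _ \<Delta>_closed[OF b]])
        fix m' n' assume m': "m' \<in> carrier H" and n': "n' \<in> carrier H"
        show "tensor_lift Q ?\<beta> (pure_tensor R H H (m \<otimes>\<^bsub>H\<^esub> m') (n \<otimes>\<^bsub>H\<^esub> n')) = g (m \<otimes>\<^bsub>H\<^esub> m') \<otimes>\<^bsub>R\<^esub> f n' \<otimes>\<^bsub>R\<^esub> f n"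
          unfolding tensor_lift_bilinear_pure[OF Hm Hm Qm bgf B.m_closed[OF m m'] B.m_closed[OF n n']]
          using alg_homD(2)[OF f n n'] v(1)[OF n] v(1)[OF n'] v(2)[OF B.m_closed[OF m m']] by (simp add: B.R.m_ac)
      qed
    qed
    note lm = hom_tensor_lift[OF Hm Hm T Qm lift_mult_bilinear[OF bialg_algebra bialg_algebra \<Delta>_closed[OF b]] tensor_lift_linear[OF Hm Hm Qm bgf] \<Delta>_closed[OF a]]
    have "conv R H (\<lambda>a. conv R H (\<lambda>b. g (a \<otimes>\<^bsub>H\<^esub> b)) f b) f a = tensor_lift Q ?\<beta> (comul H a \<otimes>\<^bsub>tensor R H H\<^esub> comul H b)"
      unfolding tensor_mult_eq[OF bialg_algebra bialg_algebra \<Delta>_closed[OF a] \<Delta>_closed[OF b]] lm(1)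
      unfolding conv_def[of R H "\<lambda>a. conv R H (\<lambda>b. g (a \<otimes>\<^bsub>H\<^esub> b)) f b"]
      by (rule tensor_lift_cong[OF Hm Hm Qm reg_mult_bilinear[OF R Mlin[OF b] fl] lm(2) _ \<Delta>_closed[OF a]])
         (rule inner[symmetric])
    also have "\<dots> = conv R H g f (a \<otimes>\<^bsub>H\<^esub> b)" unfolding conv_def alg_homD(2)[OF B.comul_hom a b] ..
    also have "\<dots> = counit H b \<otimes>\<^bsub>R\<^esub> counit H a"
      using gf[OF B.m_closed[OF a b]] alg_homD(2)[OF B.counit_hom a b] v(3)[OF a] v(3)[OF b] by (simp add: B.R.m_comm)
    finally show "conv R H (\<lambda>a. conv R H (\<lambda>b. g (a \<otimes>\<^bsub>H\<^esub> b)) f b) f a = counit H b \<otimes>\<^bsub>R\<^esub> counit H a" .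
  qed
  show "g (a \<otimes>\<^bsub>H\<^esub> b) = g a \<otimes>\<^bsub>Q\<^esub> g b"
    using conv_cancel[OF gmul[OF a] fl g v(2)[OF a] fg _ b] M[OF a] v(2)[OF a] v(3) by (simp add: B.R.m_comm)
next
  have "conv R H f g \<one>\<^bsub>H\<^esub> = f \<one>\<^bsub>H\<^esub> \<otimes>\<^bsub>R\<^esub> g \<one>\<^bsub>H\<^esub>"
    unfolding conv_def alg_homD(3)[OF B.comul_hom] tensor_simps(4)
    by (rule tensor_lift_bilinear_pure[OF Hm Hm Qm reg_mult_bilinear[OF R alg_homD(1)[OF f] g] B.one_closed B.one_closed])
  then show "g \<one>\<^bsub>H\<^esub> = \<one>\<^bsub>Q\<^esub>"
    using fg[OF B.one_closed] alg_homD(3)[OF f] alg_homD(3)[OF B.counit_hom] module_homD(1)[OF g B.one_closed] by simp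
qed

end

context
  fixes R :: "('a, 'r) ring_scheme" and H :: "('a, 'h, 'z) hopf_scheme"
  assumes Hopf: "comm_hopf_algebra R H"
begin

interpretation B: comm_hopf_algebra R H by (fact Hopf)

lemma hopf_bialg: "comm_bialgebra R H" by (rule B.comm_bialgebra_axioms)

private lemma Qm': "module R (reg_module R)" by (rule reg_module_module[OF B.R.is_cring])

lemma conv_antipode:
  assumes f: "f \<in> alg_hom R H (reg_module R)" and h: "h \<in> carrier H"
  shows "conv R H (\<lambda>h. f (antipode H h)) f h = counit H h"
    and "conv R H f (\<lambda>h. f (antipode H h)) h = counit H h"
proof -
  note fl = alg_homD(1)[OF f] and S = B.antipode_linear and Hm = B.module_axioms
  note fS = module_hom_comp[OF S fl]
  note mul = algebra_mult_bilinear[OF B.algebra_axioms]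
  have c: "comul H h \<in> carrier (tensor R H H)" by (rule module_homD(1)[OF bialg_comul_linear[OF hopf_bialg] h])
  have e: "counit H h \<in> carrier R" using module_homD(1)[OF counit_linear[OF hopf_bialg] h] by simp
  have fe: "f (counit H h \<odot>\<^bsub>H\<^esub> \<one>\<^bsub>H\<^esub>) = counit H h"
    using module_homD(3)[OF fl e B.one_closed] alg_homD(3)[OF f] e by simp
  note k = hom_tensor_lift[OF Hm Hm Hm Qm' bilinear_comp[OF mul S module_hom_id] fl c]
  have "conv R H (\<lambda>h. f (antipode H h)) f h = f (tensor_lift H (\<lambda>a b. antipode H a \<otimes>\<^bsub>H\<^esub> b) (comul H h))"
    unfolding conv_def k(1)
    by (rule tensor_lift_cong[OF Hm Hm Qm' reg_mult_bilinear[OF B.R.is_cring fS fl] k(2) _ c])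
       (simp add: alg_homD(2)[OF f] module_homD(1)[OF S])
  then show "conv R H (\<lambda>h. f (antipode H h)) f h = counit H h" using B.antipode_left[OF h] fe by simp
  note k = hom_tensor_lift[OF Hm Hm Hm Qm' bilinear_comp[OF mul module_hom_id S] fl c]
  have "conv R H f (\<lambda>h. f (antipode H h)) h = f (tensor_lift H (\<lambda>a b. a \<otimes>\<^bsub>H\<^esub> antipode H b) (comul H h))"
    unfolding conv_def k(1)
    by (rule tensor_lift_cong[OF Hm Hm Qm' reg_mult_bilinear[OF B.R.is_cring fl fS] k(2) _ c])
       (simp add: alg_homD(2)[OF f] module_homD(1)[OF S])
  then show "conv R H f (\<lambda>h. f (antipode H h)) h = counit H h" using B.antipode_right[OF h] fe by simp
qed

text \<open>The antipode of a Hopf algebra is only assumed to be linear, so that \<open>p \<circ> S\<close> is a point has to be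
deduced from its being a convolution inverse of \<open>p\<close>.\<close>

lemma alg_points_inverse:
  assumes p: "p \<in> carrier (alg_points R H)"
  shows "(\<lambda>h\<in>carrier H. p (antipode H h)) \<in> carrier (alg_points R H)" (is "?p' \<in> _")
    and "(\<lambda>h\<in>carrier H. p (antipode H h)) \<otimes>\<^bsub>alg_points R H\<^esub> p = \<one>\<^bsub>alg_points R H\<^esub>"
proof -
  have f: "p \<in> alg_hom R H (reg_module R)" using p by (simp add: alg_points_simps)
  note fl = alg_homD(1)[OF f]
  note pS = module_hom_comp[OF B.antipode_linear fl]
  have lin: "?p' \<in> module_hom R H (reg_module R)" by (rule module_hom_cong[OF pS B.module_axioms]) simp
  have pS': "(\<lambda>h. p (antipode H h)) \<in> alg_hom R H (reg_module R)"
    by (rule conv_inverse_alg_hom[OF hopf_bialg f pS conv_antipode(2)[OF f] conv_antipode(1)[OF f]])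
  show "?p' \<in> carrier (alg_points R H)"
    unfolding alg_points_simps by (intro IntI restrict_extensional) (rule alg_hom_restrict[OF B.algebra_axioms pS']; simp)
  show "?p' \<otimes>\<^bsub>alg_points R H\<^esub> p = \<one>\<^bsub>alg_points R H\<^esub>"
    unfolding alg_points_simps
  proof (rule restrict_ext)
    fix h assume h: "h \<in> carrier H"
    have "conv R H ?p' p h = conv R H (\<lambda>h. p (antipode H h)) p h"
      by (rule conv_cong[OF hopf_bialg lin fl pS fl _ _ h]) simp_all
    then show "conv R H ?p' p h = counit H h" using conv_antipode(1)[OF f h] by simp
  qed
qed

lemma alg_points_group: "group (alg_points R H)"
  by (rule monoid.group_l_invI[OF alg_points_monoid[OF hopf_bialg]]) (use alg_points_inverse in blast)

end

section \<open>The two functors\<close>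

lemma mon_homD:
  assumes "\<phi> \<in> mon_hom G K"
  shows "\<And>x. x \<in> carrier G \<Longrightarrow> \<phi> x \<in> carrier K"
    "\<And>x y. \<lbrakk>x \<in> carrier G; y \<in> carrier G\<rbrakk> \<Longrightarrow> \<phi> (x \<otimes>\<^bsub>G\<^esub> y) = \<phi> x \<otimes>\<^bsub>K\<^esub> \<phi> y"
    "\<phi> \<one>\<^bsub>G\<^esub> = \<one>\<^bsub>K\<^esub>" "\<phi> \<in> extensional (carrier G)"
  using assms by (auto simp: mon_hom_def hom_def)

lemma mon_homI:
  assumes "\<And>x. x \<in> carrier G \<Longrightarrow> \<phi> x \<in> carrier K"
    "\<And>x y. \<lbrakk>x \<in> carrier G; y \<in> carrier G\<rbrakk> \<Longrightarrow> \<phi> (x \<otimes>\<^bsub>G\<^esub> y) = \<phi> x \<otimes>\<^bsub>K\<^esub> \<phi> y"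
    "\<phi> \<one>\<^bsub>G\<^esub> = \<one>\<^bsub>K\<^esub>" "\<phi> \<in> extensional (carrier G)"
  shows "\<phi> \<in> mon_hom G K"
  using assms by (auto simp: mon_hom_def hom_def)

lemma grp_hom_eq_mon_hom:
  assumes "group G" "group K"
  shows "grp_hom G K = mon_hom G K"
  using hom_one[OF _ assms] unfolding grp_hom_def mon_hom_def by blast

lemma bialg_homD:
  assumes "\<alpha> \<in> bialg_hom R H K"
  shows "\<alpha> \<in> alg_hom R H K" "\<alpha> \<in> module_hom R H K" "\<alpha> \<in> extensional (carrier H)"
    "\<And>h. h \<in> carrier H \<Longrightarrow> \<alpha> h \<in> carrier K"
    "\<And>h. h \<in> carrier H \<Longrightarrow> comul K (\<alpha> h) = tensor_map R K K \<alpha> \<alpha> (comul H h)"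
    "\<And>h. h \<in> carrier H \<Longrightarrow> counit K (\<alpha> h) = counit H h"
  using assms by (auto simp: bialg_hom_def alg_hom_def module_hom_def)

lemma bialg_homI:
  assumes "\<alpha> \<in> alg_hom R H K" "\<alpha> \<in> extensional (carrier H)"
    "\<And>h. h \<in> carrier H \<Longrightarrow> comul K (\<alpha> h) = tensor_map R K K \<alpha> \<alpha> (comul H h)"
    "\<And>h. h \<in> carrier H \<Longrightarrow> counit K (\<alpha> h) = counit H h"
  shows "\<alpha> \<in> bialg_hom R H K"
  using assms by (simp add: bialg_hom_def)

lemma rep_functions_compose:
  fixes G1 :: "('g, 'x) monoid_scheme" and G2 :: "('k, 'y) monoid_scheme"
  assumes R: "cring R" and noeth: "noetherian_ring R" and G1: "monoid G1" and G2: "monoid G2"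
    and \<phi>: "\<phi> \<in> mon_hom G1 G2" and f: "f \<in> rep_functions R G2"
  shows "compose (carrier G1) f \<phi> \<in> rep_functions R G1"
proof -
  interpret R: cring R by fact
  interpret G1: monoid G1 by fact
  interpret V1: algebra R "fun_algebra R G1" by (rule fun_algebra_algebra[OF R])
  interpret V2: algebra R "fun_algebra R G2" by (rule fun_algebra_algebra[OF R])
  note \<phi>D = mon_homD[OF \<phi>]
  let ?c = "\<lambda>f. compose (carrier G1) f \<phi>"
  have c: "?c \<in> module_hom R (fun_algebra R G2) (fun_algebra R G1)"
    using \<phi>D(1) by (intro module_homI) (auto simp: compose_def intro!: restrict_ext)
  obtain F where F: "f \<in> carrier (fun_algebra R G2)" "finite F" "F \<subseteq> carrier (fun_algebra R G2)"
    and tr: "\<forall>g \<in> carrier G2. \<forall>g' \<in> carrier G2. translate G2 g g' f \<in> module_span R (fun_algebra R G2) F"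
    using rep_functionsD[OF R noeth G2 f] by (elim exE conjE)
  have cF: "?c ` F \<subseteq> carrier (fun_algebra R G1)" using module_homD(1)[OF c] F(3) by blast
  have sp: "?c m \<in> module_span R (fun_algebra R G1) (?c ` F)" if "m \<in> module_span R (fun_algebra R G2) F" for m
    by (rule module_hom_span[OF V2.module_axioms V1.module_axioms c F(3) that])
  show ?thesis
  proof (rule rep_functionsI[OF R noeth G1 module_homD(1)[OF c F(1)] finite_imageI[OF F(2)] cF])
    fix g g' assume g: "g \<in> carrier G1" "g' \<in> carrier G1"
    have "translate G1 g g' (?c f) = ?c (translate G2 (\<phi> g) (\<phi> g') f)"
      using g \<phi>D(1,2) by (auto simp: translate_def compose_def intro!: restrict_ext)
    then show "translate G1 g g' (?c f) \<in> module_span R (fun_algebra R G1) (?c ` F)"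
      using sp[OF tr[rule_format, OF \<phi>D(1)[OF g(1)] \<phi>D(1)[OF g(2)]]] by simp
  qed
qed

text \<open>Compatibility with the comultiplications is checked on values, where it is \<open>f (\<phi> x \<phi> y) = f (\<phi> (x y))\<close>.\<close>

lemma rep_map_bialg_hom:
  fixes G1 :: "('g, 'x) monoid_scheme" and G2 :: "('k, 'y) monoid_scheme"
  assumes R: "cring R" and noeth: "noetherian_ring R" and her: "hereditary_ring R" and G1: "monoid G1" and G2: "monoid G2"
    and \<phi>: "\<phi> \<in> mon_hom G1 G2" and K1: "K1 = rep_coalg R G1 z1" and K2: "K2 = rep_coalg R G2 z2"
  shows "rep_map R G1 G2 \<phi> \<in> bialg_hom R K2 K1"
proof -
  interpret R: cring R by fact
  interpret G1: monoid G1 by fact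
  note c1 = R noeth her G1 K1 and c2 = R noeth her G2 K2
  note \<phi>D = mon_homD[OF \<phi>]
  let ?\<alpha> = "rep_map R G1 G2 \<phi>"
  note s1 = repf_simps[OF c1] and s2 = repf_simps[OF c2]
  interpret K2: algebra R K2 by (rule repf_algebra[OF c2])
  have cl: "?\<alpha> f \<in> carrier K1" if "f \<in> carrier K2" for f
    using rep_functions_compose[OF R noeth G1 G2 \<phi>] that by (simp add: rep_map_def s1 s2)
  have ap: "?\<alpha> f x = f (\<phi> x)" if "f \<in> carrier K2" "x \<in> carrier G1" for f x
    using that by (simp add: rep_map_def s2 compose_def)
  note eqI = repf_eqI[OF c1]
  have lin: "?\<alpha> \<in> module_hom R K2 K1"
  proof (rule module_homI)
    fix f f' assume f: "f \<in> carrier K2" "f' \<in> carrier K2"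
    note ff = K2.M.a_closed[OF f]
    have "(?\<alpha> f \<oplus>\<^bsub>K1\<^esub> ?\<alpha> f') \<in> carrier K1"
      using abelian_groupE(1)[OF module.axioms(2)[OF repf_module[OF c1]] cl[OF f(1)] cl[OF f(2)]] .
    then show "?\<alpha> (f \<oplus>\<^bsub>K2\<^esub> f') = ?\<alpha> f \<oplus>\<^bsub>K1\<^esub> ?\<alpha> f'"
    proof (intro eqI[OF cl[OF ff]])
      fix x assume x: "x \<in> carrier G1"
      show "?\<alpha> (f \<oplus>\<^bsub>K2\<^esub> f') x = (?\<alpha> f \<oplus>\<^bsub>K1\<^esub> ?\<alpha> f') x"
        unfolding ap[OF ff x] using ap[OF f(1) x] ap[OF f(2) x] x \<phi>D(1)[OF x] by (simp add: s1 s2)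
    qed
  next
    fix r f assume r: "r \<in> carrier R" and f: "f \<in> carrier K2"
    note ff = K2.smult_closed[OF r f]
    have "(r \<odot>\<^bsub>K1\<^esub> ?\<alpha> f) \<in> carrier K1"
      using module.smult_closed[OF repf_module[OF c1] r cl[OF f]] .
    then show "?\<alpha> (r \<odot>\<^bsub>K2\<^esub> f) = r \<odot>\<^bsub>K1\<^esub> ?\<alpha> f"
    proof (intro eqI[OF cl[OF ff]])
      fix x assume x: "x \<in> carrier G1"
      show "?\<alpha> (r \<odot>\<^bsub>K2\<^esub> f) x = (r \<odot>\<^bsub>K1\<^esub> ?\<alpha> f) x"
        unfolding ap[OF ff x] using ap[OF f x] x \<phi>D(1)[OF x] by (simp add: s1 s2)
    qed
  qed (rule cl)
  have alg: "?\<alpha> \<in> alg_hom R K2 K1"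
  proof (rule alg_homI[OF lin])
    interpret K1: algebra R K1 by (rule repf_algebra[OF c1])
    fix f f' assume f: "f \<in> carrier K2" "f' \<in> carrier K2"
    note ff = K2.m_closed[OF f]
    show "?\<alpha> (f \<otimes>\<^bsub>K2\<^esub> f') = ?\<alpha> f \<otimes>\<^bsub>K1\<^esub> ?\<alpha> f'"
    proof (rule eqI[OF cl[OF ff] K1.m_closed[OF cl[OF f(1)] cl[OF f(2)]]])
      fix x assume x: "x \<in> carrier G1"
      show "?\<alpha> (f \<otimes>\<^bsub>K2\<^esub> f') x = (?\<alpha> f \<otimes>\<^bsub>K1\<^esub> ?\<alpha> f') x"
        unfolding ap[OF ff x] using ap[OF f(1) x] ap[OF f(2) x] x \<phi>D(1)[OF x] by (simp add: s1 s2)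
    qed
  next
    interpret K1: algebra R K1 by (rule repf_algebra[OF c1])
    show "?\<alpha> \<one>\<^bsub>K2\<^esub> = \<one>\<^bsub>K1\<^esub>"
    proof (rule eqI[OF cl[OF K2.one_closed] K1.one_closed])
      fix x assume x: "x \<in> carrier G1"
      show "?\<alpha> \<one>\<^bsub>K2\<^esub> x = \<one>\<^bsub>K1\<^esub> x"
        unfolding ap[OF K2.one_closed x] using x \<phi>D(1)[OF x] by (simp add: s1 s2)
    qed
  qed
  show ?thesis
  proof (rule bialg_homI[OF alg])
    show "?\<alpha> \<in> extensional (carrier K2)" by (simp add: rep_map_def s2)
    fix f assume f: "f \<in> carrier K2"
    show "counit K1 (?\<alpha> f) = counit K2 f"
      using ap[OF f G1.one_closed] \<phi>D(3) by (simp add: s1 s2)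
    note m2 = repf_module[OF c2] and m1 = repf_module[OF c1] and Q = base_module[OF c1]
    note sp = repf_comul_spec[OF c2 f]
    show "comul K1 (?\<alpha> f) = tensor_map R K1 K1 ?\<alpha> ?\<alpha> (comul K2 f)"
    proof (rule repf_comul_eqI[OF c1 cl[OF f] module_homD(1)[OF tensor_map_linear[OF m2 m2 m1 m1 lin lin] sp(1)]])
      fix x y assume xy: "x \<in> carrier G1" "y \<in> carrier G1"
      note b1 = repf_eval2_bilinear[OF c1 xy] and b2 = repf_eval2_bilinear[OF c2 \<phi>D(1)[OF xy(1)] \<phi>D(1)[OF xy(2)]]
      have "eval2 R x y (tensor_map R K1 K1 ?\<alpha> ?\<alpha> (comul K2 f)) =
        tensor_lift (reg_module R) (\<lambda>a b. ?\<alpha> a x \<otimes>\<^bsub>R\<^esub> ?\<alpha> b y) (comul K2 f)"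
        by (rule tensor_lift_map[OF m2 m2 m1 m1 lin lin Q b1 sp(1)])
      also have "\<dots> = eval2 R (\<phi> x) (\<phi> y) (comul K2 f)"
        by (rule tensor_lift_cong[OF m2 m2 Q bilinear_comp[OF b1 lin lin] b2 _ sp(1)]) (simp add: ap xy)
      also have "\<dots> = f (\<phi> x \<otimes>\<^bsub>G2\<^esub> \<phi> y)" by (rule sp(2)[OF \<phi>D(1)[OF xy(1)] \<phi>D(1)[OF xy(2)]])
      finally show "eval2 R x y (tensor_map R K1 K1 ?\<alpha> ?\<alpha> (comul K2 f)) = ?\<alpha> f (x \<otimes>\<^bsub>G1\<^esub> y)"
        using ap[OF f G1.m_closed[OF xy]] \<phi>D(2)[OF xy] by simp
    qed
  qed
qed

lemma rep_map_hopf_hom: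
  fixes G1 :: "('g, 'x) monoid_scheme" and G2 :: "('k, 'y) monoid_scheme"
  assumes R: "cring R" and noeth: "noetherian_ring R" and her: "hereditary_ring R" and G1: "group G1" and G2: "group G2"
    and \<phi>: "\<phi> \<in> grp_hom G1 G2"
  shows "rep_map R G1 G2 \<phi> \<in> hopf_hom R (rep_hopf R G2) (rep_hopf R G1)"
proof -
  interpret G1: group G1 by fact
  interpret G2: group G2 by fact
  have \<phi>m: "\<phi> \<in> mon_hom G1 G2" using \<phi> grp_hom_eq_mon_hom[OF G1 G2] by blast
  interpret h: group_hom G1 G2 \<phi>
    using \<phi> by unfold_locales (simp add: grp_hom_def)
  note ctx = R noeth her G2.monoid_axioms rep_hopf_eq
  interpret K: comm_hopf_algebra R "rep_hopf R G2" by (rule rep_hopf_comm_hopf_algebra[OF R noeth her G2])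
  have S: "antipode (rep_hopf R G) f = (\<lambda>x\<in>carrier G. f (inv\<^bsub>G\<^esub> x))" for f and G :: "('l, 'w) monoid_scheme"
    by (simp add: rep_hopf_def bialg.defs)
  have c: "carrier (rep_hopf R G2) = rep_functions R G2" by (simp add: rep_hopf_eq rep_coalg_simps)
  have "rep_map R G1 G2 \<phi> (antipode (rep_hopf R G2) f) = antipode (rep_hopf R G1) (rep_map R G1 G2 \<phi> f)"
    if f: "f \<in> carrier (rep_hopf R G2)" for f
    using module_homD(1)[OF K.antipode_linear f] f
    by (auto simp: rep_map_def c S compose_def intro!: restrict_ext)
  then show ?thesis
    using rep_map_bialg_hom[OF R noeth her G1.monoid_axioms G2.monoid_axioms \<phi>m rep_hopf_eq rep_hopf_eq]
    by (simp add: hopf_hom_def)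
qed

lemma rep_map_id: "rep_map R G G (\<lambda>x\<in>carrier G. x) = (\<lambda>f\<in>rep_functions R G. f)"
proof -
  have "compose (carrier G) f (\<lambda>x\<in>carrier G. x) = f" if "f \<in> rep_functions R G" for f
  proof -
    have "f \<in> extensional (carrier G)" using that by (auto simp: rep_functions_def PiE_def)
    then show ?thesis by (rule extensionalityI[OF compose_extensional]) (simp add: compose_def)
  qed
  then show ?thesis unfolding rep_map_def by (intro restrict_ext)
qed

lemma rep_map_comp:
  assumes R: "cring R" and noeth: "noetherian_ring R" and G: "monoid G2" "monoid G3"
    and \<phi>: "\<phi> \<in> mon_hom G1 G2" and \<psi>: "\<psi> \<in> mon_hom G2 G3"
  shows "rep_map R G1 G3 (compose (carrier G1) \<psi> \<phi>) =
    compose (rep_functions R G3) (rep_map R G1 G2 \<phi>) (rep_map R G2 G3 \<psi>)"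
  unfolding compose_def[of "rep_functions R G3"] rep_map_def[of R G1 G3]
proof (rule restrict_ext)
  fix f assume f: "f \<in> rep_functions R G3"
  have "compose (carrier G2) f \<psi> \<in> rep_functions R G2"
    by (rule rep_functions_compose[OF R noeth G \<psi> f])
  then show "compose (carrier G1) f (compose (carrier G1) \<psi> \<phi>) = rep_map R G1 G2 \<phi> (rep_map R G2 G3 \<psi> f)"
    using f mon_homD(1)[OF \<phi>] by (auto simp: rep_map_def compose_def intro!: restrict_ext)
qed

lemma alg_points_map_point:
  assumes H1: "comm_bialgebra R H1" and H2: "comm_bialgebra R H2" and \<alpha>: "\<alpha> \<in> bialg_hom R H1 H2"
    and p: "p \<in> carrier (alg_points R H2)"
  shows "alg_points_map R H1 H2 \<alpha> p \<in> carrier (alg_points R H1)"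
    and "\<And>h. h \<in> carrier H1 \<Longrightarrow> alg_points_map R H1 H2 \<alpha> p h = p (\<alpha> h)"
proof -
  interpret H1: comm_bialgebra R H1 by fact
  note \<alpha>D = bialg_homD[OF \<alpha>]
  show ap: "\<And>h. h \<in> carrier H1 \<Longrightarrow> alg_points_map R H1 H2 \<alpha> p h = p (\<alpha> h)"
    using p by (simp add: alg_points_map_def compose_def)
  have pa: "p \<in> alg_hom R H2 (reg_module R)" using p by (simp add: alg_points_simps)
  have "(\<lambda>h. p (\<alpha> h)) \<in> alg_hom R H1 (reg_module R)"
    using alg_homD(2,3)[OF pa] alg_homD(2,3)[OF \<alpha>D(1)] \<alpha>D(4)
    by (intro alg_homI module_hom_comp[OF \<alpha>D(2) alg_homD(1)[OF pa]]) simp_all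
  then have "alg_points_map R H1 H2 \<alpha> p \<in> alg_hom R H1 (reg_module R)"
    by (rule alg_hom_restrict[OF H1.algebra_axioms]) (rule ap)
  moreover have "alg_points_map R H1 H2 \<alpha> p \<in> extensional (carrier H1)"
    using p by (simp add: alg_points_map_def compose_def)
  ultimately show "alg_points_map R H1 H2 \<alpha> p \<in> carrier (alg_points R H1)" by (simp add: alg_points_simps)
qed

lemma alg_points_map_hom:
  assumes H1: "comm_bialgebra R H1" and H2: "comm_bialgebra R H2" and \<alpha>: "\<alpha> \<in> bialg_hom R H1 H2"
  shows "alg_points_map R H1 H2 \<alpha> \<in> mon_hom (alg_points R H2) (alg_points R H1)"
proof (rule mon_homI)
  interpret H1: comm_bialgebra R H1 by fact
  interpret H2: comm_bialgebra R H2 by fact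
  interpret P2: monoid "alg_points R H2" by (rule alg_points_monoid[OF H2])
  interpret P1: monoid "alg_points R H1" by (rule alg_points_monoid[OF H1])
  note \<alpha>D = bialg_homD[OF \<alpha>]
  let ?A = "alg_points_map R H1 H2 \<alpha>"
  note cl = alg_points_map_point(1)[OF assms] and ap = alg_points_map_point(2)[OF assms]
  show "\<And>p. p \<in> carrier (alg_points R H2) \<Longrightarrow> ?A p \<in> carrier (alg_points R H1)" by (rule cl)
  show "?A \<in> extensional (carrier (alg_points R H2))" by (simp add: alg_points_map_def)
  have eqI: "p = q" if "p \<in> carrier (alg_points R H1)" "q \<in> carrier (alg_points R H1)" "\<And>h. h \<in> carrier H1 \<Longrightarrow> p h = q h" for p q
    using that by (auto simp: alg_points_simps intro: extensionalityI)
  fix p q assume p: "p \<in> carrier (alg_points R H2)" and q: "q \<in> carrier (alg_points R H2)"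
  note pl = alg_points_linear[OF H2 p] and ql = alg_points_linear[OF H2 q]
  note pq = P2.m_closed[OF p q]
  note m1 = H1.module_axioms and m2 = H2.module_axioms and Q = reg_module_module[OF H1.R.is_cring]
  show "?A (p \<otimes>\<^bsub>alg_points R H2\<^esub> q) = ?A p \<otimes>\<^bsub>alg_points R H1\<^esub> ?A q"
  proof (rule eqI[OF cl[OF pq] P1.m_closed[OF cl[OF p] cl[OF q]]])
    fix h assume h: "h \<in> carrier H1"
    have c: "comul H1 h \<in> carrier (tensor R H1 H1)" by (rule module_homD(1)[OF bialg_comul_linear[OF H1] h])
    note b = reg_mult_bilinear[OF H1.R.is_cring pl ql]
    have "?A (p \<otimes>\<^bsub>alg_points R H2\<^esub> q) h = conv R H2 p q (\<alpha> h)"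
      using ap[OF pq h] \<alpha>D(4)[OF h] by (simp add: alg_points_simps)
    also have "\<dots> = tensor_lift (reg_module R) (\<lambda>a b. p (\<alpha> a) \<otimes>\<^bsub>R\<^esub> q (\<alpha> b)) (comul H1 h)"
      unfolding conv_def \<alpha>D(5)[OF h] by (rule tensor_lift_map[OF m1 m1 m2 m2 \<alpha>D(2) \<alpha>D(2) Q b c])
    also have "\<dots> = conv R H1 (?A p) (?A q) h"
      unfolding conv_def
      by (rule tensor_lift_cong[OF m1 m1 Q bilinear_comp[OF b \<alpha>D(2) \<alpha>D(2)]
            reg_mult_bilinear[OF H1.R.is_cring alg_points_linear[OF H1 cl[OF p]] alg_points_linear[OF H1 cl[OF q]]] _ c])
         (simp add: ap p q)
    finally show "?A (p \<otimes>\<^bsub>alg_points R H2\<^esub> q) h = (?A p \<otimes>\<^bsub>alg_points R H1\<^esub> ?A q) h"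
      using h by (simp add: alg_points_simps)
  qed
next
  interpret P2: monoid "alg_points R H2" by (rule alg_points_monoid[OF H2])
  interpret P1: monoid "alg_points R H1" by (rule alg_points_monoid[OF H1])
  note \<alpha>D = bialg_homD[OF \<alpha>]
  show "alg_points_map R H1 H2 \<alpha> \<one>\<^bsub>alg_points R H2\<^esub> = \<one>\<^bsub>alg_points R H1\<^esub>"
  proof (rule extensionalityI)
    show "alg_points_map R H1 H2 \<alpha> \<one>\<^bsub>alg_points R H2\<^esub> \<in> extensional (carrier H1)"
      using alg_points_map_point(1)[OF assms P2.one_closed] by (simp add: alg_points_simps)
    show "\<one>\<^bsub>alg_points R H1\<^esub> \<in> extensional (carrier H1)" by (simp add: alg_points_simps)
    fix h assume h: "h \<in> carrier H1"
    show "alg_points_map R H1 H2 \<alpha> \<one>\<^bsub>alg_points R H2\<^esub> h = \<one>\<^bsub>alg_points R H1\<^esub> h"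
      unfolding alg_points_map_point(2)[OF assms P2.one_closed h] using \<alpha>D(4,6) h by (simp add: alg_points_simps)
  qed
qed

lemma alg_points_map_id: "alg_points_map R H H (\<lambda>h\<in>carrier H. h) = (\<lambda>p\<in>carrier (alg_points R H). p)"
  unfolding alg_points_map_def
proof (rule restrict_ext)
  fix p assume "p \<in> carrier (alg_points R H)"
  then have "p \<in> extensional (carrier H)" by (simp add: alg_points_simps)
  then show "compose (carrier H) p (\<lambda>h\<in>carrier H. h) = p"
    by (rule extensionalityI[OF compose_extensional[of "carrier H" p]]) (simp add: compose_def)
qed

lemma alg_points_map_comp:
  assumes H2: "comm_bialgebra R H2" and H3: "comm_bialgebra R H3"
    and \<alpha>: "\<alpha> \<in> bialg_hom R H1 H2" and \<beta>: "\<beta> \<in> bialg_hom R H2 H3"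
  shows "alg_points_map R H1 H3 (compose (carrier H1) \<beta> \<alpha>) =
    compose (carrier (alg_points R H3)) (alg_points_map R H1 H2 \<alpha>) (alg_points_map R H2 H3 \<beta>)"
  unfolding compose_def[of "carrier (alg_points R H3)"] alg_points_map_def[of R H1 H3]
proof (rule restrict_ext)
  fix p assume p: "p \<in> carrier (alg_points R H3)"
  note q = alg_points_map_point[OF H2 H3 \<beta> p]
  show "compose (carrier H1) p (compose (carrier H1) \<beta> \<alpha>) = alg_points_map R H1 H2 \<alpha> (alg_points_map R H2 H3 \<beta> p)"
    using q bialg_homD(4)[OF \<alpha>] by (simp add: alg_points_map_def[of R H1 H2] compose_def cong: restrict_cong)
qed

section \<open>The adjunction\<close>

lemma transpose_apply:
  "\<lbrakk>h \<in> carrier H; g \<in> carrier G\<rbrakk> \<Longrightarrow> transpose_hom G H \<phi> h g = \<phi> g h"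
  by (simp add: transpose_hom_def)

text \<open>The index \<open>i\<close> varies over an arbitrary set, but the finite set \<open>F\<close> is the same for all \<open>i\<close>.  This
uniformity is what bounds all translates of a function at once.\<close>

lemma tensor_lift_finite_span:
  fixes \<beta> :: "'i \<Rightarrow> 'g \<Rightarrow> 'm \<Rightarrow> 'n \<Rightarrow> 'a" and G :: "('g, 'x) monoid_scheme"
  assumes R: "cring R" and M: "module R M" and N: "module R N"
    and bil: "\<And>i x. \<lbrakk>i \<in> I; x \<in> carrier G\<rbrakk> \<Longrightarrow> bilinear R M N (reg_module R) (\<beta> i x)"
    and pure: "\<And>m n. \<lbrakk>m \<in> carrier M; n \<in> carrier N\<rbrakk> \<Longrightarrow> \<exists>F. finite F \<and> F \<subseteq> carrier (fun_algebra R G) \<and>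
      (\<forall>i \<in> I. (\<lambda>x\<in>carrier G. \<beta> i x m n) \<in> module_span R (fun_algebra R G) F)"
    and t: "t \<in> carrier (tensor R M N)"
  shows "\<exists>F. finite F \<and> F \<subseteq> carrier (fun_algebra R G) \<and>
    (\<forall>i \<in> I. (\<lambda>x\<in>carrier G. tensor_lift (reg_module R) (\<beta> i x) t) \<in> module_span R (fun_algebra R G) F)"
  using t
proof (induction rule: tensor_induct[OF M N, consumes 1, case_names pure add])
  case (pure m n)
  obtain F where F: "finite F" "F \<subseteq> carrier (fun_algebra R G)"
    and Fi: "\<forall>i \<in> I. (\<lambda>x\<in>carrier G. \<beta> i x m n) \<in> module_span R (fun_algebra R G) F"
    using assms(5)[OF pure] by (elim exE conjE)
  have eq: "(\<lambda>x\<in>carrier G. tensor_lift (reg_module R) (\<beta> i x) (pure_tensor R M N m n)) = (\<lambda>x\<in>carrier G. \<beta> i x m n)"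
    if "i \<in> I" for i
    by (rule restrict_ext) (rule tensor_lift_bilinear_pure[OF M N reg_module_module[OF R] bil[OF that] pure])
  show ?case
  proof (intro exI[of _ F] conjI ballI F)
    fix i assume i: "i \<in> I"
    show "(\<lambda>x\<in>carrier G. tensor_lift (reg_module R) (\<beta> i x) (pure_tensor R M N m n)) \<in> module_span R (fun_algebra R G) F"
      unfolding eq[OF i] using Fi i by blast
  qed
next
  case (add s t)
  let ?V = "fun_algebra R G" and ?f = "\<lambda>i t. \<lambda>x\<in>carrier G. tensor_lift (reg_module R) (\<beta> i x) t"
  interpret V: module R ?V by (rule fun_algebra_module[OF R])
  obtain A where A: "finite A" "A \<subseteq> carrier ?V" and As: "\<forall>i \<in> I. ?f i s \<in> module_span R ?V A"
    using add(3) by (elim exE conjE)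
  obtain C where C: "finite C" "C \<subseteq> carrier ?V" and Ct: "\<forall>i \<in> I. ?f i t \<in> module_span R ?V C"
    using add(4) by (elim exE conjE)
  have AC: "A \<union> C \<subseteq> carrier ?V" using A C by blast
  show ?case
  proof (intro exI[of _ "A \<union> C"] conjI ballI AC)
    fix i assume i: "i \<in> I"
    have "?f i (s \<oplus>\<^bsub>tensor R M N\<^esub> t) = ?f i s \<oplus>\<^bsub>?V\<^esub> ?f i t"
      using module_homD(2)[OF tensor_lift_linear[OF M N reg_module_module[OF R] bil[OF i]] add(1,2)]
      by (auto intro!: restrict_ext)
    moreover have "?f i s \<oplus>\<^bsub>?V\<^esub> ?f i t \<in> module_span R ?V (A \<union> C)"
      using As Ct i V.span_mono[of A "A \<union> C"] V.span_mono[of C "A \<union> C"] by (intro V.span_add[OF AC]) blast+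
    ultimately show "?f i (s \<oplus>\<^bsub>tensor R M N\<^esub> t) \<in> module_span R ?V (A \<union> C)" by simp
  qed (use A C in simp)
qed

text \<open>The translate of the transposed function by \<open>g\<close>, \<open>g'\<close> is
\<open>x \<mapsto> (\<phi> g \<star> \<phi> x \<star> \<phi> g') h = \<Sum> \<phi> g h\<^sub>1 \<phi> x h\<^sub>2 \<phi> g' h\<^sub>3\<close>.  It is a combination of the functions
\<open>x \<mapsto> \<phi> x h\<^sub>2\<close>, finitely many for all \<open>g\<close> and \<open>g'\<close> together.\<close>

lemma transpose_rep_function:
  fixes G :: "('g, 'x) monoid_scheme" and H :: "('a, 'h, 'z) bialg_scheme"
  assumes noeth: "noetherian_ring R" and G: "monoid G" and H: "comm_bialgebra R H"
    and \<phi>: "\<phi> \<in> mon_hom G (alg_points R H)" and h: "h \<in> carrier H"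
  shows "transpose_hom G H \<phi> h \<in> rep_functions R G"
proof -
  interpret B: comm_bialgebra R H by fact
  interpret G: monoid G by fact
  let ?V = "fun_algebra R G" and ?Q = "reg_module R" and ?\<alpha> = "transpose_hom G H \<phi>"
  have R: "cring R" by (rule B.R.is_cring)
  interpret V: algebra R ?V by (rule fun_algebra_algebra[OF R])
  note \<phi>D = mon_homD[OF \<phi>]
  note Hm = B.module_axioms and Q = reg_module_module[OF R]
  have lin: "\<phi> g \<in> module_hom R H ?Q" if "g \<in> carrier G" for g
    by (rule alg_points_linear[OF H \<phi>D(1)[OF that]])
  have \<alpha>V: "?\<alpha> a \<in> carrier ?V" if "a \<in> carrier H" for a
    using module_homD(1)[OF lin] that by (auto simp: transpose_hom_def)
  \<comment> \<open>First the factor \<open>v\<close> on the right, then a factor on the left; both range over all functionals.\<close>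
  have one: "\<exists>F. finite F \<and> F \<subseteq> carrier ?V \<and> (\<forall>v \<in> module_hom R H ?Q.
      (\<lambda>x\<in>carrier G. conv R H (\<phi> x) v c) \<in> module_span R ?V F)" if c: "c \<in> carrier H" for c
    unfolding conv_def
  proof (rule tensor_lift_finite_span[OF R Hm Hm reg_mult_bilinear[OF R lin] _ module_homD(1)[OF bialg_comul_linear[OF H] c]])
    fix a b assume a: "a \<in> carrier H" and b: "b \<in> carrier H"
    have F: "{?\<alpha> a} \<subseteq> carrier ?V" using \<alpha>V[OF a] by blast
    have "(\<lambda>x\<in>carrier G. \<phi> x a \<otimes>\<^bsub>R\<^esub> v b) \<in> module_span R ?V {?\<alpha> a}" if v: "v \<in> module_hom R H ?Q" for v
    proof -
      have vb: "v b \<in> carrier R" using module_homD(1)[OF v b] by simp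
      have "v b \<odot>\<^bsub>?V\<^esub> ?\<alpha> a \<in> module_span R ?V {?\<alpha> a}"
        using V.span_superset[of "{?\<alpha> a}"] by (intro V.span_smult[OF F vb]) blast
      also have "v b \<odot>\<^bsub>?V\<^esub> ?\<alpha> a = (\<lambda>x\<in>carrier G. \<phi> x a \<otimes>\<^bsub>R\<^esub> v b)"
        using module_homD(1)[OF lin a] vb by (auto simp: transpose_apply[OF a] B.R.m_comm intro!: restrict_ext)
      finally show ?thesis .
    qed
    then show "\<exists>F. finite F \<and> F \<subseteq> carrier ?V \<and> (\<forall>v \<in> module_hom R H ?Q. (\<lambda>x\<in>carrier G. \<phi> x a \<otimes>\<^bsub>R\<^esub> v b) \<in> module_span R ?V F)"
      using F by (intro exI[of _ "{?\<alpha> a}"]) blast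
  qed
  have two: "\<exists>F. finite F \<and> F \<subseteq> carrier ?V \<and> (\<forall>p \<in> module_hom R H ?Q \<times> module_hom R H ?Q.
      (\<lambda>x\<in>carrier G. conv R H (fst p) (conv R H (\<phi> x) (snd p)) h) \<in> module_span R ?V F)"
    unfolding conv_def[where f = "fst p" for p :: "('h \<Rightarrow> 'a) \<times> ('h \<Rightarrow> 'a)"]
  proof (rule tensor_lift_finite_span[OF R Hm Hm _ _ module_homD(1)[OF bialg_comul_linear[OF H] h]])
    fix p x assume "p \<in> module_hom R H ?Q \<times> module_hom R H ?Q" "x \<in> carrier G"
    then show "bilinear R H H ?Q (\<lambda>a c. fst p a \<otimes>\<^bsub>R\<^esub> conv R H (\<phi> x) (snd p) c)"
      by (intro reg_mult_bilinear[OF R] conv_linear[OF H lin]) auto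
  next
    fix a c assume a: "a \<in> carrier H" and c: "c \<in> carrier H"
    obtain F where F: "finite F" "F \<subseteq> carrier ?V" and Fv: "\<forall>v \<in> module_hom R H ?Q.
      (\<lambda>x\<in>carrier G. conv R H (\<phi> x) v c) \<in> module_span R ?V F"
      using one[OF c] by (elim exE conjE)
    have "(\<lambda>x\<in>carrier G. u a \<otimes>\<^bsub>R\<^esub> conv R H (\<phi> x) v c) \<in> module_span R ?V F"
      if u: "u \<in> module_hom R H ?Q" and v: "v \<in> module_hom R H ?Q" for u v
    proof -
      have "u a \<odot>\<^bsub>?V\<^esub> (\<lambda>x\<in>carrier G. conv R H (\<phi> x) v c) \<in> module_span R ?V F"
        using V.span_smult[OF F(2) _ Fv[rule_format, OF v]] module_homD(1)[OF u a] by (simp del: fun_algebra_simps)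
      also have "u a \<odot>\<^bsub>?V\<^esub> (\<lambda>x\<in>carrier G. conv R H (\<phi> x) v c) = (\<lambda>x\<in>carrier G. u a \<otimes>\<^bsub>R\<^esub> conv R H (\<phi> x) v c)"
        by (auto intro!: restrict_ext)
      finally show ?thesis .
    qed
    then show "\<exists>F. finite F \<and> F \<subseteq> carrier ?V \<and> (\<forall>p \<in> module_hom R H ?Q \<times> module_hom R H ?Q.
      (\<lambda>x\<in>carrier G. fst p a \<otimes>\<^bsub>R\<^esub> conv R H (\<phi> x) (snd p) c) \<in> module_span R ?V F)"
      using F by (intro exI[of _ F]) auto
  qed
  obtain F where F: "finite F" "F \<subseteq> carrier ?V" and Fp: "\<forall>p \<in> module_hom R H ?Q \<times> module_hom R H ?Q.
      (\<lambda>x\<in>carrier G. conv R H (fst p) (conv R H (\<phi> x) (snd p)) h) \<in> module_span R ?V F"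
    using two by (elim exE conjE)
  show ?thesis
  proof (rule rep_functionsI[OF R noeth G \<alpha>V[OF h] F])
    fix g g' assume g: "g \<in> carrier G" and g': "g' \<in> carrier G"
    have "translate G g g' (?\<alpha> h) = (\<lambda>x\<in>carrier G. conv R H (\<phi> g) (conv R H (\<phi> x) (\<phi> g')) h)"
      unfolding translate_def
    proof (rule restrict_ext)
      fix x assume x: "x \<in> carrier G"
      have gx: "g \<otimes>\<^bsub>G\<^esub> x \<in> carrier G" using g x by simp
      have c: "conv R H (\<phi> g) (\<phi> x) a = \<phi> (g \<otimes>\<^bsub>G\<^esub> x) a" if "a \<in> carrier H" for a
        using \<phi>D(2)[OF g x] that by (simp add: alg_points_simps)
      have "?\<alpha> h (g \<otimes>\<^bsub>G\<^esub> x \<otimes>\<^bsub>G\<^esub> g') = conv R H (\<phi> (g \<otimes>\<^bsub>G\<^esub> x)) (\<phi> g') h"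
        using transpose_apply[where \<phi> = \<phi>, OF h G.m_closed[OF gx g']] \<phi>D(2)[OF gx g'] h by (simp add: alg_points_simps)
      also have "\<dots> = conv R H (conv R H (\<phi> g) (\<phi> x)) (\<phi> g') h"
        by (rule conv_cong[OF H lin[OF gx] lin[OF g'] conv_linear[OF H lin[OF g] lin[OF x]] lin[OF g'] _ _ h]) (simp_all add: c)
      also have "\<dots> = conv R H (\<phi> g) (conv R H (\<phi> x) (\<phi> g')) h"
        by (rule conv_assoc[OF H lin[OF g] lin[OF x] lin[OF g'] h])
      finally show "?\<alpha> h (g \<otimes>\<^bsub>G\<^esub> x \<otimes>\<^bsub>G\<^esub> g') = conv R H (\<phi> g) (conv R H (\<phi> x) (\<phi> g')) h" .
    qed
    also have "\<dots> \<in> module_span R ?V F"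
      using Fp[rule_format, of "(\<phi> g, \<phi> g')"] lin[OF g] lin[OF g'] by simp
    finally show "translate G g g' (?\<alpha> h) \<in> module_span R ?V F" .
  qed
qed

text \<open>The comultiplication of a representative function is determined by its values, and both sides of
the comultiplication law have the value \<open>\<phi> (x y) h = (\<phi> x \<star> \<phi> y) h\<close> at \<open>(x, y)\<close>.\<close>

lemma transpose_bialg_hom:
  fixes G :: "('g, 'x) monoid_scheme" and H :: "('a, 'h, 'z) bialg_scheme"
  assumes R: "cring R" and noeth: "noetherian_ring R" and her: "hereditary_ring R" and G: "monoid G" and H: "comm_bialgebra R H"
    and K: "K = rep_coalg R G w" and \<phi>: "\<phi> \<in> mon_hom G (alg_points R H)"
  shows "transpose_hom G H \<phi> \<in> bialg_hom R H K"
proof -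
  interpret B: comm_bialgebra R H by fact
  interpret G: monoid G by fact
  note ctx = R noeth her G K
  let ?Q = "reg_module R" and ?\<alpha> = "transpose_hom G H \<phi>"
  note \<phi>D = mon_homD[OF \<phi>] and s = repf_simps[OF ctx]
  note Hm = B.module_axioms and Q = reg_module_module[OF R] and Km = repf_module[OF ctx]
  interpret K: algebra R K by (rule repf_algebra[OF ctx])
  have alg: "\<phi> g \<in> alg_hom R H ?Q" if "g \<in> carrier G" for g
    using \<phi>D(1)[OF that] by (simp add: alg_points_simps)
  have cl: "?\<alpha> h \<in> carrier K" if "h \<in> carrier H" for h
    unfolding s by (rule transpose_rep_function[OF noeth G H \<phi> that])
  note eqI = repf_eqI[OF ctx] and ap = transpose_apply
  have lin: "?\<alpha> \<in> module_hom R H K"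
  proof (rule module_homI)
    fix h k assume hk: "h \<in> carrier H" "k \<in> carrier H"
    show "?\<alpha> (h \<oplus>\<^bsub>H\<^esub> k) = ?\<alpha> h \<oplus>\<^bsub>K\<^esub> ?\<alpha> k"
    proof (rule eqI[OF cl[OF B.M.a_closed[OF hk]] K.M.a_closed[OF cl[OF hk(1)] cl[OF hk(2)]]])
      fix x assume x: "x \<in> carrier G"
      show "?\<alpha> (h \<oplus>\<^bsub>H\<^esub> k) x = (?\<alpha> h \<oplus>\<^bsub>K\<^esub> ?\<alpha> k) x"
        using module_homD(2)[OF alg_homD(1)[OF alg[OF x]] hk] x hk by (simp add: s ap)
    qed
  next
    fix r h assume r: "r \<in> carrier R" and h: "h \<in> carrier H"
    show "?\<alpha> (r \<odot>\<^bsub>H\<^esub> h) = r \<odot>\<^bsub>K\<^esub> ?\<alpha> h"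
    proof (rule eqI[OF cl[OF B.smult_closed[OF r h]] K.smult_closed[OF r cl[OF h]]])
      fix x assume x: "x \<in> carrier G"
      show "?\<alpha> (r \<odot>\<^bsub>H\<^esub> h) x = (r \<odot>\<^bsub>K\<^esub> ?\<alpha> h) x"
        using module_homD(3)[OF alg_homD(1)[OF alg[OF x]] r h] x h r by (simp add: s ap)
    qed
  qed (rule cl)
  show ?thesis
  proof (rule bialg_homI[OF alg_homI[OF lin]])
    fix h k assume hk: "h \<in> carrier H" "k \<in> carrier H"
    show "?\<alpha> (h \<otimes>\<^bsub>H\<^esub> k) = ?\<alpha> h \<otimes>\<^bsub>K\<^esub> ?\<alpha> k"
    proof (rule eqI[OF cl[OF B.m_closed[OF hk]] K.m_closed[OF cl[OF hk(1)] cl[OF hk(2)]]])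
      fix x assume x: "x \<in> carrier G"
      show "?\<alpha> (h \<otimes>\<^bsub>H\<^esub> k) x = (?\<alpha> h \<otimes>\<^bsub>K\<^esub> ?\<alpha> k) x"
        using alg_homD(2)[OF alg[OF x] hk] x hk by (simp add: s ap)
    qed
  next
    show "?\<alpha> \<one>\<^bsub>H\<^esub> = \<one>\<^bsub>K\<^esub>"
    proof (rule eqI[OF cl[OF B.one_closed] K.one_closed])
      fix x assume x: "x \<in> carrier G"
      show "?\<alpha> \<one>\<^bsub>H\<^esub> x = \<one>\<^bsub>K\<^esub> x"
        using alg_homD(3)[OF alg[OF x]] x by (simp add: s ap)
    qed
  next
    show "?\<alpha> \<in> extensional (carrier H)" by (simp add: transpose_hom_def)
  next
    fix h assume h: "h \<in> carrier H"
    show "counit K (?\<alpha> h) = counit H h"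
      using ap[where \<phi> = \<phi>, OF h G.one_closed] \<phi>D(3) h by (simp add: s alg_points_simps)
    have c: "comul H h \<in> carrier (tensor R H H)" by (rule module_homD(1)[OF bialg_comul_linear[OF H] h])
    show "comul K (?\<alpha> h) = tensor_map R K K ?\<alpha> ?\<alpha> (comul H h)"
    proof (rule repf_comul_eqI[OF ctx cl[OF h] module_homD(1)[OF tensor_map_linear[OF Hm Hm Km Km lin lin] c]])
      fix x y assume xy: "x \<in> carrier G" "y \<in> carrier G"
      note b = repf_eval2_bilinear[OF ctx xy]
      have "eval2 R x y (tensor_map R K K ?\<alpha> ?\<alpha> (comul H h)) =
        tensor_lift ?Q (\<lambda>a b. ?\<alpha> a x \<otimes>\<^bsub>R\<^esub> ?\<alpha> b y) (comul H h)"
        by (rule tensor_lift_map[OF Hm Hm Km Km lin lin Q b c])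
      also have "\<dots> = conv R H (\<phi> x) (\<phi> y) h"
        unfolding conv_def
        by (rule tensor_lift_cong[OF Hm Hm Q bilinear_comp[OF b lin lin]
              reg_mult_bilinear[OF R alg_homD(1)[OF alg[OF xy(1)]] alg_homD(1)[OF alg[OF xy(2)]]] _ c])
           (simp add: ap xy)
      finally show "eval2 R x y (tensor_map R K K ?\<alpha> ?\<alpha> (comul H h)) = ?\<alpha> h (x \<otimes>\<^bsub>G\<^esub> y)"
        using ap[where \<phi> = \<phi>, OF h G.m_closed[OF xy]] \<phi>D(2)[OF xy] h by (simp add: alg_points_simps)
    qed
  qed
qed

text \<open>Evaluation at \<open>x y\<close> is evaluation of the comultiplication at \<open>(x, y)\<close>; since \<open>\<alpha>\<close> preserves
comultiplications, it becomes the convolution of the evaluations at \<open>x\<close> and \<open>y\<close>.\<close>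

lemma untranspose_mon_hom:
  fixes G :: "('g, 'x) monoid_scheme" and H :: "('a, 'h, 'z) bialg_scheme"
  assumes R: "cring R" and noeth: "noetherian_ring R" and her: "hereditary_ring R" and G: "monoid G" and H: "comm_bialgebra R H"
    and K: "K = rep_coalg R G w" and \<alpha>: "\<alpha> \<in> bialg_hom R H K"
  shows "(\<lambda>g\<in>carrier G. \<lambda>h\<in>carrier H. \<alpha> h g) \<in> mon_hom G (alg_points R H)" (is "?\<phi> \<in> _")
proof -
  interpret B: comm_bialgebra R H by fact
  interpret G: monoid G by fact
  note ctx = R noeth her G K
  let ?Q = "reg_module R"
  note \<alpha>D = bialg_homD[OF \<alpha>] and s = repf_simps[OF ctx]
  note Hm = B.module_axioms and Q = reg_module_module[OF R] and Km = repf_module[OF ctx]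
  have ev: "(\<lambda>h. \<alpha> h x) \<in> alg_hom R H ?Q" if x: "x \<in> carrier G" for x
    using alg_homD(2,3)[OF \<alpha>D(1)] x
    by (intro alg_homI module_hom_comp[OF \<alpha>D(2) repf_eval_linear[OF ctx x]]) (simp_all add: s)
  have pt: "(\<lambda>h\<in>carrier H. \<alpha> h x) \<in> alg_hom R H ?Q" if x: "x \<in> carrier G" for x
    by (rule alg_hom_restrict[OF B.algebra_axioms ev[OF x]]) simp
  show ?thesis
  proof (rule mon_homI)
    show "\<And>x. x \<in> carrier G \<Longrightarrow> ?\<phi> x \<in> carrier (alg_points R H)" using pt by (simp add: alg_points_simps)
    show "?\<phi> \<in> extensional (carrier G)" by simp
    show "?\<phi> \<one>\<^bsub>G\<^esub> = \<one>\<^bsub>alg_points R H\<^esub>"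
      using \<alpha>D(6) by (auto simp: alg_points_simps s intro!: restrict_ext)
    fix x y assume xy: "x \<in> carrier G" "y \<in> carrier G"
    have "\<alpha> h (x \<otimes>\<^bsub>G\<^esub> y) = conv R H (\<lambda>h\<in>carrier H. \<alpha> h x) (\<lambda>h\<in>carrier H. \<alpha> h y) h" if h: "h \<in> carrier H" for h
    proof -
      note b = repf_eval2_bilinear[OF ctx xy]
      have c: "comul H h \<in> carrier (tensor R H H)" by (rule module_homD(1)[OF bialg_comul_linear[OF H] h])
      have "\<alpha> h (x \<otimes>\<^bsub>G\<^esub> y) = eval2 R x y (tensor_map R K K \<alpha> \<alpha> (comul H h))"
        using repf_comul_spec(2)[OF ctx \<alpha>D(4)[OF h] xy] \<alpha>D(5)[OF h] by simp
      also have "\<dots> = tensor_lift ?Q (\<lambda>a b. \<alpha> a x \<otimes>\<^bsub>R\<^esub> \<alpha> b y) (comul H h)"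
        by (rule tensor_lift_map[OF Hm Hm Km Km \<alpha>D(2) \<alpha>D(2) Q b c])
      also have "\<dots> = conv R H (\<lambda>h\<in>carrier H. \<alpha> h x) (\<lambda>h\<in>carrier H. \<alpha> h y) h"
        unfolding conv_def
        by (rule tensor_lift_cong[OF Hm Hm Q bilinear_comp[OF b \<alpha>D(2) \<alpha>D(2)]
              reg_mult_bilinear[OF R alg_homD(1)[OF pt[OF xy(1)]] alg_homD(1)[OF pt[OF xy(2)]]] _ c]) simp
      finally show ?thesis .
    qed
    then show "?\<phi> (x \<otimes>\<^bsub>G\<^esub> y) = ?\<phi> x \<otimes>\<^bsub>alg_points R H\<^esub> ?\<phi> y"
      using xy by (auto simp: alg_points_simps intro!: restrict_ext)
  qed
qed

lemma untranspose_transpose: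
  assumes "\<phi> \<in> mon_hom G (alg_points R H)"
  shows "(\<lambda>g\<in>carrier G. \<lambda>h\<in>carrier H. transpose_hom G H \<phi> h g) = \<phi>"
proof (rule extensionalityI[OF _ mon_homD(4)[OF assms]])
  fix g assume g: "g \<in> carrier G"
  have "\<phi> g \<in> extensional (carrier H)" using mon_homD(1)[OF assms g] by (simp add: alg_points_simps)
  then have "(\<lambda>h\<in>carrier H. transpose_hom G H \<phi> h g) = \<phi> g"
    by (intro extensionalityI[of _ "carrier H"]) (auto simp: transpose_apply g)
  then show "(\<lambda>g\<in>carrier G. \<lambda>h\<in>carrier H. transpose_hom G H \<phi> h g) g = \<phi> g" using g by simp
qed simp

lemma transpose_untranspose:
  assumes "\<alpha> \<in> extensional (carrier H)" "\<And>h. h \<in> carrier H \<Longrightarrow> \<alpha> h \<in> extensional (carrier G)"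
  shows "transpose_hom G H (\<lambda>g\<in>carrier G. \<lambda>h\<in>carrier H. \<alpha> h g) = \<alpha>"
proof (rule extensionalityI[OF _ assms(1)])
  fix h assume h: "h \<in> carrier H"
  show "transpose_hom G H (\<lambda>g\<in>carrier G. \<lambda>h\<in>carrier H. \<alpha> h g) h = \<alpha> h"
    by (rule extensionalityI[OF _ assms(2)[OF h]]) (auto simp: transpose_hom_def h)
qed (simp add: transpose_hom_def)

lemma transpose_bij_bialg:
  fixes G :: "('g, 'x) monoid_scheme" and H :: "('a, 'h, 'z) bialg_scheme"
  assumes R: "cring R" and noeth: "noetherian_ring R" and her: "hereditary_ring R" and G: "monoid G" and H: "comm_bialgebra R H"
    and K: "K = rep_coalg R G w"
  shows "bij_betw (transpose_hom G H) (mon_hom G (alg_points R H)) (bialg_hom R H K)"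
proof (rule bij_betw_byWitness[where f' = "\<lambda>\<alpha>. \<lambda>g\<in>carrier G. \<lambda>h\<in>carrier H. \<alpha> h g"])
  show "\<forall>\<phi>\<in>mon_hom G (alg_points R H). (\<lambda>g\<in>carrier G. \<lambda>h\<in>carrier H. transpose_hom G H \<phi> h g) = \<phi>"
    using untranspose_transpose by blast
  show "transpose_hom G H ` mon_hom G (alg_points R H) \<subseteq> bialg_hom R H K"
    using transpose_bialg_hom[OF assms] by blast
  show "(\<lambda>\<alpha>. \<lambda>g\<in>carrier G. \<lambda>h\<in>carrier H. \<alpha> h g) ` bialg_hom R H K \<subseteq> mon_hom G (alg_points R H)"
    using untranspose_mon_hom[OF assms] by blast
  show "\<forall>\<alpha>\<in>bialg_hom R H K. transpose_hom G H (\<lambda>g\<in>carrier G. \<lambda>h\<in>carrier H. \<alpha> h g) = \<alpha>"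
  proof
    fix \<alpha> assume \<alpha>: "\<alpha> \<in> bialg_hom R H K"
    have "\<alpha> h \<in> extensional (carrier G)" if "h \<in> carrier H" for h
      using repf_closed[OF R noeth her G K bialg_homD(4)[OF \<alpha> that]] by (auto simp: PiE_def)
    then show "transpose_hom G H (\<lambda>g\<in>carrier G. \<lambda>h\<in>carrier H. \<alpha> h g) = \<alpha>"
      by (rule transpose_untranspose[OF bialg_homD(3)[OF \<alpha>]])
  qed
qed

text \<open>Beyond the case of bialgebras, only the antipode has to be considered, and transposes respect it
automatically: \<open>\<phi> (g\<^sup>-\<^sup>1)\<close> is the inverse point \<open>\<phi> g \<circ> S\<close>.\<close>

lemma transpose_bij_hopf:
  fixes G :: "('g, 'x) monoid_scheme" and H :: "('a, 'h, 'z) hopf_scheme"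
  assumes R: "cring R" and noeth: "noetherian_ring R" and her: "hereditary_ring R" and G: "group G" and H: "comm_hopf_algebra R H"
  shows "bij_betw (transpose_hom G H) (grp_hom G (alg_points R H)) (hopf_hom R H (rep_hopf R G))"
proof -
  interpret G: group G by fact
  interpret B: comm_hopf_algebra R H by fact
  note Hb = hopf_bialg[OF H]
  have gm: "grp_hom G (alg_points R H) = mon_hom G (alg_points R H)"
    by (rule grp_hom_eq_mon_hom[OF G alg_points_group[OF H]])
  note bij = transpose_bij_bialg[OF R noeth her G.monoid_axioms Hb rep_hopf_eq]
  have "transpose_hom G H \<phi> \<in> hopf_hom R H (rep_hopf R G)" if \<phi>: "\<phi> \<in> mon_hom G (alg_points R H)" for \<phi>
  proof -
    interpret P: group "alg_points R H" by (rule alg_points_group[OF H])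
    note \<phi>D = mon_homD[OF \<phi>]
    interpret h: group_hom G "alg_points R H" \<phi>
      using \<phi> by unfold_locales (simp add: mon_hom_def)
    have inv: "\<phi> (inv\<^bsub>G\<^esub> g) = (\<lambda>h\<in>carrier H. \<phi> g (antipode H h))" if g: "g \<in> carrier G" for g
    proof -
      note i = alg_points_inverse[OF H \<phi>D(1)[OF g]]
      show ?thesis using P.inv_equality[OF i(2) \<phi>D(1)[OF g] i(1)] h.hom_inv[OF g] by simp
    qed
    have "transpose_hom G H \<phi> (antipode H h) = antipode (rep_hopf R G) (transpose_hom G H \<phi> h)" if h: "h \<in> carrier H" for h
    proof -
      have Sh: "antipode H h \<in> carrier H" by (rule module_homD(1)[OF B.antipode_linear h])
      have "\<phi> g (antipode H h) = \<phi> (inv\<^bsub>G\<^esub> g) h" if "g \<in> carrier G" for g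
        using inv[OF that] h by simp
      then show ?thesis using h Sh
        by (auto simp: rep_hopf_def bialg.defs transpose_hom_def intro!: restrict_ext)
    qed
    then show ?thesis
      using transpose_bialg_hom[OF R noeth her G.monoid_axioms Hb rep_hopf_eq \<phi>] by (simp add: hopf_hom_def)
  qed
  then have sub: "transpose_hom G H ` mon_hom G (alg_points R H) \<subseteq> hopf_hom R H (rep_hopf R G)" by blast
  have "hopf_hom R H (rep_hopf R G) \<subseteq> bialg_hom R H (rep_hopf R G)" by (auto simp: hopf_hom_def)
  then have "transpose_hom G H ` mon_hom G (alg_points R H) = hopf_hom R H (rep_hopf R G)"
    using sub bij by (auto simp: bij_betw_def)
  then show ?thesis using bij unfolding gm by (simp add: bij_betw_def)
qed

lemma transpose_natural_left:
  assumes R: "cring R" and noeth: "noetherian_ring R" and G2: "monoid G2" and H: "comm_bialgebra R H"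
    and \<psi>: "\<psi> \<in> mon_hom G1 G2" and \<phi>: "\<phi> \<in> mon_hom G2 (alg_points R H)"
  shows "transpose_hom G1 H (compose (carrier G1) \<phi> \<psi>) =
    compose (carrier H) (rep_map R G1 G2 \<psi>) (transpose_hom G2 H \<phi>)"
proof -
  have "(\<lambda>g\<in>carrier G1. compose (carrier G1) \<phi> \<psi> g h) = rep_map R G1 G2 \<psi> (transpose_hom G2 H \<phi> h)"
    if h: "h \<in> carrier H" for h
    using transpose_rep_function[OF noeth G2 H \<phi> h] mon_homD(1)[OF \<psi>] h
    by (auto simp: rep_map_def compose_def transpose_hom_def intro!: restrict_ext)
  then show ?thesis
    unfolding compose_def[of "carrier H"] transpose_hom_def[of G1] by (intro restrict_ext)
qed

lemma transpose_natural_right: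
  assumes H1: "comm_bialgebra R H1" and H2: "comm_bialgebra R H2"
    and \<alpha>: "\<alpha> \<in> bialg_hom R H1 H2" and \<phi>: "\<phi> \<in> mon_hom G (alg_points R H2)"
  shows "transpose_hom G H1 (compose (carrier G) (alg_points_map R H1 H2 \<alpha>) \<phi>) =
    compose (carrier H1) (transpose_hom G H2 \<phi>) \<alpha>"
proof -
  have "(\<lambda>g\<in>carrier G. compose (carrier G) (alg_points_map R H1 H2 \<alpha>) \<phi> g h) = transpose_hom G H2 \<phi> (\<alpha> h)"
    if h: "h \<in> carrier H1" for h
    using alg_points_map_point(2)[OF H1 H2 \<alpha> mon_homD(1)[OF \<phi>] h] bialg_homD(4)[OF \<alpha> h]
    by (auto simp: compose_def transpose_hom_def intro!: restrict_ext)
  then show ?thesis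
    unfolding compose_def[of "carrier H1"] transpose_hom_def[of G H1] by (intro restrict_ext)
qed

lemma rep_carriers:
  "carrier (rep_bialg R G) = rep_functions R G" "carrier (rep_hopf R G) = rep_functions R G"
  by (simp_all add: rep_bialg_eq rep_hopf_eq rep_coalg_simps)

theorem theorem6p10:
  fixes R :: "('a, 'r) ring_scheme"
  assumes "cring R" and "noetherian_ring R" and "hereditary_ring R"
  shows
    "((\<forall>G :: 'g1 monoid. monoid G \<longrightarrow>
          (\<forall>f \<in> carrier (rep_bialg R G). \<exists>!t. is_rep_comul R G f t) \<and> comm_bialgebra R (rep_bialg R G))
     \<and> (\<forall>(G1 :: 'g1 monoid) (G2 :: 'g2 monoid) \<phi>.
          monoid G1 \<and> monoid G2 \<and> \<phi> \<in> mon_hom G1 G2 \<longrightarrow>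
          rep_map R G1 G2 \<phi> \<in> bialg_hom R (rep_bialg R G2) (rep_bialg R G1))
     \<and> (\<forall>G :: 'g1 monoid. monoid G \<longrightarrow>
          rep_map R G G (\<lambda>x\<in>carrier G. x) = (\<lambda>f\<in>carrier (rep_bialg R G). f))
     \<and> (\<forall>(G1 :: 'g1 monoid) (G2 :: 'g2 monoid) (G3 :: 'g3 monoid) \<phi> \<psi>.
          monoid G1 \<and> monoid G2 \<and> monoid G3 \<and> \<phi> \<in> mon_hom G1 G2 \<and> \<psi> \<in> mon_hom G2 G3 \<longrightarrow>
          rep_map R G1 G3 (compose (carrier G1) \<psi> \<phi>) =
          compose (carrier (rep_bialg R G3)) (rep_map R G1 G2 \<phi>) (rep_map R G2 G3 \<psi>))
     \<and> (\<forall>H :: ('a, 'h1) bialg. comm_bialgebra R H \<longrightarrow> monoid (alg_points R H))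
     \<and> (\<forall>(H1 :: ('a, 'h1) bialg) (H2 :: ('a, 'h2) bialg) \<alpha>.
          comm_bialgebra R H1 \<and> comm_bialgebra R H2 \<and> \<alpha> \<in> bialg_hom R H1 H2 \<longrightarrow>
          alg_points_map R H1 H2 \<alpha> \<in> mon_hom (alg_points R H2) (alg_points R H1))
     \<and> (\<forall>H :: ('a, 'h1) bialg. comm_bialgebra R H \<longrightarrow>
          alg_points_map R H H (\<lambda>h\<in>carrier H. h) = (\<lambda>p\<in>carrier (alg_points R H). p))
     \<and> (\<forall>(H1 :: ('a, 'h1) bialg) (H2 :: ('a, 'h2) bialg) (H3 :: ('a, 'h3) bialg) \<alpha> \<beta>.
          comm_bialgebra R H1 \<and> comm_bialgebra R H2 \<and> comm_bialgebra R H3 \<and>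
          \<alpha> \<in> bialg_hom R H1 H2 \<and> \<beta> \<in> bialg_hom R H2 H3 \<longrightarrow>
          alg_points_map R H1 H3 (compose (carrier H1) \<beta> \<alpha>) =
          compose (carrier (alg_points R H3)) (alg_points_map R H1 H2 \<alpha>) (alg_points_map R H2 H3 \<beta>))
     \<and> (\<forall>(G :: 'g1 monoid) (H :: ('a, 'h1) bialg). monoid G \<and> comm_bialgebra R H \<longrightarrow>
          bij_betw (transpose_hom G H) (mon_hom G (alg_points R H)) (bialg_hom R H (rep_bialg R G)))
     \<and> (\<forall>(G1 :: 'g1 monoid) (G2 :: 'g2 monoid) (H :: ('a, 'h1) bialg) \<psi> \<phi>.
          monoid G1 \<and> monoid G2 \<and> comm_bialgebra R H \<and> \<psi> \<in> mon_hom G1 G2 \<and> \<phi> \<in> mon_hom G2 (alg_points R H) \<longrightarrow>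
          transpose_hom G1 H (compose (carrier G1) \<phi> \<psi>) =
          compose (carrier H) (rep_map R G1 G2 \<psi>) (transpose_hom G2 H \<phi>))
     \<and> (\<forall>(G :: 'g1 monoid) (H1 :: ('a, 'h1) bialg) (H2 :: ('a, 'h2) bialg) \<alpha> \<phi>.
          monoid G \<and> comm_bialgebra R H1 \<and> comm_bialgebra R H2 \<and> \<alpha> \<in> bialg_hom R H1 H2 \<and> \<phi> \<in> mon_hom G (alg_points R H2) \<longrightarrow>
          transpose_hom G H1 (compose (carrier G) (alg_points_map R H1 H2 \<alpha>) \<phi>) =
          compose (carrier H1) (transpose_hom G H2 \<phi>) \<alpha>))
     \<and>
     ((\<forall>G :: 'g1 monoid. group G \<longrightarrow>
          (\<forall>f \<in> carrier (rep_hopf R G). \<exists>!t. is_rep_comul R G f t) \<and> comm_hopf_algebra R (rep_hopf R G))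
     \<and> (\<forall>(G1 :: 'g1 monoid) (G2 :: 'g2 monoid) \<phi>.
          group G1 \<and> group G2 \<and> \<phi> \<in> grp_hom G1 G2 \<longrightarrow>
          rep_map R G1 G2 \<phi> \<in> hopf_hom R (rep_hopf R G2) (rep_hopf R G1))
     \<and> (\<forall>G :: 'g1 monoid. group G \<longrightarrow>
          rep_map R G G (\<lambda>x\<in>carrier G. x) = (\<lambda>f\<in>carrier (rep_hopf R G). f))
     \<and> (\<forall>(G1 :: 'g1 monoid) (G2 :: 'g2 monoid) (G3 :: 'g3 monoid) \<phi> \<psi>.
          group G1 \<and> group G2 \<and> group G3 \<and> \<phi> \<in> grp_hom G1 G2 \<and> \<psi> \<in> grp_hom G2 G3 \<longrightarrow>
          rep_map R G1 G3 (compose (carrier G1) \<psi> \<phi>) =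
          compose (carrier (rep_hopf R G3)) (rep_map R G1 G2 \<phi>) (rep_map R G2 G3 \<psi>))
     \<and> (\<forall>H :: ('a, 'h1) hopf. comm_hopf_algebra R H \<longrightarrow> group (alg_points R H))
     \<and> (\<forall>(H1 :: ('a, 'h1) hopf) (H2 :: ('a, 'h2) hopf) \<alpha>.
          comm_hopf_algebra R H1 \<and> comm_hopf_algebra R H2 \<and> \<alpha> \<in> hopf_hom R H1 H2 \<longrightarrow>
          alg_points_map R H1 H2 \<alpha> \<in> grp_hom (alg_points R H2) (alg_points R H1))
     \<and> (\<forall>H :: ('a, 'h1) hopf. comm_hopf_algebra R H \<longrightarrow>
          alg_points_map R H H (\<lambda>h\<in>carrier H. h) = (\<lambda>p\<in>carrier (alg_points R H). p))
     \<and> (\<forall>(H1 :: ('a, 'h1) hopf) (H2 :: ('a, 'h2) hopf) (H3 :: ('a, 'h3) hopf) \<alpha> \<beta>.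
          comm_hopf_algebra R H1 \<and> comm_hopf_algebra R H2 \<and> comm_hopf_algebra R H3 \<and>
          \<alpha> \<in> hopf_hom R H1 H2 \<and> \<beta> \<in> hopf_hom R H2 H3 \<longrightarrow>
          alg_points_map R H1 H3 (compose (carrier H1) \<beta> \<alpha>) =
          compose (carrier (alg_points R H3)) (alg_points_map R H1 H2 \<alpha>) (alg_points_map R H2 H3 \<beta>))
     \<and> (\<forall>(G :: 'g1 monoid) (H :: ('a, 'h1) hopf). group G \<and> comm_hopf_algebra R H \<longrightarrow>
          bij_betw (transpose_hom G H) (grp_hom G (alg_points R H)) (hopf_hom R H (rep_hopf R G)))
     \<and> (\<forall>(G1 :: 'g1 monoid) (G2 :: 'g2 monoid) (H :: ('a, 'h1) hopf) \<psi> \<phi>.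
          group G1 \<and> group G2 \<and> comm_hopf_algebra R H \<and> \<psi> \<in> grp_hom G1 G2 \<and> \<phi> \<in> grp_hom G2 (alg_points R H) \<longrightarrow>
          transpose_hom G1 H (compose (carrier G1) \<phi> \<psi>) =
          compose (carrier H) (rep_map R G1 G2 \<psi>) (transpose_hom G2 H \<phi>))
     \<and> (\<forall>(G :: 'g1 monoid) (H1 :: ('a, 'h1) hopf) (H2 :: ('a, 'h2) hopf) \<alpha> \<phi>.
          group G \<and> comm_hopf_algebra R H1 \<and> comm_hopf_algebra R H2 \<and> \<alpha> \<in> hopf_hom R H1 H2 \<and> \<phi> \<in> grp_hom G (alg_points R H2) \<longrightarrow>
          transpose_hom G H1 (compose (carrier G) (alg_points_map R H1 H2 \<alpha>) \<phi>) =
          compose (carrier H1) (transpose_hom G H2 \<phi>) \<alpha>))"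
proof (intro conjI allI impI, goal_cases)
  note R = assms(1) and noeth = assms(2) and her = assms(3)
  {
    case (1 G)
    then show ?case using rep_comul_ex1[where G = G, OF R noeth her] by (simp add: rep_carriers)
  next
    case (2 G)
    then show ?case by (rule rep_bialg_comm_bialgebra[OF R noeth her])
  next
    case (3 G1 G2 \<phi>)
    then show ?case
      by (elim conjE) (rule rep_map_bialg_hom[OF R noeth her _ _ _ rep_bialg_eq rep_bialg_eq])
  next
    case (4 G)
    show ?case unfolding rep_carriers by (rule rep_map_id)
  next
    case (5 G1 G2 G3 \<phi> \<psi>)
    then show ?case unfolding rep_carriers by (elim conjE) (rule rep_map_comp[OF R noeth])
  next
    case (6 H)
    then show ?case by (rule alg_points_monoid)
  next
    case (7 H1 H2 \<alpha>)
    then show ?case by (elim conjE) (rule alg_points_map_hom)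
  next
    case (8 H)
    show ?case by (rule alg_points_map_id)
  next
    case (9 H1 H2 H3 \<alpha> \<beta>)
    then show ?case by (elim conjE) (rule alg_points_map_comp)
  next
    case (10 G H)
    then show ?case by (elim conjE) (rule transpose_bij_bialg[OF R noeth her _ _ rep_bialg_eq])
  next
    case (11 G1 G2 H \<psi> \<phi>)
    then show ?case by (elim conjE) (rule transpose_natural_left[OF R noeth])
  next
    case (12 G H1 H2 \<alpha> \<phi>)
    then show ?case by (elim conjE) (rule transpose_natural_right)
  next
    case (13 G)
    then show ?case using rep_comul_ex1[where G = G, OF R noeth her group.is_monoid] by (simp add: rep_carriers)
  next
    case (14 G)
    then show ?case by (rule rep_hopf_comm_hopf_algebra[OF R noeth her])
  next
    case (15 G1 G2 \<phi>)
    then show ?case by (elim conjE) (rule rep_map_hopf_hom[OF R noeth her])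
  next
    case (16 G)
    show ?case unfolding rep_carriers by (rule rep_map_id)
  next
    case (17 G1 G2 G3 \<phi> \<psi>)
    then have "\<phi> \<in> mon_hom G1 G2" "\<psi> \<in> mon_hom G2 G3" "monoid G2" "monoid G3"
      using grp_hom_eq_mon_hom[of G1 G2] grp_hom_eq_mon_hom[of G2 G3] by (auto intro: group.is_monoid)
    then show ?case unfolding rep_carriers by (intro rep_map_comp[OF R noeth])
  next
    case (18 H)
    then show ?case by (rule alg_points_group)
  next
    case (19 H1 H2 \<alpha>)
    then have H: "comm_bialgebra R H1" "comm_bialgebra R H2" and \<alpha>: "\<alpha> \<in> bialg_hom R H1 H2"
      and P: "group (alg_points R H2)" "group (alg_points R H1)"
      by (auto simp: hopf_hom_def intro: hopf_bialg alg_points_group)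
    show ?case unfolding grp_hom_eq_mon_hom[OF P] by (rule alg_points_map_hom[OF H \<alpha>])
  next
    case (20 H)
    show ?case by (rule alg_points_map_id)
  next
    case (21 H1 H2 H3 \<alpha> \<beta>)
    then have "comm_bialgebra R H2" "comm_bialgebra R H3" "\<alpha> \<in> bialg_hom R H1 H2" "\<beta> \<in> bialg_hom R H2 H3"
      by (auto simp: hopf_hom_def intro: hopf_bialg)
    then show ?case by (rule alg_points_map_comp)
  next
    case (22 G H)
    then show ?case by (elim conjE) (rule transpose_bij_hopf[OF R noeth her])
  next
    case (23 G1 G2 H \<psi> \<phi>)
    then have "monoid G2" "comm_bialgebra R H" "\<psi> \<in> mon_hom G1 G2" "\<phi> \<in> mon_hom G2 (alg_points R H)"
      using grp_hom_eq_mon_hom[of G1 G2] grp_hom_eq_mon_hom[of G2 "alg_points R H"]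
      by (auto intro: group.is_monoid hopf_bialg alg_points_group)
    then show ?case by (rule transpose_natural_left[OF R noeth])
  next
    case (24 G H1 H2 \<alpha> \<phi>)
    then have "comm_bialgebra R H1" "comm_bialgebra R H2" "\<alpha> \<in> bialg_hom R H1 H2" "\<phi> \<in> mon_hom G (alg_points R H2)"
      using grp_hom_eq_mon_hom[of G "alg_points R H2"]
      by (auto simp: hopf_hom_def intro: hopf_bialg alg_points_group)
    then show ?case by (rule transpose_natural_right)
  }
qed

end
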